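(* Select $m,M,N,\nu\in\mathbb N$ satisfying $$M\ge2,\qquad m\ge2\qquad\text{and}\qquad 2\nu-M-5/2-(m+1)-N\ge0 .$$ Let $\{v_\varepsilon^a\}_\varepsilon$ and $\{q_\varepsilon^a\}_\varepsilon$ be the families of approximate velocities and pressures described in the context. Then, for all $T>0$ and all $j\in\{1,2\}$, $$\sup_{\varepsilon\in]0,1]}\ \sup_{t\in[0,T]}\ \bigl\|\varepsilon^{-N}\mathcal L_j(\varepsilon,q_\varepsilon^a,v_\varepsilon^a)(t,\cdot)\bigr\|_{H^m(\mathbb T\times\mathbb R)}<+\infty .$$
   Context: Fixed data: constants $\mu,\lambda>0$, $\gamma>1$, $C=(\gamma-1)/2$; $\mathbb T=\mathbb R/\mathbb Z$; $h\in C^\infty(\mathbb T;\mathbb R)$ with $\int_{\mathbb T}h\,d\theta=0$. Functions depend on $t\ge0$ (or $\tau\ge0$) and $(\theta,y)\in\mathbb T\times\mathbb R$. Notation: $H^\infty=\bigcap_jH^j$. $\mathcal H_T^{m,n}$ is the space of $f$ with $f\in C^j([0,T];H^{m-j}(\mathbb T\times\mathbb R))$ for $0\le j\le n$; $\mathcal H_T^\infty=\bigcap_m\mathcal H_T^{m,m}$, $\mathcal H_T^{\infty,0}=\bigcap_m\mathcal H_T^{m,0}$. $\mathcal E_\delta^\infty$ is the set of $f$ with $\sup_{\tau\ge0}e^{\delta\tau}\|f(\tau,\cdot)\|_{H^s(\mathbb T\times\mathbb R)}<\infty$ for all $s\in\mathbb N$. With $\partial^\alpha=\partial_\theta^{\alpha_1}\partial_y^{\alpha_2}$,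 $\|f\|_{H^m_{(1,\varepsilon)}}=\sum_{|\alpha|\le m}\|\varepsilon^{\alpha_1}\partial^\alpha f\|_{L^2}$. $\Pi u=\int_{\mathbb T}u\,d\theta$; $\partial_\theta^{-1}$ is the inverse of $\partial_\theta$ on mean-zero functions, with mean-zero values. Operators, for $v=(v^1,v^2)$: $$\widetilde{\mathcal P}_\varepsilon^1v=\varepsilon^{-2}\bigl[\mu(\partial_{\theta\theta}v^1+\varepsilon^2\partial_{yy}v^1)+\lambda\varepsilon(\partial_{\theta\theta}v^1+\varepsilon\partial_{\theta y}v^2)\bigr],$$ $$\widetilde{\mathcal P}_\varepsilon^2v=\varepsilon^{-2}\bigl[\mu(\partial_{\theta\theta}v^2+\varepsilon^2\partial_{yy}v^2)+\lambda\varepsilon(\varepsilon\partial_{\theta y}v^1+\varepsilon^2\partial_{yy}v^2)\bigr],$$ $$\mathcal L_1^a(\varepsilon,v)=\partial_tv^1+\varepsilon^{-1}h\partial_yv^1+\varepsilon^{M-2}(v^1\partial_\theta v^1+\varepsilon v^2\partial_yv^1)-\widetilde{\mathcal P}_\varepsilon^1v,$$ $$\mathcal L_2^a(\varepsilon,v)=\partial_tv^2+\varepsilon^{-1}h\partial_yv^2+\varepsilon^{-2}\partial_\theta h\,v^1+\varepsilon^{M-2}(v^1\partial_\theta v^2+\varepsilon v^2\partial_yv^2)-\widetilde{\mathcal P}_\varepsilon^2v,$$ $$\mathcal L_1(\varepsilon,q,v)=\mathcal L_1^a(\varepsilon,v)+C\varepsilon^{2\nu-M-2}q\,\partial_\theta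 q,\qquad \mathcal L_2(\varepsilon,q,v)=\mathcal L_2^a(\varepsilon,v)+C\varepsilon^{2\nu-M-1}q\,\partial_yq,$$ $$\mathcal L_0(\varepsilon,q,v)=\partial_tq+\varepsilon^{-1}h\partial_yq+\varepsilon^{M-2}(v^1\partial_\theta q+\varepsilon v^2\partial_yq)+C\varepsilon^{M-2}q(\partial_\theta v^1+\varepsilon\partial_yv^2).$$ Approximate velocities: for given $\delta\in]0,\mu[$ and $v_k^0\in H^\infty(\mathbb T\times\mathbb R;\mathbb R^2)$ ($0\le k\le N+1$), $v_\varepsilon^a(t,\theta,y)=\sum_{k=0}^{N+1}\varepsilon^k\bigl(v_k^s(t,\theta,y)+v_k^f(t/\varepsilon^2,\theta,y)\bigr)$ with $v_k^s\in\bigcap_{T>0}\mathcal H_T^\infty$, $v_k^f\in\mathcal E_\delta^\infty$, such that (i) $v_\varepsilon^a(0,\cdot)=\sum_{k}\varepsilon^kv_k^0$; (ii) for all $T>0$, $m'\in\mathbb N$, $j\in\{1,2\}$: $\sup_{\varepsilon\in]0,1]}\sup_{t\in[0,T]}\|\varepsilon^{-N}\mathcal L_j^a(\varepsilon,v_\varepsilon^a)\|_{H^{m'}}<\infty$; and $\partial_t\Pi v_k^s-(\mu+\frac1\mu\Pi((\partial_\theta^{-1}h)^2))\partial_{yy}\Pi v_k^s=S_k$ with $S_k$ depending only on the $v_j^s$, $j\le k-1$. Approximate pressures: for given real-valued $q_k^0\in H^\infty(\mathbb T\times\mathbb R)$ ($0\le k\le N+1$), $q_\varepsilon^a=\sum_{k=0}^{N+1}\varepsilon^kq_k^\varepsilon$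 with $q_k^\varepsilon\in\bigcap_{T>0}\mathcal H_T^{\infty,0}$, such that $\mathcal L_0(\varepsilon,q_\varepsilon^a,v_\varepsilon^a)=0$, $q_\varepsilon^a(0,\cdot)=\sum_k\varepsilon^kq_k^0$, and $\sup_{\varepsilon\in]0,1]}\sup_{t\in[0,T]}\|q_k^\varepsilon(t,\cdot)\|_{H^{m'}_{(1,\varepsilon)}}<\infty$ for all $T>0$, $m'\in\mathbb N$, $k$. *)

theory Defs
  imports "HOL-Analysis.Analysis"
begin

text \<open>
  Functions on the cylinder (circle of length 1) x R are Borel functions on R x R that are
  1-periodic in the first variable; elements of Lebesgue and Sobolev spaces are represented by such
  functions, and equalities between them are equalities almost everywhere.
\<close>

type_synonym field = "real \<times> real \<Rightarrow> real"
type_synonym vfield = "real \<times> real \<Rightarrow> real ^ 2"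

definition theta_periodic :: "field \<Rightarrow> bool" where
  "theta_periodic f \<longleftrightarrow> (\<forall>x y. f (x + 1, y) = f (x, y))"

definition cyl :: "(real \<times> real) measure" where
  "cyl = restrict_space lborel ({0..<1} \<times> UNIV)"

definition L2_cyl :: "field set" where
  "L2_cyl = {f \<in> borel_measurable borel. theta_periodic f \<and> integrable cyl (\<lambda>p. (f p)\<^sup>2)}"

text \<open>All norms take values in the extended nonnegative reals and are infinite outside their
  space, so that finiteness of a norm, or of a supremum of norms, includes membership.\<close>

definition L2_norm :: "field \<Rightarrow> ennreal" where
  "L2_norm f = (if f \<in> L2_cyl then ennreal (sqrt (LINT p|cyl. (f p)\<^sup>2)) else \<infinity>)"

definition loc_integrable :: "field \<Rightarrow> bool" where
  "loc_integrable f \<longleftrightarrow> f \<in> borel_measurable borel \<and> theta_periodic f \<and>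
     (\<forall>R. set_integrable lborel ({0..1} \<times> {-R..R}) f)"

text \<open>\<^term>\<open>D 0 0\<close> is a compactly supported smooth function on the cylinder, and \<^term>\<open>D i j\<close> is
  its partial derivative of order i in the first and j in the second variable.\<close>

definition test_jet :: "(nat \<Rightarrow> nat \<Rightarrow> field) \<Rightarrow> bool" where
  "test_jet D \<longleftrightarrow>
     (\<forall>i j. theta_periodic (D i j) \<and> continuous_on UNIV (D i j) \<and>
        (\<forall>x y. ((\<lambda>s. D i j (s, y)) has_real_derivative D (Suc i) j (x, y)) (at x) \<and>
               ((\<lambda>s. D i j (x, s)) has_real_derivative D i (Suc j) (x, y)) (at y))) \<and>
     (\<exists>R. \<forall>x y. \<bar>y\<bar> > R \<longrightarrow> D 0 0 (x, y) = 0)"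

definition weak_deriv :: "nat \<Rightarrow> nat \<Rightarrow> field \<Rightarrow> field \<Rightarrow> bool" where
  "weak_deriv i j f g \<longleftrightarrow> loc_integrable f \<and> loc_integrable g \<and>
     (\<forall>D. test_jet D \<longrightarrow>
        (LINT p|cyl. f p * D i j p) = (-1) ^ (i + j) * (LINT p|cyl. g p * D 0 0 p))"

text \<open>The weak derivative of order i in the first and j in the second variable; if it exists, it
  is determined up to null sets.\<close>

definition pd :: "nat \<Rightarrow> nat \<Rightarrow> field \<Rightarrow> field" where
  "pd i j f = (SOME g. weak_deriv i j f g)"

definition Sob :: "nat \<Rightarrow> field set" where
  "Sob m = {f \<in> L2_cyl. \<forall>i j. i + j \<le> m \<longrightarrow> (\<exists>g \<in> L2_cyl. weak_deriv i j f g)}"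

definition Sob_inf :: "field set" where
  "Sob_inf = (\<Inter>m. Sob m)"

definition Hnorm_w :: "real \<Rightarrow> nat \<Rightarrow> field \<Rightarrow> ennreal" where
  "Hnorm_w \<epsilon> m f =
     (if f \<in> Sob m then \<Sum>(i, j) \<in> {(i, j). i + j \<le> m}. L2_norm (\<lambda>p. \<epsilon> ^ i * pd i j f p) else \<infinity>)"

abbreviation Hnorm :: "nat \<Rightarrow> field \<Rightarrow> ennreal" where
  "Hnorm \<equiv> Hnorm_w 1"

text \<open>The space of j times continuously differentiable maps from [0,T] to the Sobolev space of
  order s; here \<^term>\<open>F i\<close> is the i-th time derivative.\<close>

definition C_Sob :: "real \<Rightarrow> nat \<Rightarrow> nat \<Rightarrow> (real \<Rightarrow> field) set" where
  "C_Sob T j s = {f. \<exists>F. F 0 = f \<and>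
     (\<forall>i\<le>j. \<forall>t\<in>{0..T}. F i t \<in> Sob s \<and>
        ((\<lambda>r. Hnorm s (\<lambda>p. F i r p - F i t p)) \<longlongrightarrow> 0) (at t within {0..T})) \<and>
     (\<forall>i<j. \<forall>t\<in>{0..T}.
        ((\<lambda>r. Hnorm s (\<lambda>p. (F i r p - F i t p) / (r - t) - F (Suc i) t p)) \<longlongrightarrow> 0)
          (at t within {0..T}))}"

text \<open>Only used for \<^prop>\<open>n \<le> m\<close>.\<close>

definition HT :: "real \<Rightarrow> nat \<Rightarrow> nat \<Rightarrow> (real \<Rightarrow> field) set" where
  "HT T m n = {f. \<forall>j\<le>n. f \<in> C_Sob T j (m - j)}"

definition HT_inf :: "real \<Rightarrow> (real \<Rightarrow> field) set" where
  "HT_inf T = (\<Inter>m. HT T m m)"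

definition HT_inf0 :: "real \<Rightarrow> (real \<Rightarrow> field) set" where
  "HT_inf0 T = (\<Inter>m. HT T m 0)"

definition E_inf :: "real \<Rightarrow> (real \<Rightarrow> field) set" where
  "E_inf \<delta> = {f. \<forall>s. (SUP \<tau>\<in>{0..}. ennreal (exp (\<delta> * \<tau>)) * Hnorm s (f \<tau>)) < \<infinity>}"

text \<open>Time derivative on \<^term>\<open>{0::real..}\<close>, as a limit of difference quotients in the mean
  square; one-sided at 0.\<close>

definition has_dt :: "(real \<Rightarrow> field) \<Rightarrow> real \<Rightarrow> field \<Rightarrow> bool" where
  "has_dt f t g \<longleftrightarrow> g \<in> L2_cyl \<and>
     ((\<lambda>r. L2_norm (\<lambda>p. (f r p - f t p) / (r - t) - g p)) \<longlongrightarrow> 0) (at t within {0..})"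

definition dt :: "(real \<Rightarrow> field) \<Rightarrow> real \<Rightarrow> field" where
  "dt f t = (SOME g. has_dt f t g)"

definition dt_exists :: "(real \<Rightarrow> field) \<Rightarrow> bool" where
  "dt_exists f \<longleftrightarrow> (\<forall>t\<ge>0. \<exists>g. has_dt f t g)"

definition vcomp :: "(real \<Rightarrow> vfield) \<Rightarrow> 2 \<Rightarrow> real \<Rightarrow> field" where
  "vcomp v j = (\<lambda>t p. v t p $ j)"

text \<open>Averages over the circle are regarded as functions on the cylinder that do not depend on the
  first variable.\<close>

definition circle_avg :: "field \<Rightarrow> field" where
  "circle_avg u = (\<lambda>p. LINT s:{0..<1}|lborel. u (s, snd p))"

definition circle_smooth :: "(real \<Rightarrow> real) \<Rightarrow> bool" where
  "circle_smooth h \<longleftrightarrow> (\<forall>x. h (x + 1) = h x) \<and> (\<forall>n x. (deriv ^^ n) h field_differentiable at x)"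

definition mean_zero :: "(real \<Rightarrow> real) \<Rightarrow> bool" where
  "mean_zero h \<longleftrightarrow> (LINT s:{0..<1}|lborel. h s) = 0"

definition dtheta_inv :: "(real \<Rightarrow> real) \<Rightarrow> real \<Rightarrow> real" where
  "dtheta_inv h = (THE H. (\<forall>x. (H has_real_derivative h x) (at x)) \<and>
                          (\<forall>x. H (x + 1) = H x) \<and> mean_zero H)"

definition P1 :: "real \<Rightarrow> real \<Rightarrow> real \<Rightarrow> (real \<Rightarrow> vfield) \<Rightarrow> real \<Rightarrow> field" where
  "P1 \<mu> lam \<epsilon> v t p = \<epsilon> powi (-2) *
     (\<mu> * (pd 2 0 (vcomp v 1 t) p + \<epsilon>\<^sup>2 * pd 0 2 (vcomp v 1 t) p) +
      lam * \<epsilon> * (pd 2 0 (vcomp v 1 t) p + \<epsilon> * pd 1 1 (vcomp v 2 t) p))"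

definition P2 :: "real \<Rightarrow> real \<Rightarrow> real \<Rightarrow> (real \<Rightarrow> vfield) \<Rightarrow> real \<Rightarrow> field" where
  "P2 \<mu> lam \<epsilon> v t p = \<epsilon> powi (-2) *
     (\<mu> * (pd 2 0 (vcomp v 2 t) p + \<epsilon>\<^sup>2 * pd 0 2 (vcomp v 2 t) p) +
      lam * \<epsilon> * (\<epsilon> * pd 1 1 (vcomp v 1 t) p + \<epsilon>\<^sup>2 * pd 0 2 (vcomp v 2 t) p))"

definition L1a ::
  "real \<Rightarrow> real \<Rightarrow> (real \<Rightarrow> real) \<Rightarrow> nat \<Rightarrow> real \<Rightarrow> (real \<Rightarrow> vfield) \<Rightarrow> real \<Rightarrow> field" where
  "L1a \<mu> lam h M \<epsilon> v t p =
     dt (vcomp v 1) t p + \<epsilon> powi (-1) * h (fst p) * pd 0 1 (vcomp v 1 t) p +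
     \<epsilon> powi (int M - 2) * (vcomp v 1 t p * pd 1 0 (vcomp v 1 t) p +
                          \<epsilon> * vcomp v 2 t p * pd 0 1 (vcomp v 1 t) p) -
     P1 \<mu> lam \<epsilon> v t p"

definition L2a ::
  "real \<Rightarrow> real \<Rightarrow> (real \<Rightarrow> real) \<Rightarrow> nat \<Rightarrow> real \<Rightarrow> (real \<Rightarrow> vfield) \<Rightarrow> real \<Rightarrow> field" where
  "L2a \<mu> lam h M \<epsilon> v t p =
     dt (vcomp v 2) t p + \<epsilon> powi (-1) * h (fst p) * pd 0 1 (vcomp v 2 t) p +
     \<epsilon> powi (-2) * deriv h (fst p) * vcomp v 1 t p +
     \<epsilon> powi (int M - 2) * (vcomp v 1 t p * pd 1 0 (vcomp v 2 t) p +
                          \<epsilon> * vcomp v 2 t p * pd 0 1 (vcomp v 2 t) p) -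
     P2 \<mu> lam \<epsilon> v t p"

definition La ::
  "real \<Rightarrow> real \<Rightarrow> (real \<Rightarrow> real) \<Rightarrow> nat \<Rightarrow> 2 \<Rightarrow> real \<Rightarrow> (real \<Rightarrow> vfield) \<Rightarrow> real \<Rightarrow> field" where
  "La \<mu> lam h M j \<epsilon> v t p = (if j = 1 then L1a \<mu> lam h M \<epsilon> v t p else L2a \<mu> lam h M \<epsilon> v t p)"

definition L_op ::
  "real \<Rightarrow> real \<Rightarrow> real \<Rightarrow> (real \<Rightarrow> real) \<Rightarrow> nat \<Rightarrow> nat \<Rightarrow> 2 \<Rightarrow>
   real \<Rightarrow> (real \<Rightarrow> field) \<Rightarrow> (real \<Rightarrow> vfield) \<Rightarrow> real \<Rightarrow> field" where
  "L_op \<mu> lam C h M \<nu> j \<epsilon> q v t p = La \<mu> lam h M j \<epsilon> v t p +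
     (if j = 1 then C * \<epsilon> powi (2 * int \<nu> - int M - 2) * q t p * pd 1 0 (q t) p
      else C * \<epsilon> powi (2 * int \<nu> - int M - 1) * q t p * pd 0 1 (q t) p)"

definition L0 ::
  "real \<Rightarrow> (real \<Rightarrow> real) \<Rightarrow> nat \<Rightarrow>
   real \<Rightarrow> (real \<Rightarrow> field) \<Rightarrow> (real \<Rightarrow> vfield) \<Rightarrow> real \<Rightarrow> field" where
  "L0 C h M \<epsilon> q v t p =
     dt q t p + \<epsilon> powi (-1) * h (fst p) * pd 0 1 (q t) p +
     \<epsilon> powi (int M - 2) * (vcomp v 1 t p * pd 1 0 (q t) p + \<epsilon> * vcomp v 2 t p * pd 0 1 (q t) p) +
     C * \<epsilon> powi (int M - 2) * q t p * (pd 1 0 (vcomp v 1 t) p + \<epsilon> * pd 0 1 (vcomp v 2 t) p)"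

definition v_app ::
  "nat \<Rightarrow> (nat \<Rightarrow> real \<Rightarrow> vfield) \<Rightarrow> (nat \<Rightarrow> real \<Rightarrow> vfield) \<Rightarrow> real \<Rightarrow> real \<Rightarrow> vfield" where
  "v_app N vs vf \<epsilon> t p = (\<Sum>k\<le>N + 1. \<epsilon> ^ k *\<^sub>R (vs k t p + vf k (t / \<epsilon>\<^sup>2) p))"

definition q_app :: "nat \<Rightarrow> (nat \<Rightarrow> real \<Rightarrow> real \<Rightarrow> field) \<Rightarrow> real \<Rightarrow> real \<Rightarrow> field" where
  "q_app N q \<epsilon> t p = (\<Sum>k\<le>N + 1. \<epsilon> ^ k * q k \<epsilon> t p)"

text \<open>The k-th source term \<^term>\<open>S k\<close> is a functional that only receives the slow profiles with index
  below k. The slow profiles are smooth in time, but membership of the fast ones in \<^term>\<open>E_inf \<delta>\<close>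
  says nothing about time derivatives; the condition \<^term>\<open>dt_exists\<close> makes explicit that the time
  derivative in \<^term>\<open>La\<close> exists (likewise for the pressures and \<^term>\<open>L0\<close>).\<close>

definition approx_velocities ::
  "real \<Rightarrow> real \<Rightarrow> (real \<Rightarrow> real) \<Rightarrow> nat \<Rightarrow> nat \<Rightarrow> real \<Rightarrow> (nat \<Rightarrow> vfield) \<Rightarrow>
   (nat \<Rightarrow> (nat \<Rightarrow> real \<Rightarrow> vfield) \<Rightarrow> real \<Rightarrow> real \<Rightarrow> real ^ 2) \<Rightarrow>
   (nat \<Rightarrow> real \<Rightarrow> vfield) \<Rightarrow> (nat \<Rightarrow> real \<Rightarrow> vfield) \<Rightarrow> bool" where
  "approx_velocities \<mu> lam h M N \<delta> v0 S vs vf \<longleftrightarrow>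
     (\<forall>k\<le>N + 1. \<forall>j. (\<lambda>p. v0 k p $ j) \<in> Sob_inf) \<and>
     (\<forall>k\<le>N + 1. \<forall>j. (\<forall>T>0. vcomp (vs k) j \<in> HT_inf T) \<and> vcomp (vf k) j \<in> E_inf \<delta>) \<and>
     (\<forall>\<epsilon>\<in>{0<..1}. AE p in cyl. v_app N vs vf \<epsilon> 0 p = (\<Sum>k\<le>N + 1. \<epsilon> ^ k *\<^sub>R v0 k p)) \<and>
     (\<forall>\<epsilon>\<in>{0<..1}. \<forall>j. dt_exists (vcomp (v_app N vs vf \<epsilon>) j)) \<and>
     (\<forall>T>0. \<forall>m' j.
        (SUP \<epsilon>\<in>{0<..1}. SUP t\<in>{0..T}.
           Hnorm m' (\<lambda>p. \<epsilon> powi (- int N) * La \<mu> lam h M j \<epsilon> (v_app N vs vf \<epsilon>) t p)) < \<infinity>) \<and>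
     (\<forall>k\<le>N + 1. \<forall>j. \<forall>t\<ge>0. AE p in cyl.
        dt (\<lambda>r. circle_avg (vcomp (vs k) j r)) t p -
        (\<mu> + 1 / \<mu> * (LINT s:{0..<1}|lborel. (dtheta_inv h s)\<^sup>2)) *
          pd 0 2 (circle_avg (vcomp (vs k) j t)) p =
        S k (restrict vs {..<k}) t (snd p) $ j)"

definition approx_pressures ::
  "real \<Rightarrow> (real \<Rightarrow> real) \<Rightarrow> nat \<Rightarrow> nat \<Rightarrow> (real \<Rightarrow> real \<Rightarrow> vfield) \<Rightarrow> (nat \<Rightarrow> field) \<Rightarrow>
   (nat \<Rightarrow> real \<Rightarrow> real \<Rightarrow> field) \<Rightarrow> bool" where
  "approx_pressures C h M N va q0 q \<longleftrightarrow>
     (\<forall>k\<le>N + 1. q0 k \<in> Sob_inf) \<and>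
     (\<forall>k\<le>N + 1. \<forall>\<epsilon>\<in>{0<..1}. \<forall>T>0. q k \<epsilon> \<in> HT_inf0 T) \<and>
     (\<forall>\<epsilon>\<in>{0<..1}. dt_exists (q_app N q \<epsilon>) \<and>
        (\<forall>t\<ge>0. AE p in cyl. L0 C h M \<epsilon> (q_app N q \<epsilon>) (va \<epsilon>) t p = 0)) \<and>
     (\<forall>\<epsilon>\<in>{0<..1}. AE p in cyl. q_app N q \<epsilon> 0 p = (\<Sum>k\<le>N + 1. \<epsilon> ^ k * q0 k p)) \<and>
     (\<forall>T>0. \<forall>m'. \<forall>k\<le>N + 1.
        (SUP \<epsilon>\<in>{0<..1}. SUP t\<in>{0..T}. Hnorm_w \<epsilon> m' (q k \<epsilon> t)) < \<infinity>)"

end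

theory Submission
  imports Defs
begin

text \<open>The operators \<^const>\<open>L_op\<close> and \<^const>\<open>La\<close> differ by the pressure terms
  \<open>C \<epsilon>\<^bsup>2\<nu>-M-2\<^esup> q \<partial>\<^sub>\<theta>q\<close> and \<open>C \<epsilon>\<^bsup>2\<nu>-M-1\<^esup> q \<partial>\<^sub>yq\<close>. Since the contribution of
  \<^const>\<open>La\<close> is bounded by assumption, the theorem is an estimate of these two products in the Sobolev
  space of order m, with an explicit count of the powers of \<open>\<epsilon>\<close>.

  A bound B on the norm of q with weights \<open>\<epsilon>\<^sup>i\<close> says that a derivative of order i in the angle has
  square norm at most \<open>B \<epsilon>\<^bsup>-i\<^esup>\<close>. A pointwise bound costs one more factor: the value of a function at
  a point is a sum of weighted averages over a unit square of the function, its two first derivatives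
  and its mixed derivative, so that a derivative of order i in the angle is pointwise at most \<open>4 B \<epsilon>\<^bsup>-(i+1)\<^esup>\<close> (lemma
  \<open>anisotropic_sobolev\<close>). In the Leibniz formula for a derivative of order at most m of
  \<open>q \<partial>\<^sub>\<theta>q\<close> the first factor is taken in the supremum norm and the second one in the square norm; in total
  at most \<open>\<epsilon>\<^bsup>-(m+2)\<^esup>\<close> is lost, respectively \<open>\<epsilon>\<^bsup>-(m+1)\<^esup>\<close> for \<open>q \<partial>\<^sub>yq\<close> (lemma
  \<open>Hnorm_quadratic_bound\<close>). The optimal anisotropic Sobolev inequality would lose only \<open>\<epsilon>\<^bsup>-1/2\<^esup>\<close> in
  place of \<open>\<epsilon>\<^bsup>-1\<^esup>\<close> for the supremum. The weaker one suffices because the exponents are integers: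
  \<open>2\<nu> - M - 5/2 - (m+1) - N \<ge> 0\<close> means \<open>2\<nu> - M - 2 - N \<ge> m + 2\<close>.

  The derivatives are weak, so the Leibniz formula has to be justified. A function with square
  integrable weak derivatives of all orders agrees almost everywhere with a smooth function whose
  classical derivatives are its weak derivatives (lemma \<open>smooth_representative\<close>). This is proved by
  duality. An average of translates of a weak derivative, tested against \<open>\<phi>\<close>, equals up to
  sign the function itself, tested against the reflected average of a derivative of \<open>\<phi>\<close>; for the
  smooth function \<open>\<phi>\<close> the latter is computed with the fundamental theorem of calculus. Averages over the
  unit square give the representation formula above, whose right-hand side is continuous, and averages
  over segments show that the continuous representatives are derivatives of each other. Identities
  between integrals against test functions become identities almost everywhere by
  \<open>fundamental_lemma\<close>.\<close>

section \<open>Translation invariance on the cylinder\<close>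

lemma space_cyl: "space cyl = {0..<1} \<times> UNIV"
  by (simp add: cyl_def space_restrict_space)

lemma strip_borel [measurable]: "{0..<1} \<times> UNIV \<in> sets (borel :: (real \<times> real) measure)"
proof -
  have "{0..<1::real} \<times> (UNIV :: real set) \<in> sets (borel \<Otimes>\<^sub>M borel)"
    by (rule pair_measureI) auto
  then show ?thesis by (simp only: borel_prod)
qed

lemma fst_borel [measurable]: "fst \<in> borel_measurable (borel :: (real \<times> real) measure)"
  and snd_borel [measurable]: "snd \<in> borel_measurable (borel :: (real \<times> real) measure)"
  by (auto intro!: borel_measurable_continuous_onI continuous_intros)

lemma measurable_cyl [intro]:
  "f \<in> measurable borel N \<Longrightarrow> f \<in> measurable cyl N"
  by (simp add: cyl_def measurable_restrict_space1)

lemma sigma_finite_cyl: "sigma_finite_measure cyl"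
  unfolding cyl_def by (rule sigma_finite_measure_restrict_space) (auto simp: lborel.sigma_finite_measure_axioms)

lemma nn_integral_cyl:
  assumes [measurable]: "f \<in> borel_measurable borel"
  shows "(\<integral>\<^sup>+p. f p \<partial>cyl) = (\<integral>\<^sup>+y. \<integral>\<^sup>+x. f (x, y) * indicator {0..<1} x \<partial>lborel \<partial>lborel)"
proof -
  have [measurable]: "f \<in> borel_measurable (borel \<Otimes>\<^sub>M borel)"
    using assms by (simp only: borel_prod)
  have "(\<integral>\<^sup>+p. f p \<partial>cyl) = (\<integral>\<^sup>+p. f p * indicator ({0..<1} \<times> UNIV) p \<partial>(lborel \<Otimes>\<^sub>M lborel))"
    unfolding cyl_def lborel_prod by (rule nn_integral_restrict_space) simp
  also have "\<dots> = (\<integral>\<^sup>+y. \<integral>\<^sup>+x. f (x, y) * indicator {0..<1} x \<partial>lborel \<partial>lborel)"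
    by (subst lborel_pair.nn_integral_snd[where f="\<lambda>p. f p * indicator ({0..<1} \<times> UNIV) p", symmetric])
     (simp_all add: indicator_times)
  finally show ?thesis .
qed

lemma periodic_int_shift:
  assumes "\<And>x. f (x + 1) = f x"
  shows "f (x + of_int n) = f (x::real)"
proof -
  have nat: "f (x + of_nat k) = f x" for x k
  proof (induction k)
    case (Suc k)
    have "f (x + of_nat (Suc k)) = f ((x + of_nat k) + 1)" by (simp add: ac_simps)
    then show ?case using Suc assms by simp
  qed simp
  show ?thesis
  proof (cases "n \<ge> 0")
    case True
    then show ?thesis using nat[of x "nat n"] by simp
  next
    case False
    then show ?thesis using nat[of "x + of_int n" "nat (-n)"] by simp
  qed
qed

text \<open>Only the fractional part r of the translation matters. The translated period \<open>[r, 1 + r)\<close> is cut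
  at 1 and its right piece is moved back by one period.\<close>

lemma nn_integral_period_shift:
  fixes f :: "real \<Rightarrow> ennreal"
  assumes [measurable]: "f \<in> borel_measurable borel" and per: "\<And>x. f (x + 1) = f x"
  shows "(\<integral>\<^sup>+x. f (x + a) * indicator {0..<1} x \<partial>lborel) = (\<integral>\<^sup>+x. f x * indicator {0..<1} x \<partial>lborel)"
proof -
  define r where "r = frac a"
  have r: "0 \<le> r" "r < 1" by (auto simp: r_def frac_lt_1)
  have fr: "f (x + a) = f (x + r)" for x
    using periodic_int_shift[of f "x + r" "\<lfloor>a\<rfloor>", OF per] by (simp add: r_def frac_def algebra_simps)
  have shift: "(\<integral>\<^sup>+x. g x \<partial>lborel) = (\<integral>\<^sup>+x. g (x + c) \<partial>lborel)"
    if [measurable]: "g \<in> borel_measurable borel" for g :: "real \<Rightarrow> ennreal" and c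
    using nn_integral_real_affine[of g 1 c] by (simp add: add.commute)
  have "(\<integral>\<^sup>+x. f (x + a) * indicator {0..<1} x \<partial>lborel)
      = (\<integral>\<^sup>+x. f (x + r) * indicator {r..<1} (x + r) + f (x + r) * indicator {1..<1+r} (x + r) \<partial>lborel)"
    unfolding fr by (intro nn_integral_cong) (use r in \<open>auto simp: indicator_def\<close>)
  also have "\<dots> = (\<integral>\<^sup>+x. f (x + r) * indicator {r..<1} (x + r) \<partial>lborel)
      + (\<integral>\<^sup>+x. f (x + r) * indicator {1..<1+r} (x + r) \<partial>lborel)"
    by (rule nn_integral_add) auto
  also have "(\<integral>\<^sup>+x. f (x + r) * indicator {r..<1} (x + r) \<partial>lborel)
      = (\<integral>\<^sup>+x. f x * indicator {r..<1} x \<partial>lborel)"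
    by (rule shift[symmetric]) measurable
  also have "(\<integral>\<^sup>+x. f (x + r) * indicator {1..<1+r} (x + r) \<partial>lborel)
      = (\<integral>\<^sup>+x. f x * indicator {1..<1+r} x \<partial>lborel)"
    by (rule shift[symmetric]) measurable
  also have "\<dots> = (\<integral>\<^sup>+x. f (x + 1) * indicator {1..<1+r} (x + 1) \<partial>lborel)"
    by (rule shift) measurable
  also have "\<dots> = (\<integral>\<^sup>+x. f x * indicator {0..<r} x \<partial>lborel)"
    by (intro nn_integral_cong) (auto simp: indicator_def per)
  also have "(\<integral>\<^sup>+x. f x * indicator {r..<1} x \<partial>lborel) + \<dots>
      = (\<integral>\<^sup>+x. f x * indicator {r..<1} x + f x * indicator {0..<r} x \<partial>lborel)"
    by (rule nn_integral_add[symmetric]) auto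
  also have "\<dots> = (\<integral>\<^sup>+x. f x * indicator {0..<1} x \<partial>lborel)"
    by (intro nn_integral_cong) (use r in \<open>auto simp: indicator_def\<close>)
  finally show ?thesis .
qed

lemma nn_integral_cyl_shift:
  assumes [measurable]: "f \<in> borel_measurable borel" and per: "\<And>x y. f (x + 1, y) = f (x, y)"
  shows "(\<integral>\<^sup>+p. f (p + c) \<partial>cyl) = (\<integral>\<^sup>+p. f p \<partial>cyl)"
proof -
  obtain a b where c: "c = (a, b)" by (cases c)
  have [measurable]: "f \<in> borel_measurable (borel \<Otimes>\<^sub>M borel)"
    by (simp add: borel_prod)
  have "(\<integral>\<^sup>+p. f (p + c) \<partial>cyl)
      = (\<integral>\<^sup>+y. \<integral>\<^sup>+x. f (x + a, y + b) * indicator {0..<1} x \<partial>lborel \<partial>lborel)"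
    by (subst nn_integral_cyl) (auto simp: c)
  also have "\<dots> = (\<integral>\<^sup>+y. \<integral>\<^sup>+x. f (x, y + b) * indicator {0..<1} x \<partial>lborel \<partial>lborel)"
    by (intro nn_integral_cong nn_integral_period_shift) (auto simp: per)
  also have "\<dots> = (\<integral>\<^sup>+y. \<integral>\<^sup>+x. f (x, y) * indicator {0..<1} x \<partial>lborel \<partial>lborel)"
    using nn_integral_real_affine[of "\<lambda>y. \<integral>\<^sup>+x. f (x, y) * indicator {0..<1} x \<partial>lborel" 1 b]
    by (simp add: add.commute)
  also have "\<dots> = (\<integral>\<^sup>+p. f p \<partial>cyl)"
    by (subst nn_integral_cyl) auto
  finally show ?thesis .
qed

text \<open>A translation does not map the strip that represents the cylinder to itself, hence the reduction
  modulo 1. Composition of a periodic function with \<open>wrap c\<close> is its translate by c.\<close>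

definition wrap :: "real \<times> real \<Rightarrow> real \<times> real \<Rightarrow> real \<times> real" where
  "wrap c p = (frac (fst p + fst c), snd p + snd c)"

lemma wrap_measurable [measurable]: "wrap c \<in> measurable cyl cyl"
proof -
  have "wrap c \<in> measurable borel (borel \<Otimes>\<^sub>M borel)"
    unfolding wrap_def frac_def by measurable
  then have "wrap c \<in> measurable borel lborel" by (simp add: borel_prod)
  then have "wrap c \<in> measurable cyl lborel" by (rule measurable_cyl)
  then show ?thesis
    unfolding cyl_def by (intro measurable_restrict_space2) (auto simp: wrap_def frac_lt_1)
qed

lemma periodic_wrap: 
  assumes "\<And>x y. f (x + 1, y) = f (x, y)"
  shows "f (wrap c p) = f (p + c)"
  using periodic_int_shift[of "\<lambda>x. f (x, snd p + snd c)" "fst p + fst c" "- \<lfloor>fst p + fst c\<rfloor>"] assms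
  by (simp add: wrap_def frac_def plus_prod_def)

text \<open>Stated for the measure, the invariance yields integrability and the value of Bochner integrals at
  the same time.\<close>

lemma distr_cyl_wrap: "distr cyl cyl (wrap c) = cyl"
proof (rule measure_eqI)
  fix A assume "A \<in> sets (distr cyl cyl (wrap c))"
  then have A: "A \<in> sets cyl" by simp
  then have A': "A \<subseteq> {0..<1} \<times> UNIV" "A \<in> sets borel"
    by (auto simp: cyl_def sets_restrict_space)
  define f where "f = (\<lambda>p. indicator A (frac (fst p), snd p) :: ennreal)"
  have [measurable]: "(\<lambda>p. (frac (fst p), snd p)) \<in> measurable borel (borel :: (real \<times> real) measure)"
    unfolding frac_def borel_prod[symmetric] by measurable
  have fm: "f \<in> borel_measurable borel"
    unfolding f_def using A'(2) by measurable
  have per: "f (x + 1, y) = f (x, y)" for x y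
    by (simp add: f_def frac_1_eq)
  have "emeasure (distr cyl cyl (wrap c)) A = (\<integral>\<^sup>+p. indicator A p \<partial>distr cyl cyl (wrap c))"
    using A by (intro nn_integral_indicator[symmetric]) simp
  also have "\<dots> = (\<integral>\<^sup>+p. indicator A (wrap c p) \<partial>cyl)"
    using A by (intro nn_integral_distr) auto
  also have "\<dots> = (\<integral>\<^sup>+p. f (p + c) \<partial>cyl)"
    by (simp add: f_def wrap_def)
  also have "\<dots> = (\<integral>\<^sup>+p. f p \<partial>cyl)"
    by (rule nn_integral_cyl_shift[OF fm per])
  also have "\<dots> = (\<integral>\<^sup>+p. indicator A p \<partial>cyl)"
    by (intro nn_integral_cong) (auto simp: f_def space_cyl frac_eq_id)
  also have "\<dots> = emeasure cyl A" using A by simp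
  finally show "emeasure (distr cyl cyl (wrap c)) A = emeasure cyl A" .
qed simp

lemma integrable_cyl_shift:
  assumes [measurable]: "f \<in> borel_measurable borel" and per: "theta_periodic f"
  shows "integrable cyl (\<lambda>p. f (p + c)) \<longleftrightarrow> integrable cyl f"
proof -
  have "integrable cyl f \<longleftrightarrow> integrable (distr cyl cyl (wrap c)) f" by (simp add: distr_cyl_wrap)
  also have "\<dots> \<longleftrightarrow> integrable cyl (\<lambda>p. f (wrap c p))"
    by (rule integrable_distr_eq) auto
  finally show ?thesis using per by (simp add: periodic_wrap theta_periodic_def)
qed

lemma integral_cyl_shift:
  assumes [measurable]: "f \<in> borel_measurable borel" and per: "theta_periodic f"
  shows "(LINT p|cyl. f (p + c)) = (LINT p|cyl. f p)"
proof -
  have "(LINT p|cyl. f p) = (LINT p|distr cyl cyl (wrap c). f p)" by (simp add: distr_cyl_wrap)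
  also have "\<dots> = (LINT p|cyl. f (wrap c p))"
    by (rule integral_distr) auto
  finally show ?thesis using per by (simp add: periodic_wrap theta_periodic_def)
qed

lemma AE_cyl_iff: "(AE p in cyl. P p) \<longleftrightarrow> (AE p in lborel. p \<in> {0..<1} \<times> UNIV \<longrightarrow> P p)"
  unfolding cyl_def by (subst AE_restrict_space_iff) auto

lemma AE_vertical_line: "AE p in (lborel :: (real \<times> real) measure). fst p \<noteq> a"
proof (rule AE_I')
  have "emeasure (lborel \<Otimes>\<^sub>M lborel) ({a} \<times> (UNIV :: real set)) = 0"
    by (subst lborel.emeasure_pair_measure_Times) auto
  then show "{a} \<times> UNIV \<in> null_sets (lborel :: (real \<times> real) measure)"
    by (auto simp: null_sets_def lborel_prod closed_Times intro!: borel_closed)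
qed auto

lemma AE_horizontal_line: "AE p in (lborel :: (real \<times> real) measure). snd p \<noteq> a"
proof (rule AE_I')
  have "emeasure (lborel \<Otimes>\<^sub>M lborel) ((UNIV :: real set) \<times> {a}) = 0"
    by (subst lborel.emeasure_pair_measure_Times) auto
  then show "UNIV \<times> {a} \<in> null_sets (lborel :: (real \<times> real) measure)"
    by (auto simp: null_sets_def lborel_prod closed_Times intro!: borel_closed)
qed auto

lemma box_borel [measurable]: "{a..b::real} \<times> {c..d::real} \<in> sets borel"
  by (intro borel_closed closed_Times) auto

text \<open>The closed rectangles and the half-open strip differ by the null line over the angle 1.\<close>

lemma loc_integrable_iff:
  "loc_integrable f \<longleftrightarrow> f \<in> borel_measurable borel \<and> theta_periodic f \<and>
     (\<forall>R. integrable cyl (\<lambda>p. indicator {-R..R} (snd p) * f p))"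
proof -
  have "set_integrable lborel ({0..1} \<times> {-R..R}) f \<longleftrightarrow>
      integrable cyl (\<lambda>p. indicator {-R..R} (snd p) * f p)"
    if [measurable]: "f \<in> borel_measurable borel" for R
  proof -
    have "integrable cyl (\<lambda>p. indicator {-R..R} (snd p) * f p) \<longleftrightarrow>
       integrable lborel (\<lambda>p. indicator ({0..<1} \<times> UNIV) p *\<^sub>R (indicator {-R..R} (snd p) * f p))"
      unfolding cyl_def by (subst integrable_restrict_space) auto
    also have "\<dots> \<longleftrightarrow> set_integrable lborel ({0..1} \<times> {-R..R}) f"
      unfolding set_integrable_def
    proof (rule integrable_cong_AE)
      show "(\<lambda>p. indicator ({0..<1} \<times> UNIV) p *\<^sub>R (indicator {-R..R} (snd p) * f p)) \<in> borel_measurable lborel"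
        by simp
      show "(\<lambda>p. indicator ({0..1} \<times> {-R..R}) p *\<^sub>R f p) \<in> borel_measurable lborel" by simp
      show "AE p in lborel. indicator ({0..<1} \<times> UNIV) p *\<^sub>R (indicator {-R..R} (snd p) * f p)
           = indicator ({0..1} \<times> {-R..R}) p *\<^sub>R f p"
        using AE_vertical_line[of 1] by eventually_elim (auto simp: indicator_def)
    qed
    finally show ?thesis by simp
  qed
  then show ?thesis by (auto simp: loc_integrable_def)
qed

section \<open>Smooth functions of one variable\<close>

text \<open>Differentiability of order n, without continuity of the last derivative. The recursion makes the
  closure under products and compositions a plain induction that needs no formula for higher
  derivatives.\<close>

primrec Ck :: "nat \<Rightarrow> (real \<Rightarrow> real) \<Rightarrow> bool" where
  "Ck 0 f \<longleftrightarrow> True"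
| "Ck (Suc n) f \<longleftrightarrow> (\<exists>f'. (\<forall>x. (f has_real_derivative f' x) (at x)) \<and> Ck n f')"

lemma Ck_SucD: "Ck (Suc n) f \<Longrightarrow> Ck n f"
proof (induction n arbitrary: f)
  case (Suc n)
  from Suc.prems obtain f' where "\<forall>x. (f has_real_derivative f' x) (at x)" "Ck (Suc n) f'"
    by (subst (asm) Ck.simps) blast
  then show ?case using Suc.IH[of f'] by auto
qed simp

lemma Ck_const: "Ck n (\<lambda>x. c)"
proof (induction n arbitrary: c)
  case (Suc n)
  have "\<forall>x. ((\<lambda>x. c) has_real_derivative 0) (at x)" by simp
  then show ?case using Suc[of 0] by (subst Ck.simps) (rule exI[of _ "\<lambda>x. 0"], simp)
qed simp

lemma Ck_add: "Ck n f \<Longrightarrow> Ck n g \<Longrightarrow> Ck n (\<lambda>x. f x + g x)"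
proof (induction n arbitrary: f g)
  case (Suc n)
  obtain f' g' where d: "\<And>x. (f has_real_derivative f' x) (at x)" "Ck n f'"
    "\<And>x. (g has_real_derivative g' x) (at x)" "Ck n g'"
    using Suc.prems by auto
  have "\<forall>x. ((\<lambda>x. f x + g x) has_real_derivative f' x + g' x) (at x)"
    by (auto intro!: derivative_eq_intros d)
  moreover have "Ck n (\<lambda>x. f' x + g' x)" by (rule Suc.IH) (auto simp: d)
  ultimately show ?case by auto
qed simp

lemma Ck_mult: "Ck n f \<Longrightarrow> Ck n g \<Longrightarrow> Ck n (\<lambda>x. f x * g x)"
proof (induction n arbitrary: f g)
  case (Suc n)
  obtain f' g' where d: "\<And>x. (f has_real_derivative f' x) (at x)" "Ck n f'"
    "\<And>x. (g has_real_derivative g' x) (at x)" "Ck n g'"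
    using Suc.prems by auto
  have "\<forall>x. ((\<lambda>x. f x * g x) has_real_derivative f' x * g x + f x * g' x) (at x)"
    by (auto intro!: derivative_eq_intros d)
  moreover have "Ck n (\<lambda>x. f' x * g x + f x * g' x)"
    by (rule Ck_add[OF Suc.IH[OF d(2) Ck_SucD[OF Suc.prems(2)]] Suc.IH[OF Ck_SucD[OF Suc.prems(1)] d(4)]])
  ultimately show ?case by auto
qed simp

lemma Ck_compose: "Ck n f \<Longrightarrow> Ck n g \<Longrightarrow> Ck n (\<lambda>x. f (g x))"
proof (induction n arbitrary: f)
  case (Suc n)
  obtain f' g' where d: "\<And>x. (f has_real_derivative f' x) (at x)" "Ck n f'"
    "\<And>x. (g has_real_derivative g' x) (at x)" "Ck n g'"
    using Suc.prems by auto
  have "\<forall>x. ((\<lambda>x. f (g x)) has_real_derivative f' (g x) * g' x) (at x)"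
    using DERIV_chain2[OF d(1) d(3)] by blast
  moreover have "Ck n (\<lambda>x. f' (g x) * g' x)"
    by (rule Ck_mult[OF Suc.IH[OF d(2) Ck_SucD[OF Suc.prems(2)]] d(4)])
  ultimately show ?case by auto
qed simp

lemma Ck_affine: "Ck n (\<lambda>x. c * x + d)"
proof (cases n)
  case (Suc k)
  have "\<forall>x. ((\<lambda>x. c * x + d) has_real_derivative c) (at x)"
    by (auto intro!: derivative_eq_intros)
  then show ?thesis using Ck_const[of k c] Suc by auto
qed simp

lemma Ck_sin_cos: "Ck n sin \<and> Ck n cos"
proof (induction n)
  case (Suc n)
  have "\<forall>x::real. (sin has_real_derivative cos x) (at x)"
    and "\<forall>x::real. (cos has_real_derivative (-1) * sin x) (at x)"
    by (auto intro!: derivative_eq_intros)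
  moreover have "Ck n (\<lambda>x. (-1) * sin x)" using Suc Ck_const Ck_mult by blast
  ultimately show ?case using Suc by (metis Ck.simps(2))
qed simp

lemma exp_inverse_over_power_tendsto_0: "((\<lambda>s::real. exp (- 1 / s) / s ^ k) \<longlongrightarrow> 0) (at_right 0)"
proof -
  have "((\<lambda>s::real. inverse s ^ k / exp (inverse s)) \<longlongrightarrow> 0) (at_right 0)"
    by (rule filterlim_compose[OF tendsto_power_div_exp_0 filterlim_inverse_at_top_right])
  then show ?thesis
    by (simp add: exp_minus divide_inverse power_inverse mult.commute)
qed

text \<open>For \<open>k = 0\<close> this is the classical smooth function that is positive exactly for \<open>s > 0\<close>. The
  derivative of a member of the family is a linear combination of members, which is what the induction
  for smoothness needs.\<close>

definition flat :: "nat \<Rightarrow> real \<Rightarrow> real" where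
  "flat k s = (if s > 0 then exp (- 1 / s) / s ^ k else 0)"

lemma flat_tendsto_0: "(flat k \<longlongrightarrow> 0) (at 0)"
proof (rule filterlim_split_at)
  have "eventually (\<lambda>s. exp (- 1 / s) / s ^ k = flat k s) (at_right 0)"
    by (auto simp: flat_def eventually_at_right_field intro!: exI[of _ 1])
  with exp_inverse_over_power_tendsto_0 show "(flat k \<longlongrightarrow> 0) (at_right 0)"
    by (rule Lim_transform_eventually)
  have "eventually (\<lambda>s. 0 = flat k s) (at_left 0)"
    by (auto simp: flat_def eventually_at_left_field intro!: exI[of _ "-1"])
  then show "(flat k \<longlongrightarrow> 0) (at_left 0)"
    by (rule Lim_transform_eventually[rotated]) simp
qed

lemma flat_deriv: "(flat k has_real_derivative flat (k + 2) s + (- real k) * flat (k + 1) s) (at s)"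
proof -
  consider "s > 0" | "s < 0" | "s = 0" by linarith
  then show ?thesis
  proof cases
    case 1
    have "((\<lambda>s. exp (- 1 / s) / s ^ k) has_real_derivative flat (k + 2) s + (- real k) * flat (k + 1) s) (at s)"
      using 1 by (cases k) (auto intro!: derivative_eq_intros simp: flat_def field_simps power2_eq_square,
          metis Suc_pred neq0_conv power_Suc)
    then show ?thesis
      by (rule has_field_derivative_transform_within[where d = s]) (use 1 in \<open>auto simp: flat_def dist_real_def\<close>)
  next
    case 2
    have "((\<lambda>s. 0) has_real_derivative flat (k + 2) s + (- real k) * flat (k + 1) s) (at s)"
      using 2 by (auto simp: flat_def)
    then show ?thesis
      by (rule has_field_derivative_transform_within[where d = "- s"]) (use 2 in \<open>auto simp: flat_def dist_real_def\<close>)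
  next
    case 3
    have "(\<lambda>h. (flat k (0 + h) - flat k 0) / h) = flat (k + 1)"
      by (auto simp: flat_def field_simps fun_eq_iff)
    then show ?thesis
      using flat_tendsto_0[of "k + 1"] 3 by (simp add: DERIV_def flat_def)
  qed
qed

lemma Ck_flat: "Ck n (flat k)"
proof (induction n arbitrary: k)
  case (Suc n)
  have "Ck n (\<lambda>s. flat (k + 2) s + (- real k) * flat (k + 1) s)"
    by (rule Ck_add[OF Suc Ck_mult[OF Ck_const Suc]])
  then show ?case using flat_deriv[of k] unfolding Ck.simps
    by (intro exI[of _ "\<lambda>s. flat (k + 2) s + (- real k) * flat (k + 1) s"] conjI allI)
qed simp

lemma Ck_deriv:
  assumes "\<And>n. Ck n g"
  shows "(g has_real_derivative deriv g x) (at x)" "Ck n (deriv g)"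
proof -
  have "\<exists>g'. (\<forall>x. (g has_real_derivative g' x) (at x)) \<and> Ck n g'" for n
    using assms[of "Suc n"] by simp
  then obtain G where G: "\<And>n x. (g has_real_derivative G n x) (at x)" "\<And>n. Ck n (G n)"
    by metis
  have "G n = deriv g" for n
  proof
    show "G n x = deriv g x" for x using DERIV_imp_deriv[OF G(1)] by simp
  qed
  then show "(g has_real_derivative deriv g x) (at x)" "Ck n (deriv g)"
    using G(1)[of n x] G(2)[of n] by simp_all
qed

lemma Ck_imp_derivs:
  assumes "\<And>n. Ck n f"
  obtains D :: "nat \<Rightarrow> real \<Rightarrow> real"
  where "D 0 = f" "\<And>n x. (D n has_real_derivative D (Suc n) x) (at x)"
proof
  have "Ck n ((deriv ^^ k) f)" for n k
    by (induction k arbitrary: n) (simp_all add: assms Ck_deriv)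
  then show "((deriv ^^ n) f has_real_derivative (deriv ^^ Suc n) f x) (at x)" for n x
    using Ck_deriv(1) by simp
  show "(deriv ^^ 0) f = f" by simp
qed

section \<open>Jets of smooth functions on the cylinder\<close>

text \<open>A smooth function given together with all its partial derivatives, like \<^const>\<open>test_jet\<close> but with
  arbitrary support.\<close>

definition jet :: "(nat \<Rightarrow> nat \<Rightarrow> field) \<Rightarrow> bool" where
  "jet D \<longleftrightarrow> (\<forall>i j. theta_periodic (D i j) \<and> continuous_on UNIV (D i j) \<and>
        (\<forall>x y. ((\<lambda>s. D i j (s, y)) has_real_derivative D (Suc i) j (x, y)) (at x) \<and>
               ((\<lambda>s. D i j (x, s)) has_real_derivative D i (Suc j) (x, y)) (at y)))"

lemma jetI:
  assumes "\<And>i j. theta_periodic (D i j)" "\<And>i j. continuous_on UNIV (D i j)"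
    "\<And>i j x y. ((\<lambda>s. D i j (s, y)) has_real_derivative D (Suc i) j (x, y)) (at x)"
    "\<And>i j x y. ((\<lambda>s. D i j (x, s)) has_real_derivative D i (Suc j) (x, y)) (at y)"
  shows "jet D"
  using assms by (simp add: jet_def)

lemma jetD:
  assumes "jet D"
  shows "theta_periodic (D i j)" "continuous_on UNIV (D i j)"
    "((\<lambda>s. D i j (s, y)) has_real_derivative D (Suc i) j (x, y)) (at x)"
    "((\<lambda>s. D i j (x, s)) has_real_derivative D i (Suc j) (x, y)) (at y)"
  using assms by (simp_all add: jet_def)

lemma test_jet_iff: "test_jet D \<longleftrightarrow> jet D \<and> (\<exists>R. \<forall>x y. \<bar>y\<bar> > R \<longrightarrow> D 0 0 (x, y) = 0)"
  by (simp add: test_jet_def jet_def)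

lemma test_jetD: "test_jet D \<Longrightarrow> jet D"
  by (simp add: test_jet_iff)

lemma jet_borel: "jet D \<Longrightarrow> D i j \<in> borel_measurable borel"
  by (intro borel_measurable_continuous_onI) (rule jetD)

lemma theta_periodic_frac: "theta_periodic f \<Longrightarrow> f (x, y) = f (frac x, y)"
  using periodic_int_shift[of "\<lambda>x. f (x, y)" x "- \<lfloor>x\<rfloor>"]
  by (simp add: theta_periodic_def frac_def)

text \<open>The definition restricts the support of \<^term>\<open>D 0 0\<close> only. The derivatives vanish outside the same
  strip because a function that is zero on an open set has zero derivative there.\<close>

lemma test_jet_support:
  assumes "test_jet D"
  obtains R where "R > 0" "\<And>i j x y. \<bar>y\<bar> > R \<Longrightarrow> D i j (x, y) = 0"
proof -
  obtain R0 where R0: "\<And>x y. \<bar>y\<bar> > R0 \<Longrightarrow> D 0 0 (x, y) = 0"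
    using assms by (auto simp: test_jet_iff)
  define R where "R = \<bar>R0\<bar> + 1"
  have jet: "jet D" using assms by (rule test_jetD)
  have y0: "D 0 j (x, y) = 0" if "\<bar>y\<bar> > R" for j x y
    using that
  proof (induction j arbitrary: x y)
    case 0
    then show ?case using R0 by (auto simp: R_def)
  next
    case (Suc j)
    have "((\<lambda>s. 0) has_real_derivative D 0 (Suc j) (x, y)) (at y)"
      using jetD(4)[OF jet, of 0 j x y]
    proof (rule has_field_derivative_transform_within[where d = "\<bar>y\<bar> - R"])
      fix y' assume "dist y' y < \<bar>y\<bar> - R"
      then have "\<bar>y'\<bar> > R" by (auto simp: dist_real_def)
      then show "D 0 j (x, y') = 0" by (rule Suc.IH)
    qed (use Suc.prems in auto)
    then show ?case using DERIV_unique DERIV_const by blast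
  qed
  have "D i j (x, y) = 0" if "\<bar>y\<bar> > R" for i j x y
  proof (induction i arbitrary: x)
    case 0
    then show ?case using y0 that by blast
  next
    case (Suc i)
    have "((\<lambda>s. D i j (s, y)) has_real_derivative D (Suc i) j (x, y)) (at x)"
      by (rule jetD[OF jet])
    then have "((\<lambda>s. 0) has_real_derivative D (Suc i) j (x, y)) (at x)"
      by (simp add: Suc)
    then show ?case using DERIV_unique DERIV_const by blast
  qed
  moreover have "R > 0" by (simp add: R_def)
  ultimately show thesis using that by blast
qed

lemma continuous_periodic_bounded:
  assumes "theta_periodic f" "continuous_on UNIV f"
  obtains K where "K > 0" "\<And>x y. \<bar>y\<bar> \<le> R \<Longrightarrow> \<bar>f (x, y)\<bar> \<le> K"
proof -
  have "compact (f ` ({0..1} \<times> {-R..R}))"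
    by (intro compact_continuous_image compact_Times compact_Icc continuous_on_subset[OF assms(2)]) auto
  then obtain K where K: "K > 0" "\<And>z. z \<in> f ` ({0..1} \<times> {-R..R}) \<Longrightarrow> \<bar>z\<bar> \<le> K"
    using bounded_pos compact_imp_bounded by (metis real_norm_def)
  have "\<bar>f (x, y)\<bar> \<le> K" if "\<bar>y\<bar> \<le> R" for x y
    using theta_periodic_frac[OF assms(1), of x y] K(2)[of "f (frac x, y)"] that frac_lt_1[of x]
    by (force simp: abs_le_iff)
  with K(1) show thesis using that by blast
qed

lemma test_jet_bounded:
  assumes "test_jet D"
  obtains K where "K > 0" "\<And>p. \<bar>D i j p\<bar> \<le> K"
proof -
  obtain R where R: "\<And>i j x y. \<bar>y\<bar> > R \<Longrightarrow> D i j (x, y) = 0"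
    using test_jet_support[OF assms] by metis
  obtain K where K: "K > 0" "\<And>x y. \<bar>y\<bar> \<le> R \<Longrightarrow> \<bar>D i j (x, y)\<bar> \<le> K"
    using continuous_periodic_bounded[of "D i j" R] assms by (auto simp: test_jet_iff jet_def)
  have "\<bar>D i j p\<bar> \<le> K" for p
    by (cases p; cases "\<bar>snd p\<bar> > R") (use R K in force)+
  with K(1) show thesis using that by blast
qed

lemma jet_shift_index: "jet D \<Longrightarrow> jet (\<lambda>i j. D (i + a) (j + b))"
  by (auto simp: jet_def)

lemma test_jet_shift_index:
  assumes "test_jet D" shows "test_jet (\<lambda>i j. D (i + a) (j + b))"
  unfolding test_jet_iff
proof
  show "jet (\<lambda>i j. D (i + a) (j + b))" using assms by (intro jet_shift_index test_jetD)
  show "\<exists>R. \<forall>x y. R < \<bar>y\<bar> \<longrightarrow> D (0 + a) (0 + b) (x, y) = 0"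
    using test_jet_support[OF assms] by metis
qed

lemma theta_periodic_translate:
  assumes "theta_periodic f" shows "theta_periodic (\<lambda>p. f (p + c))"
  unfolding theta_periodic_def
proof (intro allI)
  fix x y
  show "f ((x + 1, y) + c) = f ((x, y) + c)"
    using assms[unfolded theta_periodic_def, rule_format, of "x + fst c" "y + snd c"]
    by (simp add: plus_prod_def ac_simps)
qed

lemma jet_translate:
  assumes "jet D" shows "jet (\<lambda>i j p. D i j (p + c))"
proof (rule jetI)
  obtain a b where c: "c = (a, b)" by (cases c)
  show "theta_periodic (\<lambda>p. D i j (p + c))" for i j
    by (rule theta_periodic_translate[OF jetD(1)[OF assms]])
  show "continuous_on UNIV (\<lambda>p. D i j (p + c))" for i j
    by (intro continuous_on_compose2[OF jetD(2)[OF assms]] continuous_intros) auto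
  show "((\<lambda>s. D i j ((s, y) + c)) has_real_derivative D (Suc i) j ((x, y) + c)) (at x)" for i j x y
    using jetD(3)[OF assms, of i j "y + b" "x + a"] by (simp add: c DERIV_shift)
  show "((\<lambda>s. D i j ((x, s) + c)) has_real_derivative D i (Suc j) ((x, y) + c)) (at y)" for i j x y
    using jetD(4)[OF assms, of i j "x + a" "y + b"] by (simp add: c DERIV_shift)
qed

lemma test_jet_translate:
  assumes "test_jet D" shows "test_jet (\<lambda>i j p. D i j (p + c))"
  unfolding test_jet_iff
proof
  show "jet (\<lambda>i j p. D i j (p + c))" using assms by (intro jet_translate test_jetD)
  obtain R where R: "\<And>i j x y. \<bar>y\<bar> > R \<Longrightarrow> D i j (x, y) = 0"
    using test_jet_support[OF assms] by metis
  show "\<exists>R. \<forall>x y. R < \<bar>y\<bar> \<longrightarrow> D 0 0 ((x, y) + c) = 0"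
    by (rule exI[of _ "R + \<bar>snd c\<bar>"], cases c) (auto intro!: R)
qed

text \<open>The derivatives of \<open>\<alpha>\<close> inherit its period by uniqueness of derivatives.\<close>

lemma product_test_jet:
  assumes A: "\<And>n. Ck n \<alpha>" and per: "\<And>x. \<alpha> (x + 1) = \<alpha> x"
    and B: "\<And>n. Ck n \<beta>" and supp: "\<And>y. \<bar>y\<bar> > R \<Longrightarrow> \<beta> y = 0"
  obtains D where "test_jet D" "D 0 0 = (\<lambda>p. \<alpha> (fst p) * \<beta> (snd p))"
proof -
  obtain A where A: "A 0 = \<alpha>" "\<And>n x. (A n has_real_derivative A (Suc n) x) (at x)"
    using Ck_imp_derivs[OF A] by metis
  obtain B where B: "B 0 = \<beta>" "\<And>n x. (B n has_real_derivative B (Suc n) x) (at x)"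
    using Ck_imp_derivs[OF B] by metis
  have per: "A n (x + 1) = A n x" for n x
  proof (induction n arbitrary: x)
    case (Suc n)
    have "((\<lambda>x. A n (x + 1)) has_real_derivative A (Suc n) (x + 1)) (at x)"
      using A(2)[of n "x + 1"] by (simp add: DERIV_shift)
    then show ?case using A(2)[of n x] DERIV_unique by (auto simp: Suc)
  qed (simp add: A per)
  have cont: "continuous_on UNIV (A n)" "continuous_on UNIV (B n)" for n
    using DERIV_continuous_on[of UNIV "A n" "A (Suc n)"] DERIV_continuous_on[of UNIV "B n" "B (Suc n)"]
      A(2) B(2) by simp_all
  define D where "D = (\<lambda>i j p. A i (fst p) * B j (snd p))"
  have "jet D"
    unfolding D_def
  proof (rule jetI, goal_cases)
    case (1 i j) show ?case by (simp add: theta_periodic_def per)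
  next
    case (2 i j) show ?case
      by (intro continuous_intros continuous_on_compose2[OF cont(1)] continuous_on_compose2[OF cont(2)]) auto
  next
    case (3 i j x y) show ?case using A(2) by (auto intro!: derivative_eq_intros)
  next
    case (4 i j x y) show ?case using B(2) by (auto intro!: derivative_eq_intros)
  qed
  then have "test_jet D"
    using supp by (auto simp: test_jet_iff D_def B)
  then show thesis using that by (auto simp: D_def A B)
qed

text \<open>Pascal's rule, in the form in which it passes from the Leibniz formula of order i to that of order
  \<open>i + 1\<close>.\<close>

lemma leibniz_step:
  fixes u v :: "nat \<Rightarrow> real"
  shows "(\<Sum>a\<le>i. real (i choose a) * (u (Suc a) * v (i - a) + u a * v (Suc (i - a))))
      = (\<Sum>a\<le>Suc i. real (Suc i choose a) * (u a * v (Suc i - a)))"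
proof -
  have "(\<Sum>a\<le>Suc i. real (Suc i choose a) * (u a * v (Suc i - a)))
      = u 0 * v (Suc i) + (\<Sum>a\<le>i. real (Suc i choose Suc a) * (u (Suc a) * v (i - a)))"
    by (subst sum.atMost_Suc_shift) simp
  also have "\<dots> = (\<Sum>a\<le>i. real (i choose a) * (u (Suc a) * v (i - a)))
      + (u 0 * v (Suc i) + (\<Sum>a\<le>i. real (i choose Suc a) * (u (Suc a) * v (i - a))))"
    by (simp add: sum.distrib algebra_simps)
  also have "u 0 * v (Suc i) + (\<Sum>a\<le>i. real (i choose Suc a) * (u (Suc a) * v (i - a)))
      = (\<Sum>a\<le>Suc i. real (i choose a) * (u a * v (Suc i - a)))"
    by (subst sum.atMost_Suc_shift) simp
  also have "\<dots> = (\<Sum>a\<le>i. real (i choose a) * (u a * v (Suc (i - a))))"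
    by (auto intro!: sum.cong simp: Suc_diff_le)
  finally show ?thesis by (simp add: sum.distrib algebra_simps)
qed

text \<open>Leibniz formula for the partial derivatives of \<open>U 0 0 * V 0 0\<close>.\<close>

definition jet_mult :: "(nat \<Rightarrow> nat \<Rightarrow> field) \<Rightarrow> (nat \<Rightarrow> nat \<Rightarrow> field) \<Rightarrow> nat \<Rightarrow> nat \<Rightarrow> field" where
  "jet_mult U V i j p =
     (\<Sum>a\<le>i. \<Sum>b\<le>j. real (i choose a) * real (j choose b) * (U a b p * V (i - a) (j - b) p))"

lemma jet_mult_0 [simp]: "jet_mult U V 0 0 = (\<lambda>p. U 0 0 p * V 0 0 p)"
  by (simp add: jet_mult_def fun_eq_iff)

lemma jet_jet_mult:
  assumes U: "jet U" and V: "jet V"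
  shows "jet (jet_mult U V)"
proof (rule jetI)
  note [derivative_intros] = jetD(3,4)[OF U] jetD(3,4)[OF V]
  show "theta_periodic (jet_mult U V i j)" for i j
    using jetD(1)[OF U] jetD(1)[OF V] by (auto simp: theta_periodic_def jet_mult_def)
  show "continuous_on UNIV (jet_mult U V i j)" for i j
    unfolding jet_mult_def by (intro continuous_intros jetD(2) U V)
  show "((\<lambda>s. jet_mult U V i j (s, y)) has_real_derivative jet_mult U V (Suc i) j (x, y)) (at x)" for i j x y
  proof -
    have "((\<lambda>s. jet_mult U V i j (s, y)) has_real_derivative
       (\<Sum>a\<le>i. \<Sum>b\<le>j. real (i choose a) * real (j choose b) *
         (U (Suc a) b (x, y) * V (i - a) (j - b) (x, y) + U a b (x, y) * V (Suc (i - a)) (j - b) (x, y)))) (at x)"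
      unfolding jet_mult_def by (auto intro!: derivative_eq_intros sum.cong simp: algebra_simps)
    also have "(\<Sum>a\<le>i. \<Sum>b\<le>j. real (i choose a) * real (j choose b) *
         (U (Suc a) b (x, y) * V (i - a) (j - b) (x, y) + U a b (x, y) * V (Suc (i - a)) (j - b) (x, y)))
       = (\<Sum>b\<le>j. real (j choose b) * (\<Sum>a\<le>i. real (i choose a) *
         (U (Suc a) b (x, y) * V (i - a) (j - b) (x, y) + U a b (x, y) * V (Suc (i - a)) (j - b) (x, y))))"
      by (subst sum.swap) (simp add: sum_distrib_left algebra_simps)
    also have "\<dots> = (\<Sum>b\<le>j. real (j choose b) *
        (\<Sum>a\<le>Suc i. real (Suc i choose a) * (U a b (x, y) * V (Suc i - a) (j - b) (x, y))))"
      by (intro sum.cong refl arg_cong2[where f = "(*)"] leibniz_step)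
    also have "\<dots> = jet_mult U V (Suc i) j (x, y)"
      unfolding jet_mult_def by (subst sum.swap) (simp add: sum_distrib_left algebra_simps del: sum.atMost_Suc binomial_Suc_Suc)
    finally show ?thesis .
  qed
  show "((\<lambda>s. jet_mult U V i j (x, s)) has_real_derivative jet_mult U V i (Suc j) (x, y)) (at y)" for i j x y
  proof -
    have "((\<lambda>s. jet_mult U V i j (x, s)) has_real_derivative
       (\<Sum>a\<le>i. \<Sum>b\<le>j. real (i choose a) * real (j choose b) *
         (U a (Suc b) (x, y) * V (i - a) (j - b) (x, y) + U a b (x, y) * V (i - a) (Suc (j - b)) (x, y)))) (at y)"
      unfolding jet_mult_def by (auto intro!: derivative_eq_intros sum.cong simp: algebra_simps)
    also have "(\<Sum>a\<le>i. \<Sum>b\<le>j. real (i choose a) * real (j choose b) *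
         (U a (Suc b) (x, y) * V (i - a) (j - b) (x, y) + U a b (x, y) * V (i - a) (Suc (j - b)) (x, y)))
       = (\<Sum>a\<le>i. real (i choose a) * (\<Sum>b\<le>j. real (j choose b) *
         (U a (Suc b) (x, y) * V (i - a) (j - b) (x, y) + U a b (x, y) * V (i - a) (Suc (j - b)) (x, y))))"
      by (simp add: sum_distrib_left algebra_simps)
    also have "\<dots> = (\<Sum>a\<le>i. real (i choose a) *
        (\<Sum>b\<le>Suc j. real (Suc j choose b) * (U a b (x, y) * V (i - a) (Suc j - b) (x, y))))"
      by (intro sum.cong refl arg_cong2[where f = "(*)"] leibniz_step)
    also have "\<dots> = jet_mult U V i (Suc j) (x, y)"
      unfolding jet_mult_def by (simp add: sum_distrib_left algebra_simps del: sum.atMost_Suc binomial_Suc_Suc)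
    finally show ?thesis .
  qed
qed

section \<open>Test functions determine locally integrable functions\<close>

lemma integrable_loc_bounded:
  assumes f: "loc_integrable f" and [measurable]: "\<phi> \<in> borel_measurable borel"
    and K: "\<And>p. \<bar>\<phi> p\<bar> \<le> K" and R: "\<And>x y. \<bar>y\<bar> > R \<Longrightarrow> \<phi> (x, y) = 0"
  shows "integrable cyl (\<lambda>p. f p * \<phi> p)"
proof (rule Bochner_Integration.integrable_bound)
  have [measurable]: "f \<in> borel_measurable borel"
    and int: "integrable cyl (\<lambda>p. indicator {-R..R} (snd p) * f p)"
    using f by (auto simp: loc_integrable_iff)
  show "integrable cyl (\<lambda>p. K * (indicator {-R..R} (snd p) * f p))"
    using int by simp
  show "(\<lambda>p. f p * \<phi> p) \<in> borel_measurable cyl"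
    by (rule measurable_cyl) measurable
  have "\<bar>f p * \<phi> p\<bar> \<le> \<bar>K * (indicator {-R..R} (snd p) * f p)\<bar>" for p
  proof (cases "\<bar>snd p\<bar> > R")
    case True
    then show ?thesis using R[of "snd p" "fst p"] by simp
  next
    case False
    then show ?thesis using mult_left_mono[OF K[of p], of "\<bar>f p\<bar>"] order.trans[OF abs_ge_zero K[of p]]
      by (auto simp: indicator_def abs_mult mult.commute)
  qed
  then show "AE p in cyl. norm (f p * \<phi> p) \<le> norm (K * (indicator {-R..R} (snd p) * f p))"
    by simp
qed

lemma integrable_loc_test:
  assumes f: "loc_integrable f" and D: "test_jet D"
  shows "integrable cyl (\<lambda>p. f p * D i j p)"
proof -
  obtain K where K: "\<And>p. \<bar>D i j p\<bar> \<le> K" using test_jet_bounded[OF D] by metis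
  obtain R where R: "\<And>i j x y. \<bar>y\<bar> > R \<Longrightarrow> D i j (x, y) = 0" using test_jet_support[OF D] by metis
  show ?thesis
    by (rule integrable_loc_bounded[where K = K and R = R, OF f])
      (use D K R in \<open>auto simp: test_jet_iff intro: jet_borel\<close>)
qed

lemma flat_0_bounds: "0 \<le> flat 0 s" "flat 0 s \<le> 1"
  by (auto simp: flat_def)

text \<open>Dilating the argument turns a smooth function that is positive exactly on an open set into smooth
  approximations, with values in the unit interval, of the indicator of this set. Test functions that
  converge to indicators are obtained in this way without mollification.\<close>

lemma flat_dilate_tendsto_indicator: "(\<lambda>n. flat 0 (real n * s)) \<longlonglongrightarrow> indicator {0<..} s"
proof (cases "s > 0")
  case True
  have "filterlim (\<lambda>n. real n * s) at_top sequentially"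
    using filterlim_tendsto_pos_mult_at_top[OF tendsto_const True filterlim_real_sequentially]
    by (simp add: mult.commute)
  then have "(\<lambda>n. exp (- inverse (real n * s))) \<longlonglongrightarrow> exp (- 0)"
    by (intro tendsto_intros tendsto_inverse_0_at_top)
  moreover have "\<forall>\<^sub>F n in sequentially. exp (- inverse (real n * s)) = flat 0 (real n * s)"
    using eventually_gt_at_top[of 0]
    by eventually_elim (use True in \<open>auto simp: flat_def divide_inverse\<close>)
  ultimately show ?thesis using True by (auto intro: Lim_transform_eventually)
next
  case False
  then have "flat 0 (real n * s) = 0" for n
    by (auto simp: flat_def zero_less_mult_iff)
  then show ?thesis using False by simp
qed

text \<open>A smooth periodic function that is positive exactly on the arc from a to b. Each sine changes its
  sign under translation by 1, their product has period 1.\<close>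

lemma sin_arc_pos_iff:
  assumes "0 \<le> a" "a < b" "b \<le> 1" "0 \<le> x" "x < 1"
  shows "0 < sin (pi * (x - a)) * sin (pi * (b - x)) \<longleftrightarrow> a < x \<and> x < b"
proof -
  have pos: "0 < sin (pi * t)" if "0 < t" "t < 1" for t
    using that by (intro sin_gt_zero) auto
  have nn: "0 \<le> sin (pi * t)" if "0 \<le> t" "t \<le> 1" for t
    using that by (intro sin_ge_zero) auto
  have np: "sin (pi * t) \<le> 0" if "-1 \<le> t" "t \<le> 0" for t
    using nn[of "-t"] that by simp
  consider "x \<le> a" | "a < x" "x < b" | "b \<le> x" by linarith
  then show ?thesis
  proof cases
    case 1
    then have "sin (pi * (x - a)) \<le> 0" "0 \<le> sin (pi * (b - x))"
      using assms by (auto intro!: np nn)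
    then have "sin (pi * (x - a)) * sin (pi * (b - x)) \<le> 0" by (rule mult_nonpos_nonneg)
    then show ?thesis using 1 by auto
  next
    case 2
    then show ?thesis using assms by (auto intro!: mult_pos_pos pos)
  next
    case 3
    then have "0 \<le> sin (pi * (x - a))" "sin (pi * (b - x)) \<le> 0"
      using assms by (auto intro!: np nn)
    then have "sin (pi * (x - a)) * sin (pi * (b - x)) \<le> 0" by (rule mult_nonneg_nonpos)
    then show ?thesis using 3 by auto
  qed
qed

text \<open>The product of approximate indicators of an arc and of an interval. If the interval is empty, zero
  is used, since \<open>(y - c) (d - y)\<close> describes it only for \<open>c < d\<close>.\<close>

lemma rectangle_approximation:
  assumes ab: "0 \<le> a" "a < b" "b \<le> 1"
  obtains D where "\<And>n. test_jet (D n)" "\<And>n p. 0 \<le> D n 0 0 p" "\<And>n p. D n 0 0 p \<le> 1"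
    "\<And>n x y. y < c \<or> d < y \<Longrightarrow> D n 0 0 (x, y) = 0"
    "\<And>p. p \<in> {0..<1} \<times> UNIV \<Longrightarrow> (\<lambda>n. D n 0 0 p) \<longlonglongrightarrow> indicator ({a<..<b} \<times> {c<..<d}) p"
proof -
  define u where "u = (\<lambda>x. sin (pi * (x - a)) * sin (pi * (b - x)))"
  define w where "w = (\<lambda>y. (y - c) * (d - y))"
  have Ck_u: "Ck k u" for k
  proof -
    have "Ck k (\<lambda>x. sin (pi * x + (- pi * a)))" "Ck k (\<lambda>x. sin ((- pi) * x + pi * b))"
      by (rule Ck_compose[OF conjunct1[OF Ck_sin_cos] Ck_affine])+
    then have "Ck k (\<lambda>x. sin (pi * x + (- pi * a)) * sin ((- pi) * x + pi * b))" by (rule Ck_mult)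
    then show ?thesis by (simp add: u_def algebra_simps)
  qed
  have Ck_w: "Ck k w" for k
  proof -
    have "Ck k (\<lambda>y. (1 * y + (- c)) * ((- 1) * y + d))"
      by (rule Ck_mult[OF Ck_affine Ck_affine])
    then show ?thesis by (simp add: w_def algebra_simps)
  qed
  have scale: "Ck k (\<lambda>x. flat 0 (real n * g x))" if "\<And>k. Ck k g" for k n and g
    by (rule Ck_compose[OF Ck_flat Ck_mult[OF Ck_const that]])
  have per: "u (x + 1) = u x" for x
  proof -
    have "sin (pi * (x + 1 - a)) = - sin (pi * (x - a))"
      using sin_periodic_pi[of "pi * (x - a)"] by (simp add: algebra_simps)
    moreover have "sin (pi * (b - (x + 1))) = - sin (pi * (b - x))"
      using sin_periodic_pi[of "pi * (b - (x + 1))"] by (simp add: algebra_simps)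
    ultimately show ?thesis by (simp add: u_def)
  qed
  have w_pos: "0 < w y \<longleftrightarrow> c < y \<and> y < d" if "c < d" for y
    using that by (auto simp: w_def zero_less_mult_iff)
  have w_neg: "w y \<le> 0" if "y < c \<or> d < y" "c < d" for y
    using w_pos[OF that(2), of y] that(1) by auto
  define e where "e = (if c < d then 1 else 0 :: real)"
  have supp: "e * flat 0 (real n * w y) = 0" if "y < c \<or> d < y" for n y
    using w_neg[OF that] mult_nonneg_nonpos[of "real n" "w y"] by (auto simp: e_def flat_def)
  have ex: "\<exists>D. test_jet D \<and> D 0 0 = (\<lambda>p. flat 0 (real n * u (fst p)) * (e * flat 0 (real n * w (snd p))))" for n
  proof -
    let ?\<alpha> = "\<lambda>x. flat 0 (real n * u x)" and ?\<beta> = "\<lambda>y. e * flat 0 (real n * w y)"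
    show ?thesis
    proof (rule product_test_jet[of ?\<alpha> ?\<beta> "max \<bar>c\<bar> \<bar>d\<bar>"])
      show "Ck k ?\<alpha>" "Ck k ?\<beta>" for k
        by (rule scale[OF Ck_u], rule Ck_mult[OF Ck_const scale[OF Ck_w]])
      show "?\<alpha> (x + 1) = ?\<alpha> x" for x by (simp add: per)
      show "?\<beta> y = 0" if "\<bar>y\<bar> > max \<bar>c\<bar> \<bar>d\<bar>" for y
        by (rule supp) (use that in auto)
    qed blast
  qed
  then obtain D where D: "\<And>n. test_jet (D n)"
    "\<And>n. D n 0 0 = (\<lambda>p. flat 0 (real n * u (fst p)) * (e * flat 0 (real n * w (snd p))))"
    by metis
  have lim: "(\<lambda>n. D n 0 0 p) \<longlonglongrightarrow> indicator ({a<..<b} \<times> {c<..<d}) p" if "p \<in> {0..<1} \<times> UNIV" for p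
  proof -
    obtain x y where p: "p = (x, y)" by (cases p)
    with that have x: "0 \<le> x" "x < 1" by auto
    have "(\<lambda>n. D n 0 0 p) \<longlonglongrightarrow> indicator {0<..} (u x) * (e * indicator {0<..} (w y))"
      unfolding D p by (auto intro!: tendsto_intros flat_dilate_tendsto_indicator)
    also have "indicator {0<..} (u x) * (e * indicator {0<..} (w y)) = (indicator ({a<..<b} \<times> {c<..<d}) p :: real)"
      using sin_arc_pos_iff[OF ab x] w_pos[of y] by (auto simp: indicator_def e_def u_def p)
    finally show ?thesis .
  qed
  have "0 \<le> D n 0 0 p" "D n 0 0 p \<le> 1" for n p
    unfolding D e_def using flat_0_bounds by (auto intro!: mult_nonneg_nonneg mult_le_one)
  moreover have "D n 0 0 (x, y) = 0" if "y < c \<or> d < y" for n x y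
    using supp[OF that] by (simp add: D)
  ultimately show thesis using that[of D] D(1) lim by blast
qed

lemma integral_rectangle_zero:
  assumes g: "loc_integrable g" and zero: "\<And>D. test_jet D \<Longrightarrow> (LINT p|cyl. g p * D 0 0 p) = 0"
    and ab: "0 \<le> a" "a < b" "b \<le> 1"
  shows "(LINT p|cyl. g p * indicator ({a<..<b} \<times> {c<..<d}) p) = 0"
proof -
  obtain D where D: "\<And>n. test_jet (D n)" "\<And>n p. 0 \<le> D n 0 0 p" "\<And>n p. D n 0 0 p \<le> 1"
    "\<And>n x y. y < c \<or> d < y \<Longrightarrow> D n 0 0 (x, y) = 0"
    "\<And>p. p \<in> {0..<1} \<times> UNIV \<Longrightarrow> (\<lambda>n. D n 0 0 p) \<longlonglongrightarrow> indicator ({a<..<b} \<times> {c<..<d}) p"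
    using rectangle_approximation[OF ab, of c d] by metis
  define R where "R = max \<bar>c\<bar> \<bar>d\<bar>"
  have gm [measurable]: "g \<in> borel_measurable borel"
    and int: "integrable cyl (\<lambda>p. indicator {-R..R} (snd p) * g p)"
    using g by (auto simp: loc_integrable_iff)
  have [measurable]: "D n 0 0 \<in> borel_measurable borel" for n
    by (rule jet_borel[OF test_jetD[OF D(1)]])
  have "{a<..<b} \<times> {c<..<d} \<in> sets borel"
    by (intro borel_open open_Times) auto
  then have "(\<lambda>n. LINT p|cyl. g p * D n 0 0 p) \<longlonglongrightarrow> (LINT p|cyl. g p * indicator ({a<..<b} \<times> {c<..<d}) p)"
  proof (intro integral_dominated_convergence)
    show "integrable cyl (\<lambda>p. norm (indicator {-R..R} (snd p) * g p))" using int by (rule integrable_norm)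
    show "AE p in cyl. (\<lambda>n. g p * D n 0 0 p) \<longlonglongrightarrow> g p * indicator ({a<..<b} \<times> {c<..<d}) p"
      by (rule AE_I2) (auto simp: space_cyl intro!: tendsto_intros D(5))
    show "AE p in cyl. norm (g p * D n 0 0 p) \<le> norm (indicator {-R..R} (snd p) * g p)" for n
    proof (rule AE_I2)
      fix p
      show "norm (g p * D n 0 0 p) \<le> norm (indicator {-R..R} (snd p) * g p)"
      proof (cases "snd p \<in> {-R..R}")
        case True
        have "\<bar>g p\<bar> * D n 0 0 p \<le> \<bar>g p\<bar> * 1" by (intro mult_left_mono D) auto
        then show ?thesis using True D(2)[of n p] by (simp add: abs_mult)
      next
        case False
        then have "snd p < c \<or> d < snd p" by (auto simp: R_def)
        then show ?thesis using D(4)[of "snd p" n "fst p"] by simp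
      qed
    qed
  qed (auto intro!: measurable_cyl)
  then show ?thesis using zero[OF D(1)] by (simp add: LIMSEQ_const_iff)
qed

text \<open>The Borel sets over which G has integral zero form a Dynkin system that contains the boxes, an
  intersection-stable generator.\<close>

lemma AE_zero_if_box_integrals_zero:
  fixes G :: "'a::euclidean_space \<Rightarrow> real"
  assumes G: "integrable lborel G" and total: "(LINT p|lborel. G p) = 0"
    and box: "\<And>u v. (LINT p:box u v|lborel. G p) = 0"
  shows "AE p in lborel. G p = 0"
proof (rule density_unique_real[OF G])
  show "integrable lborel (\<lambda>p::'a. 0 :: real)" by simp
next
  fix A assume "A \<in> sets (lborel :: 'a measure)"
  then have gen: "A \<in> sigma_sets UNIV (range (\<lambda>(a, b). box a b) :: 'a set set)"
    by (simp add: borel_eq_box)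
  have "Int_stable (range (\<lambda>(a, b). box a b) :: 'a set set)"
    by (auto simp: Int_stable_def box_Int_box)
  moreover have "range (\<lambda>(a, b). box a b) \<subseteq> Pow (UNIV :: 'a set)" by simp
  moreover note gen
  moreover have sub: "sigma_sets UNIV (range (\<lambda>(a, b). box a b) :: 'a set set) = sets borel"
    by (simp add: borel_eq_box)
  ultimately have "(LINT p:A|lborel. G p) = 0"
  proof (induction A rule: sigma_sets_induct_disjoint)
    case (basic A)
    then show ?case using box by auto
  next
    case (compl A)
    then have A: "A \<in> sets lborel" by simp
    have "(LINT p:UNIV - A|lborel. G p) = (LINT p|lborel. G p - indicator A p * G p)"
      unfolding set_lebesgue_integral_def by (intro Bochner_Integration.integral_cong) (auto simp: indicator_def)
    also have "\<dots> = (LINT p|lborel. G p) - (LINT p:A|lborel. G p)"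
      unfolding set_lebesgue_integral_def
      using G integrable_mult_indicator[OF A G] by (subst Bochner_Integration.integral_diff) auto
    finally show ?case using compl total by simp
  next
    case (union A)
    have "(\<Union>i. A i) \<in> sets lborel" using union by auto
    then have "set_integrable lborel (\<Union>i. A i) G"
      using integrable_mult_indicator[OF _ G] by (simp add: set_integrable_def)
    then have "(LINT p:(\<Union>i. A i)|lborel. G p) = (\<Sum>i. (LINT p:(A i)|lborel. G p))"
      using union by (intro lebesgue_integral_countable_add) (auto simp: disjoint_family_on_def)
    then show ?case using union by simp
  qed (auto simp: set_lebesgue_integral_def)
  then show "(LINT p:A|lborel. G p) = (LINT p:A|lborel. 0)" by (simp add: set_lebesgue_integral_def)
qed

lemma box_Pair: "box (a, c) (b, d) = {a<..<b::real} \<times> {c<..<d::real}"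
  by (auto simp: box_def Basis_prod_def)

text \<open>The approximation of rectangles by test functions shows that g has integral zero over every box
  inside the open strip over the angles from 0 to 1. The remaining vertical line is a null set.\<close>

lemma fundamental_lemma:
  assumes g: "loc_integrable g" and zero: "\<And>D. test_jet D \<Longrightarrow> (LINT p|cyl. g p * D 0 0 p) = 0"
  shows "AE p in cyl. g p = 0"
proof -
  have gm [measurable]: "g \<in> borel_measurable borel" using g by (simp add: loc_integrable_def)
  have R: "AE p in lborel. p \<in> {0<..<1} \<times> {-R<..<R} \<longrightarrow> g p = 0" if "R > 0" for R
  proof -
    define S where "S = {0<..<1::real} \<times> {-R<..<R}"
    have S [measurable]: "S \<in> sets borel" unfolding S_def by (intro borel_open open_Times) auto
    have int_eq: "(LINT p|lborel. indicator (B \<inter> S) p * g p) = (LINT p|cyl. g p * indicator (B \<inter> S) p)"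
      if "B \<in> sets borel" for B
      unfolding cyl_def using that
      by (subst integral_restrict_space)
        (auto intro!: Bochner_Integration.integral_cong simp: indicator_def S_def)
    \<comment> \<open>a box intersected with the strip is again a rectangle, possibly empty\<close>
    have rect: "(LINT p|lborel. indicator (box u v \<inter> S) p * g p) = 0" for u v
    proof -
      obtain a c b d where uv: "u = (a, c)" "v = (b, d)" by (metis surj_pair)
      have eq: "box u v \<inter> S = {max a 0<..<min b 1} \<times> {max c (-R)<..<min d R}"
        by (auto simp: uv S_def box_Pair)
      show ?thesis
      proof (cases "max a 0 < min b 1")
        case True
        then show ?thesis
          using integral_rectangle_zero[of g "max a 0" "min b 1" "max c (-R)" "min d R"] g zero
          by (subst int_eq) (auto simp: eq borel_open open_box)
      next
        case False
        then have "box u v \<inter> S = {}" unfolding eq by auto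
        then show ?thesis by simp
      qed
    qed
    have "integrable cyl (\<lambda>p. indicator {-R..R} (snd p) * g p)"
      using g by (simp add: loc_integrable_iff)
    then have "integrable lborel (\<lambda>p. indicator ({0..<1} \<times> UNIV) p * (indicator {-R..R} (snd p) * g p))"
      unfolding cyl_def by (subst (asm) integrable_restrict_space) auto
    then have "integrable lborel (\<lambda>p. indicator S p *\<^sub>R (indicator ({0..<1} \<times> UNIV) p * (indicator {-R..R} (snd p) * g p)))"
      by (intro integrable_mult_indicator) auto
    also have "(\<lambda>p. indicator S p *\<^sub>R (indicator ({0..<1} \<times> UNIV) p * (indicator {-R..R} (snd p) * g p)))
        = (\<lambda>p. indicator S p * g p)"
      by (auto simp: indicator_def S_def fun_eq_iff)
    finally have int: "integrable lborel (\<lambda>p. indicator S p * g p)" .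
    have "AE p in lborel. indicator S p * g p = 0"
    proof (rule AE_zero_if_box_integrals_zero[OF int])
      have "box (0, -R) (1, R) \<inter> S = S" by (auto simp: S_def box_Pair)
      then show "(LINT p|lborel. indicator S p * g p) = 0" using rect[of "(0, -R)" "(1, R)"] by simp
      show "(LINT p:box u v|lborel. indicator S p * g p) = 0" for u v
        using rect[of u v] by (simp add: set_lebesgue_integral_def indicator_inter_arith mult.assoc)
    qed
    then show ?thesis by eventually_elim (auto simp: S_def indicator_def)
  qed
  have "AE p in lborel. \<forall>n::nat. p \<in> {0<..<1} \<times> {- real (Suc n)<..<real (Suc n)} \<longrightarrow> g p = 0"
    unfolding AE_all_countable by (intro allI R) simp
  then show ?thesis
    unfolding AE_cyl_iff using AE_vertical_line[of 0]
  proof eventually_elim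
    case (elim p)
    obtain n where "\<bar>snd p\<bar> < real n" using reals_Archimedean2 by blast
    then show ?case using elim(1)[rule_format, of n] elim(2) by (cases p) (auto simp: abs_less_iff)
  qed
qed

section \<open>Weak derivatives\<close>

lemma loc_integrable_add:
  assumes "loc_integrable f" "loc_integrable g" shows "loc_integrable (\<lambda>p. f p + g p)"
  using assms by (auto simp: loc_integrable_iff theta_periodic_def distrib_left)

lemma loc_integrable_cmult:
  assumes "loc_integrable f" shows "loc_integrable (\<lambda>p. c * f p)"
  using assms by (auto simp: loc_integrable_iff theta_periodic_def mult.left_commute[of _ c])

lemma loc_integrable_cong_AE:
  assumes "loc_integrable f" "g \<in> borel_measurable borel" "theta_periodic g" "AE p in cyl. f p = g p"
  shows "loc_integrable g"
  unfolding loc_integrable_iff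
proof (intro conjI allI)
  fix R
  have [measurable]: "f \<in> borel_measurable borel" "g \<in> borel_measurable borel"
    using assms by (auto simp: loc_integrable_def)
  have "integrable cyl (\<lambda>p. indicator {-R..R} (snd p) * f p) \<longleftrightarrow> integrable cyl (\<lambda>p. indicator {-R..R} (snd p) * g p)"
  proof (rule integrable_cong_AE)
    show "AE p in cyl. indicator {-R..R} (snd p) * f p = indicator {-R..R} (snd p) * g p"
      using assms(4) by eventually_elim simp
  qed (rule measurable_cyl, measurable)+
  then show "integrable cyl (\<lambda>p. indicator {-R..R} (snd p) * g p)"
    using assms(1) by (simp add: loc_integrable_iff)
qed (use assms in auto)

lemma integral_test_cong_AE:
  assumes "loc_integrable f" "loc_integrable g" "AE p in cyl. f p = g p" "\<phi> \<in> borel_measurable borel"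
  shows "(LINT p|cyl. f p * \<phi> p) = (LINT p|cyl. g p * \<phi> p)"
proof (rule integral_cong_AE)
  have [measurable]: "f \<in> borel_measurable borel" "g \<in> borel_measurable borel" "\<phi> \<in> borel_measurable borel"
    using assms by (auto simp: loc_integrable_def)
  show "(\<lambda>p. f p * \<phi> p) \<in> borel_measurable cyl" "(\<lambda>p. g p * \<phi> p) \<in> borel_measurable cyl"
    by (rule measurable_cyl, measurable)+
  show "AE p in cyl. f p * \<phi> p = g p * \<phi> p"
    using assms(3) by eventually_elim simp
qed

lemma AE_eq_if_tests_equal:
  assumes f: "loc_integrable f" and g: "loc_integrable g"
    and eq: "\<And>D. test_jet D \<Longrightarrow> (LINT p|cyl. f p * D 0 0 p) = (LINT p|cyl. g p * D 0 0 p)"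
  shows "AE p in cyl. f p = g p"
proof -
  have "AE p in cyl. f p + (-1) * g p = 0"
  proof (rule fundamental_lemma)
    show "loc_integrable (\<lambda>p. f p + (-1) * g p)" by (intro loc_integrable_add loc_integrable_cmult f g)
    fix D assume D: "test_jet D"
    show "(LINT p|cyl. (f p + (-1) * g p) * D 0 0 p) = 0"
      using integrable_loc_test[OF f D, of 0 0] integrable_loc_test[OF g D, of 0 0] eq[OF D]
      by (simp add: left_diff_distrib)
  qed
  then show ?thesis by eventually_elim simp
qed

lemma weak_derivD:
  assumes "weak_deriv i j f g"
  shows "loc_integrable f" "loc_integrable g"
    "test_jet D \<Longrightarrow> (LINT p|cyl. f p * D i j p) = (-1) ^ (i + j) * (LINT p|cyl. g p * D 0 0 p)"
  using assms by (auto simp: weak_deriv_def)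

lemma weak_deriv_cong_AE:
  assumes "weak_deriv i j f g" "loc_integrable f'" "loc_integrable g'"
    "AE p in cyl. f p = f' p" "AE p in cyl. g p = g' p"
  shows "weak_deriv i j f' g'"
  unfolding weak_deriv_def
proof (intro conjI allI impI)
  fix D assume D: "test_jet D"
  have b: "D k l \<in> borel_measurable borel" for k l by (rule jet_borel[OF test_jetD[OF D]])
  show "(LINT p|cyl. f' p * D i j p) = (-1) ^ (i + j) * (LINT p|cyl. g' p * D 0 0 p)"
    using weak_derivD(3)[OF assms(1) D]
      integral_test_cong_AE[OF weak_derivD(1)[OF assms(1)] assms(2) assms(4) b]
      integral_test_cong_AE[OF weak_derivD(2)[OF assms(1)] assms(3) assms(5) b]
    by metis
qed (use assms in auto)

lemma weak_deriv_unique: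
  assumes "weak_deriv i j f g" "weak_deriv i j f g'"
  shows "AE p in cyl. g p = g' p"
proof (rule AE_eq_if_tests_equal)
  fix D assume "test_jet D"
  then show "(LINT p|cyl. g p * D 0 0 p) = (LINT p|cyl. g' p * D 0 0 p)"
    using weak_derivD(3)[OF assms(1), of D] weak_derivD(3)[OF assms(2), of D] by simp
qed (use assms in \<open>auto dest: weak_derivD\<close>)

lemma weak_deriv_pd: "weak_deriv i j f g \<Longrightarrow> weak_deriv i j f (pd i j f)"
  unfolding pd_def by (rule someI[of "weak_deriv i j f"])

lemma weak_deriv_add:
  assumes f: "weak_deriv i j f f'" and g: "weak_deriv i j g g'"
  shows "weak_deriv i j (\<lambda>p. f p + g p) (\<lambda>p. f' p + g' p)"
  unfolding weak_deriv_def
proof (intro conjI allI impI)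
  note loc = weak_derivD(1,2)[OF f] weak_derivD(1,2)[OF g]
  show "loc_integrable (\<lambda>p. f p + g p)" "loc_integrable (\<lambda>p. f' p + g' p)"
    by (intro loc_integrable_add loc)+
  fix D assume D: "test_jet D"
  note int = loc[THEN integrable_loc_test[OF _ D]]
  show "(LINT p|cyl. (f p + g p) * D i j p) = (-1) ^ (i + j) * (LINT p|cyl. (f' p + g' p) * D 0 0 p)"
    using weak_derivD(3)[OF f D] weak_derivD(3)[OF g D]
    by (simp add: distrib_right int distrib_left)
qed

lemma weak_deriv_cmult:
  assumes f: "weak_deriv i j f f'"
  shows "weak_deriv i j (\<lambda>p. c * f p) (\<lambda>p. c * f' p)"
  unfolding weak_deriv_def
proof (intro conjI allI impI)
  show "loc_integrable (\<lambda>p. c * f p)" "loc_integrable (\<lambda>p. c * f' p)"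
    by (intro loc_integrable_cmult weak_derivD[OF f])+
  fix D assume D: "test_jet D"
  show "(LINT p|cyl. (c * f p) * D i j p) = (-1) ^ (i + j) * (LINT p|cyl. (c * f' p) * D 0 0 p)"
    using weak_derivD(3)[OF f D] by (simp add: mult.assoc)
qed

text \<open>Here and in the next lemma f is tested against a test function whose indices are shifted by k and l.\<close>

lemma weak_deriv_trans:
  assumes f: "weak_deriv i j f g" and g: "weak_deriv k l g h"
  shows "weak_deriv (i + k) (j + l) f h"
  unfolding weak_deriv_def
proof (intro conjI allI impI)
  fix D assume D: "test_jet D"
  show "(LINT p|cyl. f p * D (i + k) (j + l) p) = (-1) ^ (i + k + (j + l)) * (LINT p|cyl. h p * D 0 0 p)"
    using weak_derivD(3)[OF f test_jet_shift_index[OF D, of k l]] weak_derivD(3)[OF g D]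
    by (simp add: power_add)
qed (use f g in \<open>auto dest: weak_derivD\<close>)

lemma weak_deriv_cancel:
  assumes f: "weak_deriv i j f g" and h: "weak_deriv (i + k) (j + l) f h"
  shows "weak_deriv k l g h"
  unfolding weak_deriv_def
proof (intro conjI allI impI)
  fix D assume D: "test_jet D"
  show "(LINT p|cyl. g p * D k l p) = (-1) ^ (k + l) * (LINT p|cyl. h p * D 0 0 p)"
    using weak_derivD(3)[OF f test_jet_shift_index[OF D, of k l]] weak_derivD(3)[OF h D]
    by (simp add: power_add)
qed (use f h in \<open>auto dest: weak_derivD\<close>)

section \<open>Averages of translates\<close>

lemma measurable_snd_cyl: "snd \<in> measurable (P \<Otimes>\<^sub>M cyl) borel"
proof -
  have "(\<lambda>p. p) \<in> measurable cyl borel" by (rule measurable_cyl) simp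
  then show ?thesis by (rule measurable_compose[OF measurable_snd])
qed

lemma integral_shift_factor:
  assumes [measurable]: "k \<in> borel_measurable borel" "\<phi> \<in> borel_measurable borel"
    and "theta_periodic k" "theta_periodic \<phi>"
  shows "(LINT p|cyl. k (p + d) * \<phi> p) = (LINT p|cyl. k p * \<phi> (p - d))"
    "integrable cyl (\<lambda>p. k (p + d) * \<phi> p) \<longleftrightarrow> integrable cyl (\<lambda>p. k p * \<phi> (p - d))"
proof -
  let ?f = "\<lambda>p. k p * \<phi> (p - d)"
  have "theta_periodic ?f"
    using assms(3,4) unfolding theta_periodic_def
    by (cases d) (simp, metis add.commute add_diff_eq)
  moreover have "?f \<in> borel_measurable borel" by measurable
  ultimately show "(LINT p|cyl. k (p + d) * \<phi> p) = (LINT p|cyl. k p * \<phi> (p - d))"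
    "integrable cyl (\<lambda>p. k (p + d) * \<phi> p) \<longleftrightarrow> integrable cyl (\<lambda>p. k p * \<phi> (p - d))"
    using integral_cyl_shift[of ?f d] integrable_cyl_shift[of ?f d] by simp_all
qed

text \<open>The average of the translates of a function k by \<open>c a\<close> with weights \<open>w a\<close>, for a in a finite measure
  space, and its adjoint. Translation invariance and Fubini's theorem transfer the average from k to
  the test function. The representation formula over the unit square and the fundamental theorem of
  calculus along segments are both instances.\<close>

locale averaging = finite_measure P for P :: "'a measure" +
  fixes c :: "'a \<Rightarrow> real \<times> real" and w :: "'a \<Rightarrow> real" and W B :: real
  assumes c_borel: "c \<in> borel_measurable P" and w_borel: "w \<in> borel_measurable P"
    and w_bound: "\<And>a. a \<in> space P \<Longrightarrow> \<bar>w a\<bar> \<le> W"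
    and c_bound: "\<And>a. a \<in> space P \<Longrightarrow> \<bar>snd (c a)\<bar> \<le> B"
begin

definition avg :: "field \<Rightarrow> field" where
  "avg k p = (LINT a|P. w a * k (p + c a))"

definition avg_adj :: "field \<Rightarrow> field" where
  "avg_adj \<phi> p = (LINT a|P. w a * \<phi> (p - c a))"

sublocale Pcyl: pair_sigma_finite P cyl
  by (intro pair_sigma_finite.intro sigma_finite_measure_axioms sigma_finite_cyl)

lemma meas:
  assumes [measurable]: "k \<in> borel_measurable borel" "\<phi> \<in> borel_measurable borel"
  shows "(\<lambda>(a, p). w a * (k (p + c a) * \<phi> p)) \<in> borel_measurable (P \<Otimes>\<^sub>M cyl)"
    "(\<lambda>(a, p). w a * (k p * \<phi> (p - c a))) \<in> borel_measurable (P \<Otimes>\<^sub>M cyl)"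
proof -
  note [measurable] = measurable_snd_cyl c_borel w_borel
  show "(\<lambda>(a, p). w a * (k (p + c a) * \<phi> p)) \<in> borel_measurable (P \<Otimes>\<^sub>M cyl)"
    "(\<lambda>(a, p). w a * (k p * \<phi> (p - c a))) \<in> borel_measurable (P \<Otimes>\<^sub>M cyl)"
    unfolding case_prod_beta by measurable
qed

lemma integrable_adj:
  assumes k: "loc_integrable k" and [measurable]: "\<phi> \<in> borel_measurable borel"
    and K: "\<And>p. \<bar>\<phi> p\<bar> \<le> K" and R: "\<And>x y. \<bar>y\<bar> > R \<Longrightarrow> \<phi> (x, y) = 0"
  shows "integrable (P \<Otimes>\<^sub>M cyl) (\<lambda>(a, p). w a * (k p * \<phi> (p - c a)))"
proof (rule Bochner_Integration.integrable_bound)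
  have [measurable]: "k \<in> borel_measurable borel" using k by (simp add: loc_integrable_def)
  have int: "integrable cyl (\<lambda>p. indicator {-(R+B)..R+B} (snd p) * k p)"
    using k unfolding loc_integrable_iff by blast
  have "integrable (P \<Otimes>\<^sub>M cyl) (\<lambda>(a, p). indicator {-(R+B)..R+B} (snd p) * k p)"
  proof (rule Pcyl.Fubini_integrable)
    note [measurable] = measurable_snd_cyl
    show "(\<lambda>(a, p). indicator {-(R+B)..R+B} (snd p) * k p) \<in> borel_measurable (P \<Otimes>\<^sub>M cyl)"
      unfolding case_prod_beta by measurable
  qed (use int in auto)
  then show "integrable (P \<Otimes>\<^sub>M cyl) (\<lambda>(a, p). (W * K) * (indicator {-(R+B)..R+B} (snd p) * k p))"
    unfolding case_prod_beta by (rule integrable_mult_right)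
  show "(\<lambda>(a, p). w a * (k p * \<phi> (p - c a))) \<in> borel_measurable (P \<Otimes>\<^sub>M cyl)"
    by (rule meas) measurable
  have "\<bar>w a * (k p * \<phi> (p - c a))\<bar> \<le> \<bar>(W * K) * (indicator {-(R+B)..R+B} (snd p) * k p)\<bar>"
    if a: "a \<in> space P" for a p
  proof (cases "\<bar>snd p\<bar> > R + B")
    case True
    then have "\<bar>snd p - snd (c a)\<bar> > R" using c_bound[OF a] by linarith
    then show ?thesis using R[of "snd p - snd (c a)" "fst p - fst (c a)"] by (simp add: minus_prod_def)
  next
    case False
    have "\<bar>w a\<bar> * \<bar>\<phi> (p - c a)\<bar> \<le> W * K"
      using w_bound[OF a] K[of "p - c a"] by (intro mult_mono) auto
    then have "\<bar>w a\<bar> * \<bar>\<phi> (p - c a)\<bar> * \<bar>k p\<bar> \<le> \<bar>W * K\<bar> * \<bar>k p\<bar>"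
      by (intro mult_right_mono) auto
    moreover have "snd p \<in> {-(R+B)..R+B}" using False by auto
    ultimately show ?thesis by (simp add: abs_mult ac_simps)
  qed
  then show "AE x in P \<Otimes>\<^sub>M cyl. norm (case x of (a, p) \<Rightarrow> w a * (k p * \<phi> (p - c a)))
      \<le> norm (case x of (a, p) \<Rightarrow> (W * K) * (indicator {-(R+B)..R+B} (snd p) * k p))"
    by (intro AE_I2) (auto simp: space_pair_measure)
qed

text \<open>For fixed a the translation can be moved to \<open>\<phi>\<close>, which turns the integrand into the one of
  \<open>integrable_adj\<close>. There \<open>\<phi>\<close> is dominated by the indicator of a larger strip, a bound that does not
  depend on a.\<close>

lemma integrable_avg_pair:
  assumes k: "loc_integrable k" and phi [measurable]: "\<phi> \<in> borel_measurable borel"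
    and K: "\<And>p. \<bar>\<phi> p\<bar> \<le> K" and R: "\<And>x y. \<bar>y\<bar> > R \<Longrightarrow> \<phi> (x, y) = 0"
    and per: "theta_periodic \<phi>"
  shows "integrable (P \<Otimes>\<^sub>M cyl) (\<lambda>(a, p). w a * (k (p + c a) * \<phi> p))"
proof (rule Pcyl.Fubini_integrable)
  have [measurable]: "k \<in> borel_measurable borel" and kper: "theta_periodic k"
    using k by (auto simp: loc_integrable_def)
  have adj: "integrable (P \<Otimes>\<^sub>M cyl) (\<lambda>(a, p). w a * (k p * \<phi> (p - c a)))"
    by (rule integrable_adj[where K = K and R = R]) (use k K R in auto)
  show "(\<lambda>(a, p). w a * (k (p + c a) * \<phi> p)) \<in> borel_measurable (P \<Otimes>\<^sub>M cyl)"
    by (rule meas) measurable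
  have eq: "(LINT p|cyl. \<bar>w a * (k (p + c a) * \<phi> p)\<bar>) = (LINT p|cyl. \<bar>w a * (k p * \<phi> (p - c a))\<bar>)" for a
    using integral_shift_factor(1)[of "\<lambda>p. \<bar>k p\<bar>" "\<lambda>p. \<bar>\<phi> p\<bar>" "c a"] kper per
    by (simp add: abs_mult theta_periodic_def)
  show "integrable P (\<lambda>a. LINT p|cyl. norm (case (a, p) of (a, p) \<Rightarrow> w a * (k (p + c a) * \<phi> p)))"
    using Pcyl.integrable_fst'[OF integrable_norm[OF adj]] by (simp add: eq)
  show "AE a in P. integrable cyl (\<lambda>p. case (a, p) of (a, p) \<Rightarrow> w a * (k (p + c a) * \<phi> p))"
    using Pcyl.AE_integrable_fst'[OF adj]
  proof eventually_elim
    case (elim a)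
    then show ?case
      using integral_shift_factor(2)[OF _ phi kper per, of "c a"] by (cases "w a = 0") auto
  qed
qed

lemma borel_avg:
  assumes [measurable]: "k \<in> borel_measurable borel"
  shows "avg k \<in> borel_measurable borel"
proof -
  note [measurable] = c_borel w_borel
  have "(\<lambda>(p, a). w a * k (p + c a)) \<in> borel_measurable (borel \<Otimes>\<^sub>M P)"
    unfolding case_prod_beta by measurable
  then show ?thesis unfolding avg_def by (intro borel_measurable_lebesgue_integral) auto
qed

lemma periodic_avg: "theta_periodic k \<Longrightarrow> theta_periodic (avg k)"
  unfolding theta_periodic_def avg_def
  by (auto intro!: Bochner_Integration.integral_cong)
    (metis add.assoc add.commute add_Pair surjective_pairing add_0)

lemma loc_integrable_avg:
  assumes k: "loc_integrable k" shows "loc_integrable (avg k)"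
  unfolding loc_integrable_iff
proof (intro conjI allI)
  fix R :: real
  have "integrable (P \<Otimes>\<^sub>M cyl) (\<lambda>(a, p). w a * (k (p + c a) * indicator {-R..R} (snd p)))"
    by (rule integrable_avg_pair[OF k, where K = 1 and R = R])
      (auto simp: theta_periodic_def indicator_def)
  from Pcyl.integrable_snd[OF this]
  show "integrable cyl (\<lambda>p. indicator {-R..R} (snd p) * avg k p)"
    by (simp add: avg_def mult.assoc[symmetric] mult.commute[of _ "indicator _ _"])
      (simp add: mult.assoc)
qed (use k borel_avg periodic_avg in \<open>auto simp: loc_integrable_def\<close>)

lemma integral_avg:
  assumes k: "loc_integrable k" and D: "test_jet D"
  shows "(LINT p|cyl. avg k p * D i j p) = (LINT a|P. w a * (LINT p|cyl. k p * D i j (p - c a)))"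
    "(LINT p|cyl. k p * avg_adj (D i j) p) = (LINT a|P. w a * (LINT p|cyl. k p * D i j (p - c a)))"
proof -
  have kb: "k \<in> borel_measurable borel" "theta_periodic k"
    using k by (auto simp: loc_integrable_def)
  have Db: "D i j \<in> borel_measurable borel" "theta_periodic (D i j)"
    using jet_borel[OF test_jetD[OF D]] jetD(1)[OF test_jetD[OF D]] by auto
  obtain K where K: "\<And>p. \<bar>D i j p\<bar> \<le> K" using test_jet_bounded[OF D] by metis
  obtain R where R: "\<And>i j x y. \<bar>y\<bar> > R \<Longrightarrow> D i j (x, y) = 0" using test_jet_support[OF D] by metis
  have int1: "integrable (P \<Otimes>\<^sub>M cyl) (\<lambda>(a, p). w a * (k (p + c a) * D i j p))"
    by (rule integrable_avg_pair[where K = K and R = R]) (use k K R Db in auto)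
  have int2: "integrable (P \<Otimes>\<^sub>M cyl) (\<lambda>(a, p). w a * (k p * D i j (p - c a)))"
    by (rule integrable_adj[where K = K and R = R]) (use k K R Db in auto)
  have "(LINT p|cyl. avg k p * D i j p) = (LINT p|cyl. LINT a|P. w a * (k (p + c a) * D i j p))"
    by (simp add: avg_def mult.assoc[symmetric])
  also have "\<dots> = (LINT a|P. LINT p|cyl. w a * (k (p + c a) * D i j p))"
    by (rule Pcyl.Fubini_integral[OF int1])
  also have "\<dots> = (LINT a|P. w a * (LINT p|cyl. k p * D i j (p - c a)))"
    by (simp add: integral_shift_factor(1)[OF kb(1) Db(1) kb(2) Db(2)])
  finally show "(LINT p|cyl. avg k p * D i j p) = (LINT a|P. w a * (LINT p|cyl. k p * D i j (p - c a)))" .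
  have "(LINT p|cyl. k p * avg_adj (D i j) p) = (LINT p|cyl. LINT a|P. w a * (k p * D i j (p - c a)))"
    by (simp add: avg_adj_def mult.left_commute[of _ "k _"])
  also have "\<dots> = (LINT a|P. LINT p|cyl. w a * (k p * D i j (p - c a)))"
    by (rule Pcyl.Fubini_integral[OF int2])
  finally show "(LINT p|cyl. k p * avg_adj (D i j) p) = (LINT a|P. w a * (LINT p|cyl. k p * D i j (p - c a)))"
    by simp
qed

text \<open>The duality behind all identities between weak derivatives below: an identity for averages of
  translates of weak derivatives follows from the identity for the adjoint averages of smooth
  functions.\<close>

lemma integral_avg_weak_deriv:
  assumes f: "weak_deriv i j f g" and D: "test_jet D"
  shows "(LINT p|cyl. avg g p * D 0 0 p) = (-1) ^ (i + j) * (LINT p|cyl. f p * avg_adj (D i j) p)"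
proof -
  have "(LINT p|cyl. f p * D i j (p - d)) = (-1) ^ (i + j) * (LINT p|cyl. g p * D 0 0 (p - d))" for d
    using weak_derivD(3)[OF f test_jet_translate[OF D, of "- d"]] by simp
  then have "(LINT p|cyl. g p * D 0 0 (p - d)) = (-1) ^ (i + j) * (LINT p|cyl. f p * D i j (p - d))" for d
    by (simp add: power_mult_distrib[symmetric] mult.assoc[symmetric])
  then show ?thesis
    using integral_avg(1)[OF weak_derivD(2)[OF f] D, of 0 0] integral_avg(2)[OF weak_derivD(1)[OF f] D, of i j]
    by (simp add: mult.left_commute[of _ "(-1) ^ _"])
qed

lemma integrable_avg_adj:
  assumes k: "loc_integrable k" and D: "test_jet D"
  shows "integrable cyl (\<lambda>p. k p * avg_adj (D i j) p)"
proof -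
  have Db: "D i j \<in> borel_measurable borel"
    using jet_borel[OF test_jetD[OF D]] by auto
  obtain K where K: "\<And>p. \<bar>D i j p\<bar> \<le> K" using test_jet_bounded[OF D] by metis
  obtain R where R: "\<And>i j x y. \<bar>y\<bar> > R \<Longrightarrow> D i j (x, y) = 0" using test_jet_support[OF D] by metis
  have int2: "integrable (P \<Otimes>\<^sub>M cyl) (\<lambda>(a, p). w a * (k p * D i j (p - c a)))"
    by (rule integrable_adj[where K = K and R = R]) (use k K R Db in auto)
  from Pcyl.integrable_snd[OF this] show ?thesis
    by (simp add: avg_adj_def mult.left_commute[of _ "k _"])
qed

end

section \<open>The fundamental theorem of calculus for weak derivatives\<close>

abbreviation I01 :: "real measure" where
  "I01 \<equiv> restrict_space lborel {0..1}"

lemma finite_measure_I01: "finite_measure I01"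
  by (rule finite_measureI) (simp add: space_restrict_space emeasure_restrict_space)

lemma integral_I01: "(LINT s|I01. f s) = (LINT s|lborel. indicator {0..1} s *\<^sub>R (f s :: real))"
  by (rule integral_restrict_space) simp

lemma integral_I01_const: "(LINT s|I01. (c::real)) = c"
  by (simp only: integral_I01) simp

lemma integral_I01_FTC:
  assumes "\<And>s. (F has_real_derivative f s) (at s)" "continuous_on UNIV f"
  shows "(LINT s|I01. f s) = F 1 - F 0"
  unfolding integral_I01
proof (rule integral_FTC_atLeastAtMost)
  show "(F has_vector_derivative f s) (at s within {0..1})" for s
    using assms(1)[of s] by (simp add: has_real_derivative_iff_has_vector_derivative has_vector_derivative_at_within)
  show "continuous_on {0..1} f" using assms(2) by (rule continuous_on_subset) simp
qed simp

text \<open>The index of a first-order derivative; \<open>dir\<close> is the corresponding unit vector. Both directions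
  are treated at once.\<close>

definition unit_dir :: "nat \<Rightarrow> nat \<Rightarrow> bool" where
  "unit_dir i j \<longleftrightarrow> (i = 1 \<and> j = 0) \<or> (i = 0 \<and> j = 1)"

definition dir :: "nat \<Rightarrow> nat \<Rightarrow> real \<times> real" where
  "dir i j = (real i, real j)"

lemma jet_directional:
  assumes D: "jet D" and ij: "unit_dir i j"
  shows "((\<lambda>s. D k l (p + (s * t) *\<^sub>R dir i j)) has_real_derivative
      t * D (k + i) (l + j) (p + (s * t) *\<^sub>R dir i j)) (at s)"
proof -
  obtain x y where p: "p = (x, y)" by (cases p)
  have lin: "((\<lambda>s. z + s * t) has_real_derivative t) (at s)" for z
    by (auto intro!: derivative_eq_intros)
  show ?thesis
    using ij DERIV_chain2[OF jetD(3)[OF D, of k l y "x + s * t"] lin[of x]]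
      DERIV_chain2[OF jetD(4)[OF D, of k l x "y + s * t"] lin[of y]]
    by (auto simp: unit_dir_def dir_def p mult.commute)
qed

text \<open>The parametrisation of the segment by the unit interval, with t as a factor, gives the same formula
  for positive and negative t.\<close>

lemma jet_increment:
  assumes D: "jet D" and ij: "unit_dir i j"
  shows "(LINT s|I01. t * D (k + i) (l + j) (p + (s * t) *\<^sub>R dir i j)) = D k l (p + t *\<^sub>R dir i j) - D k l p"
proof -
  have "continuous_on UNIV (\<lambda>s. t * D (k + i) (l + j) (p + (s * t) *\<^sub>R dir i j))"
    by (intro continuous_intros continuous_on_compose2[OF jetD(2)[OF D]]) auto
  from integral_I01_FTC[OF jet_directional[OF D ij] this] show ?thesis by (simp add:)
qed

lemma loc_integrable_continuous:
  assumes "theta_periodic f" "continuous_on UNIV f" shows "loc_integrable f"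
  unfolding loc_integrable_def
proof (intro conjI allI)
  show "f \<in> borel_measurable borel" by (rule borel_measurable_continuous_onI) fact
  show "set_integrable lborel ({0..1} \<times> {-R..R}) f" for R
    unfolding set_integrable_def
    by (rule borel_integrable_compact) (auto intro!: compact_Times continuous_on_subset[OF assms(2)])
qed fact

lemma segment_averaging: "averaging I01 (\<lambda>s. (s * t) *\<^sub>R dir i j) (\<lambda>s. t) \<bar>t\<bar> (\<bar>t\<bar> * real j)"
proof -
  interpret finite_measure I01 by (rule finite_measure_I01)
  show ?thesis
  proof
    show "(\<lambda>s. (s * t) *\<^sub>R dir i j) \<in> borel_measurable I01"
      by (intro measurable_restrict_space1) (simp add: borel_measurable_continuous_onI continuous_intros)
    show "\<bar>snd ((s * t) *\<^sub>R dir i j)\<bar> \<le> \<bar>t\<bar> * real j" if "s \<in> space I01" for s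
      using that mult_right_mono[of s 1 "\<bar>t\<bar> * real j"] by (simp add: space_restrict_space abs_mult mult.assoc dir_def)
  qed auto
qed

lemma segment_avg_adj:
  assumes D: "test_jet D" and ij: "unit_dir i j"
  shows "averaging.avg_adj I01 (\<lambda>s. (s * t) *\<^sub>R dir i j) (\<lambda>s. t) (D i j) p = D 0 0 p - D 0 0 (p - t *\<^sub>R dir i j)"
proof -
  interpret averaging I01 "\<lambda>s. (s * t) *\<^sub>R dir i j" "\<lambda>s. t" "\<bar>t\<bar>" "\<bar>t\<bar> * real j" by (rule segment_averaging)
  have "(LINT s|I01. t * D i j (p - (s * t) *\<^sub>R dir i j)) = - (LINT s|I01. (- t) * D (0 + i) (0 + j) (p + (s * - t) *\<^sub>R dir i j))"
    by simp
  also have "\<dots> = D 0 0 p - D 0 0 (p - t *\<^sub>R dir i j)"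
    by (subst jet_increment[OF test_jetD[OF D] ij]) simp
  finally show ?thesis by (simp add: avg_adj_def)
qed

text \<open>By translation invariance the derivative may be averaged over a unit segment. The average is the
  difference of the test function and a translate, which have the same integral.\<close>

lemma integral_test_derivative_zero:
  assumes D: "test_jet D" and ij: "unit_dir i j"
  shows "(LINT p|cyl. D i j p) = 0"
proof -
  interpret averaging I01 "\<lambda>s. (s * 1) *\<^sub>R dir i j" "\<lambda>s. 1" "\<bar>1\<bar>" "\<bar>1\<bar> * real j" by (rule segment_averaging)
  have one: "loc_integrable (\<lambda>p. 1)"
    by (rule loc_integrable_continuous) (auto simp: theta_periodic_def)
  have "avg (\<lambda>p. 1) p = 1" for p
    unfolding avg_def by (simp only: mult_1 integral_I01_const)
  then have "(LINT p|cyl. D i j p) = (LINT p|cyl. avg_adj (D i j) p)"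
    using integral_avg[OF one D, of i j] by simp
  also have "\<dots> = (LINT p|cyl. D 0 0 p - D 0 0 (p + (- dir i j)))"
    using segment_avg_adj[OF D ij, of 1] by simp
  also have "\<dots> = 0"
  proof -
    note jet = test_jetD[OF D]
    have "integrable cyl (D 0 0)" using integrable_loc_test[OF one D, of 0 0] by simp
    then show ?thesis
      using integrable_cyl_shift[OF jet_borel[OF jet] jetD(1)[OF jet], of 0 0 "- dir i j"]
        integral_cyl_shift[OF jet_borel[OF jet] jetD(1)[OF jet], of 0 0 "- dir i j"] by simp
  qed
  finally show ?thesis .
qed

lemma loc_integrable_jet: "jet D \<Longrightarrow> loc_integrable (D i j)"
  by (intro loc_integrable_continuous jetD)

text \<open>Integration by parts: \<open>integral_test_derivative_zero\<close> for the product of the jet and the test function.\<close>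

lemma jet_weak_deriv_unit:
  assumes U: "jet U" and ij: "unit_dir i j"
  shows "weak_deriv i j (U k l) (U (k + i) (l + j))"
  unfolding weak_deriv_def
proof (intro conjI allI impI)
  show "loc_integrable (U k l)" "loc_integrable (U (k + i) (l + j))"
    by (rule loc_integrable_jet[OF U])+
  fix D assume D: "test_jet D"
  define V where "V = (\<lambda>i j. U (i + k) (j + l))"
  have V: "jet V" unfolding V_def by (rule jet_shift_index[OF U])
  have "test_jet (jet_mult V D)"
    using D jet_jet_mult[OF V test_jetD[OF D]] by (auto simp: test_jet_iff)
  from integral_test_derivative_zero[OF this ij]
  have "(LINT p|cyl. V 0 0 p * D i j p + V i j p * D 0 0 p) = 0"
    using ij by (auto simp: unit_dir_def jet_mult_def add.commute)
  then have "(LINT p|cyl. V 0 0 p * D i j p) = - (LINT p|cyl. V i j p * D 0 0 p)"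
    using integrable_loc_test[OF loc_integrable_jet[OF V] D] by simp
  moreover have "(-1 :: real) ^ (i + j) = -1" using ij by (auto simp: unit_dir_def)
  ultimately show "(LINT p|cyl. U k l p * D i j p) = (-1) ^ (i + j) * (LINT p|cyl. U (k + i) (l + j) p * D 0 0 p)"
    by (simp add: V_def add.commute)
qed

lemma weak_deriv_0: "loc_integrable f \<Longrightarrow> weak_deriv 0 0 f f"
  by (simp add: weak_deriv_def)

lemma jet_weak_deriv:
  assumes U: "jet U" shows "weak_deriv i j (U k l) (U (k + i) (l + j))"
proof -
  have "weak_deriv i 0 (U k l) (U (k + i) l)"
  proof (induction i)
    case 0
    then show ?case using weak_deriv_0[OF loc_integrable_jet[OF U]] by simp
  next
    case (Suc i)
    show ?case
      using weak_deriv_trans[OF Suc jet_weak_deriv_unit[OF U, of 1 0 "k + i" l]] by (simp add: unit_dir_def)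
  qed
  moreover have "weak_deriv 0 j (U k' l) (U k' (l + j))" for k'
  proof (induction j)
    case 0
    then show ?case using weak_deriv_0[OF loc_integrable_jet[OF U]] by simp
  next
    case (Suc j)
    show ?case
      using weak_deriv_trans[OF Suc jet_weak_deriv_unit[OF U, of 0 1 k' "l + j"]] by (simp add: unit_dir_def)
  qed
  ultimately show ?thesis using weak_deriv_trans by fastforce
qed

lemma AE_eq_continuous:
  assumes F: "theta_periodic F" "continuous_on UNIV F" and G: "theta_periodic G" "continuous_on UNIV G"
    and eq: "AE p in cyl. F p = G p"
  shows "F p = G p"
proof -
  define S where "S = {p. F p \<noteq> G p} \<inter> {0<..<1} \<times> UNIV"
  have "open {p. F p \<noteq> G p}"
    using F(2) G(2) by (intro open_Collect_neq) auto
  then have S: "open S" unfolding S_def by (intro open_Int open_Times) auto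
  have "AE p in lborel. p \<notin> S"
    using eq unfolding AE_cyl_iff by eventually_elim (auto simp: S_def)
  then have "S \<in> null_sets lborel" using S by (subst (asm) AE_iff_null_sets[symmetric]) auto
  then have "negligible S"
    by (simp add: negligible_iff_null_sets null_sets_completionI)
  then have "S = {}" using open_not_negligible S by blast
  then have "{0<..<1} \<times> UNIV \<subseteq> {p. F p = G p}" by (auto simp: S_def)
  moreover have "closed {p. F p = G p}"
    using F(2) G(2) by (intro closed_Collect_eq) auto
  ultimately have "closure ({0<..<1} \<times> UNIV) \<subseteq> {p. F p = G p}"
    by (rule closure_minimal)
  then have "F (x, y) = G (x, y)" if "0 \<le> x" "x \<le> 1" for x y
    using that by (auto simp: closure_Times subset_iff)
  from this[of "frac (fst p)" "snd p"] show ?thesis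
    using theta_periodic_frac[OF F(1), of "fst p" "snd p"] theta_periodic_frac[OF G(1), of "fst p" "snd p"]
      frac_lt_1[of "fst p"] by simp
qed

lemma continuous_segment_avg:
  assumes G: "continuous_on UNIV G"
  shows "continuous_on UNIV (\<lambda>p. LINT s|I01. (t::real) * G (p + (s * t) *\<^sub>R e :: real \<times> real))"
proof -
  have c: "continuous_on UNIV (\<lambda>s. t * G (p + (s * t) *\<^sub>R e))" for p
    by (intro continuous_intros continuous_on_compose2[OF G]) auto
  have "(LINT s|I01. t * G (p + (s * t) *\<^sub>R e)) = integral (cbox 0 1) (\<lambda>s. t * G (p + (s * t) *\<^sub>R e))" for p
  proof -
    have "set_integrable lborel {0..1} (\<lambda>s. t * G (p + (s * t) *\<^sub>R e))"
      unfolding set_integrable_def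
      by (rule borel_integrable_compact) (use continuous_on_subset[OF c] in auto)
    from set_borel_integral_eq_integral(2)[OF this] show ?thesis
      by (simp add: integral_I01 set_lebesgue_integral_def)
  qed
  moreover have "continuous_on UNIV (\<lambda>p. integral (cbox 0 1) (\<lambda>s. t * G (p + (s * t) *\<^sub>R e)))"
  proof (rule integral_continuous_on_param)
    show "continuous_on (UNIV \<times> cbox 0 1) (\<lambda>(p, s). t * G (p + (s * t) *\<^sub>R e))"
      unfolding case_prod_beta by (intro continuous_intros continuous_on_compose2[OF G]) auto
  qed
  ultimately show ?thesis by (simp only:)
qed

text \<open>By duality from \<open>jet_increment\<close> for test functions almost everywhere, and then everywhere by
  continuity of both sides.\<close>

lemma weak_deriv_increment:
  assumes F: "continuous_on UNIV F" and G: "continuous_on UNIV G"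
    and FG: "weak_deriv i j F G" and ij: "unit_dir i j"
  shows "F (p + t *\<^sub>R dir i j) - F p = (LINT s|I01. t * G (p + (s * t) *\<^sub>R dir i j))"
proof -
  interpret averaging I01 "\<lambda>s. (s * t) *\<^sub>R dir i j" "\<lambda>s. t" "\<bar>t\<bar>" "\<bar>t\<bar> * real j" by (rule segment_averaging)
  let ?e = "t *\<^sub>R dir i j"
  have per: "theta_periodic F" "theta_periodic G"
    using weak_derivD[OF FG] by (auto simp: loc_integrable_def)
  have Fb [measurable]: "F \<in> borel_measurable borel" by (rule borel_measurable_continuous_onI[OF F])
  have per': "theta_periodic (\<lambda>p. F (p + ?e) + (-1) * F p)"
    using theta_periodic_translate[OF per(1), of ?e] per(1) by (simp add: theta_periodic_def)
  have cont: "continuous_on UNIV (\<lambda>p. F (p + ?e) + (-1) * F p)"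
    by (intro continuous_intros continuous_on_compose2[OF F]) auto
  have Flin: "loc_integrable (\<lambda>p. F (p + ?e) + (-1) * F p)"
    by (rule loc_integrable_continuous[OF per' cont])
  have Gavg: "loc_integrable (avg G)" using weak_derivD[OF FG] by (intro loc_integrable_avg)
  have "AE p in cyl. F (p + ?e) + (-1) * F p = avg G p"
  proof (rule AE_eq_if_tests_equal[OF Flin Gavg])
    fix D assume D: "test_jet D"
    note jet = test_jetD[OF D]
    have Fl: "loc_integrable F" by (rule weak_derivD[OF FG])
    have int1: "integrable cyl (\<lambda>p. F p * D 0 0 (p - ?e))"
      using integrable_loc_test[OF Fl test_jet_translate[OF D, of "- ?e"], of 0 0] by simp
    have int1': "integrable cyl (\<lambda>p. F (p + ?e) * D 0 0 p)"
      using integral_shift_factor(2)[OF Fb jet_borel[OF jet] per(1) jetD(1)[OF jet]] int1 by simp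
    have int2: "integrable cyl (\<lambda>p. F p * D 0 0 p)"
      by (rule integrable_loc_test[OF Fl D])
    have "(LINT p|cyl. (F (p + ?e) + (-1) * F p) * D 0 0 p) = (LINT p|cyl. F (p + ?e) * D 0 0 p) - (LINT p|cyl. F p * D 0 0 p)"
      using int1' int2 by (simp add: left_diff_distrib)
    also have "(LINT p|cyl. F (p + ?e) * D 0 0 p) = (LINT p|cyl. F p * D 0 0 (p - ?e))"
      by (rule integral_shift_factor(1)[OF Fb jet_borel[OF jet] per(1) jetD(1)[OF jet]])
    also have "\<dots> - (LINT p|cyl. F p * D 0 0 p) = - (LINT p|cyl. F p * avg_adj (D i j) p)"
      unfolding segment_avg_adj[OF D ij] using int1 int2 by (simp add: right_diff_distrib)
    also have "\<dots> = (LINT p|cyl. avg G p * D 0 0 p)"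
      unfolding integral_avg_weak_deriv[OF FG D] using ij by (auto simp: unit_dir_def)
    finally show "(LINT p|cyl. (F (p + ?e) + (-1) * F p) * D 0 0 p) = (LINT p|cyl. avg G p * D 0 0 p)" .
  qed
  from AE_eq_continuous[OF per' cont periodic_avg[OF per(2)] _ this]
  have "F (p + ?e) + (-1) * F p = avg G p"
    using continuous_segment_avg[OF G, of t "dir i j"] unfolding avg_def by blast
  then show ?thesis unfolding avg_def by simp
qed

text \<open>The increment formula makes the difference quotient an average of G over a short segment.\<close>

lemma weak_deriv_imp_classical:
  assumes F: "continuous_on UNIV F" and G: "continuous_on UNIV G"
    and FG: "weak_deriv i j F G" and ij: "unit_dir i j"
  shows "((\<lambda>t. F (p + t *\<^sub>R dir i j)) has_real_derivative G p) (at 0)"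
  unfolding DERIV_def
proof (rule tendstoI)
  fix \<epsilon> :: real assume \<epsilon>: "\<epsilon> > 0"
  have "continuous_on UNIV (\<lambda>t. G (p + t *\<^sub>R dir i j))"
    by (intro continuous_intros continuous_on_compose2[OF G]) auto
  then have "isCont (\<lambda>t. G (p + t *\<^sub>R dir i j)) 0"
    by (simp add: continuous_on_eq_continuous_at)
  then obtain \<delta> where \<delta>: "\<delta> > 0" "\<And>t. \<bar>t\<bar> < \<delta> \<Longrightarrow> \<bar>G (p + t *\<^sub>R dir i j) - G p\<bar> < \<epsilon> / 2"
    using \<epsilon> by (force simp: continuous_at_eps_delta dist_real_def dest: spec[of _ "\<epsilon> / 2"])
  have "dist ((F (p + (0 + t) *\<^sub>R dir i j) - F (p + 0 *\<^sub>R dir i j)) / t) (G p) < \<epsilon>" if t: "t \<noteq> 0" "\<bar>t\<bar> < \<delta>" for t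
  proof -
    have c: "continuous_on UNIV (\<lambda>s. t * G (p + (s * t) *\<^sub>R dir i j))"
      by (intro continuous_intros continuous_on_compose2[OF G]) auto
    have int: "integrable I01 (\<lambda>s. t * G (p + (s * t) *\<^sub>R dir i j))"
      by (subst integrable_restrict_space)
        (simp, rule borel_integrable_compact, auto intro!: continuous_on_subset[OF c])
    have int': "integrable I01 (\<lambda>s. t * G p)"
      by (rule finite_measure.integrable_const[OF finite_measure_I01])
    have "(LINT s|I01. t * G p) = t * G p" by (rule integral_I01_const)
    then have "F (p + t *\<^sub>R dir i j) - F p - t * G p
        = (LINT s|I01. t * G (p + (s * t) *\<^sub>R dir i j) - t * G p)"
      using int int' weak_deriv_increment[OF F G FG ij, of p t] by simp
    also have "\<bar>\<dots>\<bar> \<le> (LINT s|I01. \<bar>t * G (p + (s * t) *\<^sub>R dir i j) - t * G p\<bar>)"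
      by (rule integral_abs_bound)
    also have "\<dots> \<le> (LINT s|I01. \<bar>t\<bar> * (\<epsilon> / 2))"
    proof (rule integral_mono)
      show "integrable I01 (\<lambda>s. \<bar>t * G (p + (s * t) *\<^sub>R dir i j) - t * G p\<bar>)"
        using int int' by auto
      show "integrable I01 (\<lambda>s. \<bar>t\<bar> * (\<epsilon> / 2))"
        by (rule finite_measure.integrable_const[OF finite_measure_I01])
      fix s assume "s \<in> space I01"
      then have "\<bar>s * t\<bar> \<le> 1 * \<bar>t\<bar>" unfolding abs_mult by (intro mult_right_mono) (auto simp: space_restrict_space)
      then have "\<bar>s * t\<bar> < \<delta>" using t by linarith
      from \<delta>(2)[OF this] have "\<bar>t\<bar> * \<bar>G (p + (s * t) *\<^sub>R dir i j) - G p\<bar> \<le> \<bar>t\<bar> * (\<epsilon> / 2)"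
        by (intro mult_left_mono) auto
      then show "\<bar>t * G (p + (s * t) *\<^sub>R dir i j) - t * G p\<bar> \<le> \<bar>t\<bar> * (\<epsilon> / 2)"
        by (simp add: abs_mult[symmetric] right_diff_distrib)
    qed
    also have "\<dots> = \<bar>t\<bar> * (\<epsilon> / 2)" by (rule integral_I01_const)
    also have "\<dots> < \<bar>t\<bar> * \<epsilon>" using t \<epsilon> by simp
    finally have "\<bar>(F (p + t *\<^sub>R dir i j) - F p - t * G p) / t\<bar> < \<epsilon>"
      using t by (simp add: abs_divide divide_less_eq mult.commute)
    then show ?thesis using t by (simp add: dist_real_def diff_divide_distrib)
  qed
  then show "\<forall>\<^sub>F t in at 0. dist ((F (p + (0 + t) *\<^sub>R dir i j) - F (p + 0 *\<^sub>R dir i j)) / t) (G p) < \<epsilon>"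
    unfolding eventually_at using \<delta>(1) by (intro exI[of _ \<delta>]) (auto simp: dist_real_def)
qed

section \<open>Smooth representatives\<close>

definition square :: "(real \<times> real) measure" where
  "square = restrict_space lborel ({0..1} \<times> {0..1})"

lemma space_square: "space square = {0..1} \<times> {0..1}"
  by (simp add: square_def space_restrict_space)

lemma finite_measure_square: "finite_measure square"
proof (rule finite_measureI)
  have "emeasure square (space square) = emeasure (lborel \<Otimes>\<^sub>M lborel) ({0..1::real} \<times> {0..1::real})"
    unfolding square_def lborel_prod by (simp add: space_restrict_space emeasure_restrict_space)
  also have "\<dots> = 1" by (subst lborel.emeasure_pair_measure_Times) auto
  finally show "emeasure square (space square) \<noteq> \<infinity>" by simp
qed

lemma measurable_square: "f \<in> measurable borel N \<Longrightarrow> f \<in> measurable square N"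
  by (simp add: square_def measurable_restrict_space1)

lemma integral_square: "(LINT a|square. f a) = (LINT a|lborel. indicator ({0..1} \<times> {0..1}) a *\<^sub>R (f a :: real))"
  unfolding square_def by (rule integral_restrict_space) simp

lemma integrable_square_continuous:
  assumes "continuous_on UNIV f" shows "integrable square (f :: _ \<Rightarrow> real)"
  unfolding square_def
  by (subst integrable_restrict_space, simp, rule borel_integrable_compact)
    (auto intro!: compact_Times continuous_on_subset[OF assms])

lemma integral_square_iterated:
  fixes f :: field
  assumes "continuous_on UNIV f"
  shows "(LINT a|square. f a) = (LINT b|I01. LINT a|I01. f (a, b))"
proof -
  let ?g = "\<lambda>a b. indicator {0..1} b *\<^sub>R (indicator {0..1} a *\<^sub>R f (a, b))"
  have eq: "(\<lambda>a. indicator ({0..1} \<times> {0..1}) a *\<^sub>R f a) = case_prod ?g"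
    by (auto simp: indicator_def fun_eq_iff)
  have "integrable lborel (\<lambda>a. indicator ({0..1} \<times> {0..1}) a *\<^sub>R f a)"
    by (rule borel_integrable_compact) (auto intro!: compact_Times continuous_on_subset[OF assms])
  then have "integrable (lborel \<Otimes>\<^sub>M lborel) (case_prod ?g)"
    by (simp only: lborel_prod eq)
  from lborel_pair.integral_snd[OF this]
  have "(LINT b|lborel. LINT a|lborel. ?g a b) = (LINT a|square. f a)"
    unfolding integral_square eq lborel_prod .
  then show ?thesis
    by (simp add: integral_I01)
qed

text \<open>Integration of \<open>d/da (a f(x - 1 + a))\<close> over the unit interval gives
  \<open>f(x) = \<integral> (f + a f')(x - 1 + a) da\<close>. In both variables together this expresses the value of a function
  at a corner of a unit square by averages over the square of \<open>f\<close>, \<open>\<partial>\<^sub>1f\<close>, \<open>\<partial>\<^sub>2f\<close> and \<open>\<partial>\<^sub>1\<partial>\<^sub>2f\<close> with weights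
  1, a, b and ab.\<close>

definition corner_weight :: "nat \<Rightarrow> nat \<Rightarrow> real \<times> real \<Rightarrow> real" where
  "corner_weight r s a = fst a ^ r * snd a ^ s"

lemma corner_averaging: "averaging square (\<lambda>a. a - (1, 1)) (corner_weight r s) 1 1"
proof -
  interpret finite_measure square by (rule finite_measure_square)
  show ?thesis
  proof
    show "(\<lambda>a. a - (1, 1)) \<in> borel_measurable square" "corner_weight r s \<in> borel_measurable square"
      unfolding corner_weight_def by (rule measurable_square, measurable)+
    show "\<bar>corner_weight r s a\<bar> \<le> 1" if "a \<in> space square" for a
      using that by (auto simp: space_square corner_weight_def abs_mult intro!: mult_le_one power_le_one)
  qed (auto simp: space_square)
qed

definition corner_avg :: "nat \<Rightarrow> nat \<Rightarrow> field \<Rightarrow> field" where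
  "corner_avg r s k p = (LINT a|square. corner_weight r s a * k (p + (a - (1, 1))))"

definition corner_rep :: "(nat \<Rightarrow> nat \<Rightarrow> field) \<Rightarrow> field" where
  "corner_rep G p = (\<Sum>r\<le>1. \<Sum>s\<le>1. corner_avg r s (G r s) p)"

text \<open>The integrand is the mixed derivative \<open>\<partial>\<^sub>a\<partial>\<^sub>b\<close> of \<open>a b D(p + (1, 1) - (a, b))\<close>, hence two applications of the
  fundamental theorem of calculus. The signs are those of the reflection of the square, as the
  identity is applied to the adjoint averages.\<close>

lemma corner_identity:
  assumes D: "jet D"
  shows "(\<Sum>r\<le>1. \<Sum>s\<le>1. (-1) ^ (r + s) * (LINT a|square. corner_weight r s a * D r s (p - (a - (1, 1))))) = D 0 0 p"
proof -
  obtain x y where p: "p = (x, y)" by (cases p)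
  have c: "continuous_on UNIV (\<lambda>a. corner_weight r s a * D r s (p - (a - (1, 1))))" for r s
    unfolding corner_weight_def
    by (intro continuous_intros continuous_on_compose2[OF jetD(2)[OF D]]) auto
  have c': "continuous_on UNIV (\<lambda>a. \<Sum>r\<le>1. \<Sum>s\<le>1. (-1) ^ (r + s) * (corner_weight r s a * D r s (p - (a - (1, 1)))))"
    by (intro continuous_intros c)
  have dx: "((\<lambda>a. D r s (x + 1 - a, z)) has_real_derivative - D (Suc r) s (x + 1 - a, z)) (at a)" for r s z a
  proof -
    have "((\<lambda>a. x + 1 - a) has_real_derivative - 1) (at a)" by (auto intro!: derivative_eq_intros)
    from DERIV_chain2[where f = "\<lambda>w. D r s (w, z)" and g = "\<lambda>a. x + 1 - a", OF jetD(3)[OF D] this]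
    show ?thesis by simp
  qed
  have dy: "((\<lambda>b. D r s (z, y + 1 - b)) has_real_derivative - D r (Suc s) (z, y + 1 - b)) (at b)" for r s z b
  proof -
    have "((\<lambda>b. y + 1 - b) has_real_derivative - 1) (at b)" by (auto intro!: derivative_eq_intros)
    from DERIV_chain2[where f = "\<lambda>w. D r s (z, w)" and g = "\<lambda>b. y + 1 - b", OF jetD(4)[OF D] this]
    show ?thesis by simp
  qed
  have inner: "(LINT a|I01. (\<Sum>r\<le>1. \<Sum>s\<le>1. (-1) ^ (r + s) * (corner_weight r s (a, b) * D r s (p - ((a, b) - (1, 1))))))
      = D 0 0 (x, y + 1 - b) - b * D 0 1 (x, y + 1 - b)" for b
  proof -
    have "((\<lambda>a. a * D 0 0 (x + 1 - a, y + 1 - b) - b * (a * D 0 1 (x + 1 - a, y + 1 - b))) has_real_derivative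
        (\<Sum>r\<le>1. \<Sum>s\<le>1. (-1) ^ (r + s) * (corner_weight r s (a, b) * D r s (p - ((a, b) - (1, 1)))))) (at a)" for a
      by (rule DERIV_cong[OF DERIV_diff[OF DERIV_mult[OF DERIV_ident dx] DERIV_cmult[OF DERIV_mult[OF DERIV_ident dx]]]])
        (simp add: corner_weight_def p algebra_simps)
    moreover have "continuous_on UNIV (\<lambda>a. \<Sum>r\<le>1. \<Sum>s\<le>1. (-1) ^ (r + s) * (corner_weight r s (a, b) * D r s (p - ((a, b) - (1, 1)))))"
      by (rule continuous_on_compose2[OF c', of _ "\<lambda>a. (a, b)"]) (auto intro!: continuous_intros)
    ultimately show ?thesis
      by (subst integral_I01_FTC) auto
  qed
  have outer: "(LINT b|I01. D 0 0 (x, y + 1 - b) - b * D 0 1 (x, y + 1 - b)) = D 0 0 (x, y)"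
  proof -
    have "((\<lambda>b. b * D 0 0 (x, y + 1 - b)) has_real_derivative D 0 0 (x, y + 1 - b) - b * D 0 1 (x, y + 1 - b)) (at b)" for b
      by (rule DERIV_cong[OF DERIV_mult[OF DERIV_ident dy]]) simp
    moreover have "continuous_on UNIV (\<lambda>b. D 0 0 (x, y + 1 - b) - b * D 0 1 (x, y + 1 - b))"
      by (intro continuous_intros continuous_on_compose2[OF jetD(2)[OF D]]) auto
    ultimately show ?thesis
      by (subst integral_I01_FTC) auto
  qed
  have "(\<Sum>r\<le>1. \<Sum>s\<le>1. (-1) ^ (r + s) * (LINT a|square. corner_weight r s a * D r s (p - (a - (1, 1)))))
      = (LINT a|square. (\<Sum>r\<le>1. \<Sum>s\<le>1. (-1) ^ (r + s) * (corner_weight r s a * D r s (p - (a - (1, 1))))))"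
    using integrable_square_continuous[OF c] by (simp add: Bochner_Integration.integral_sum)
  also have "\<dots> = D 0 0 p"
    unfolding integral_square_iterated[OF c'] inner outer by (simp add: p)
  finally show ?thesis .
qed

lemma loc_integrable_sum:
  "finite I \<Longrightarrow> (\<And>i. i \<in> I \<Longrightarrow> loc_integrable (f i)) \<Longrightarrow> loc_integrable (\<lambda>p. \<Sum>i\<in>I. f i p)"
  by (induction I rule: finite_induct)
    (auto intro: loc_integrable_add loc_integrable_continuous simp: theta_periodic_def)

lemma corner_avg_eq: "corner_avg r s = averaging.avg square (\<lambda>a. a - (1, 1)) (corner_weight r s)"
proof -
  interpret averaging square "\<lambda>a. a - (1, 1)" "corner_weight r s" 1 1 by (rule corner_averaging)
  show ?thesis by (simp add: fun_eq_iff corner_avg_def avg_def)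
qed

lemma loc_integrable_corner_avg: "loc_integrable k \<Longrightarrow> loc_integrable (corner_avg r s k)"
  unfolding corner_avg_eq by (rule averaging.loc_integrable_avg[OF corner_averaging])

text \<open>Dual to \<open>corner_identity\<close>, whose signs are those of integration by parts of order \<open>(r, s)\<close>.\<close>

lemma corner_rep_AE_eq:
  assumes G: "\<And>r s. r \<le> 1 \<Longrightarrow> s \<le> 1 \<Longrightarrow> weak_deriv r s f (G r s)"
  shows "AE p in cyl. f p = corner_rep G p"
proof (rule AE_eq_if_tests_equal)
  have loc: "loc_integrable (corner_avg r s (G r s))" if "r \<le> 1" "s \<le> 1" for r s
    using weak_derivD(2)[OF G[OF that]] by (rule loc_integrable_corner_avg)
  show "loc_integrable f" using weak_derivD(1)[OF G[of 0 0]] by simp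
  show "loc_integrable (corner_rep G)"
    unfolding corner_rep_def by (intro loc_integrable_sum loc) auto
  fix D assume D: "test_jet D"
  have adj: "(LINT p|cyl. corner_avg r s (G r s) p * D 0 0 p)
      = (LINT p|cyl. f p * ((-1) ^ (r + s) * (LINT a|square. corner_weight r s a * D r s (p - (a - (1, 1))))))"
    "integrable cyl (\<lambda>p. f p * ((-1) ^ (r + s) * (LINT a|square. corner_weight r s a * D r s (p - (a - (1, 1))))))"
    if rs: "r \<le> 1" "s \<le> 1" for r s
  proof -
    interpret averaging square "\<lambda>a. a - (1, 1)" "corner_weight r s" 1 1 by (rule corner_averaging)
    have "integrable cyl (\<lambda>p. (-1) ^ (r + s) * (f p * avg_adj (D r s) p))"
      by (intro integrable_mult_right integrable_avg_adj weak_derivD(1)[OF G[OF rs]] D)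
    then show "integrable cyl (\<lambda>p. f p * ((-1) ^ (r + s) * (LINT a|square. corner_weight r s a * D r s (p - (a - (1, 1))))))"
      by (simp add: avg_adj_def mult.left_commute)
    show "(LINT p|cyl. corner_avg r s (G r s) p * D 0 0 p)
      = (LINT p|cyl. f p * ((-1) ^ (r + s) * (LINT a|square. corner_weight r s a * D r s (p - (a - (1, 1))))))"
      using integral_avg_weak_deriv[OF G[OF rs] D]
      by (simp add: corner_avg_eq avg_adj_def mult.left_commute[of "f _" "(-1) ^ _"])
  qed
  have "(LINT p|cyl. f p * D 0 0 p) = (LINT p|cyl. (\<Sum>r\<le>1. \<Sum>s\<le>1. f p * ((-1) ^ (r + s) *
      (LINT a|square. corner_weight r s a * D r s (p - (a - (1, 1)))))))"
    by (subst corner_identity[OF test_jetD[OF D], symmetric]) (simp only: sum_distrib_left)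
  also have "\<dots> = (\<Sum>r\<le>1. \<Sum>s\<le>1. (LINT p|cyl. f p * ((-1) ^ (r + s) *
      (LINT a|square. corner_weight r s a * D r s (p - (a - (1, 1)))))))"
    by (subst Bochner_Integration.integral_sum, intro Bochner_Integration.integrable_sum adj(2), simp, simp,
        intro sum.cong refl Bochner_Integration.integral_sum adj(2)) auto
  also have "\<dots> = (\<Sum>r\<le>1. \<Sum>s\<le>1. (LINT p|cyl. corner_avg r s (G r s) p * D 0 0 p))"
    by (intro sum.cong refl adj(1)[symmetric]) auto
  also have "\<dots> = (LINT p|cyl. (\<Sum>r\<le>1. \<Sum>s\<le>1. corner_avg r s (G r s) p * D 0 0 p))"
    by (subst Bochner_Integration.integral_sum, intro Bochner_Integration.integrable_sum integrable_loc_test loc D, simp, simp,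
        intro sum.cong refl Bochner_Integration.integral_sum[symmetric] integrable_loc_test loc D) auto
  also have "\<dots> = (LINT p|cyl. corner_rep G p * D 0 0 p)"
    by (simp only: corner_rep_def sum_distrib_right)
  finally show "(LINT p|cyl. f p * D 0 0 p) = (LINT p|cyl. corner_rep G p * D 0 0 p)" .
qed

text \<open>The average over the square as an integral over the cylinder against a kernel. The square has the
  width of one period, so the kernel can be made periodic with \<^const>\<open>frac\<close>. Its discontinuities
  lie on null lines, from which the continuity of the averages follows, and it is dominated by the indicator
  of a strip of area 1, from which the bound by the square norm follows.\<close>

definition corner_kernel :: "nat \<Rightarrow> nat \<Rightarrow> real \<times> real \<Rightarrow> real" where
  "corner_kernel r s u = indicator {0..1} (snd u) * (frac (fst u) ^ r * snd u ^ s)"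

lemma frac_borel: "(\<lambda>x::real. frac x) \<in> borel_measurable borel"
  unfolding frac_def by measurable

lemma borel_corner_kernel: "corner_kernel r s \<in> borel_measurable borel"
proof -
  note [measurable] = measurable_compose[OF fst_borel frac_borel]
  show ?thesis unfolding corner_kernel_def by measurable
qed

lemma corner_kernel_bounds:
  "0 \<le> corner_kernel r s u" "corner_kernel r s u \<le> indicator {0..1} (snd u)"
  using mult_le_one[OF power_le_one[of "frac (fst u)" r] _ power_le_one[of "snd u" s]] frac_lt_1[of "fst u"]
  by (auto simp: corner_kernel_def indicator_def)

lemma corner_avg_eq_kernel:
  assumes k [measurable]: "k \<in> borel_measurable borel" and per: "theta_periodic k"
  shows "corner_avg r s k p = (LINT z|cyl. corner_kernel r s (z - (p - (1, 1))) * k z)"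
proof -
  note [measurable] = borel_corner_kernel
  define q where "q = p - (1, 1)"
  let ?f = "\<lambda>z. corner_kernel r s (z - q) * k z"
  have perf: "theta_periodic ?f"
    unfolding theta_periodic_def
  proof (intro allI)
    fix x y
    have "frac (x + 1 - fst q) = frac (x - fst q)" using frac_1_eq[of "x - fst q"] by (simp add: algebra_simps)
    then show "?f (x + 1, y) = ?f (x, y)"
      using per by (simp add: corner_kernel_def theta_periodic_def)
  qed
  have "corner_avg r s k p = (LINT a|lborel. indicator ({0..1} \<times> {0..1}) a *\<^sub>R (corner_weight r s a * k (a + q)))"
    unfolding corner_avg_def integral_square by (simp add: q_def algebra_simps)
  also have "\<dots> = (LINT a|lborel. indicator ({0..<1} \<times> UNIV) a *\<^sub>R (corner_kernel r s a * k (a + q)))"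
  proof (rule integral_cong_AE)
    show "AE a in lborel. indicator ({0..1} \<times> {0..1}) a *\<^sub>R (corner_weight r s a * k (a + q))
        = indicator ({0..<1} \<times> UNIV) a *\<^sub>R (corner_kernel r s a * k (a + q))"
      using AE_vertical_line[of 1]
      by eventually_elim (auto simp: indicator_def corner_weight_def corner_kernel_def frac_eq_id)
  qed (simp_all add: corner_weight_def)
  also have "\<dots> = (LINT a|cyl. corner_kernel r s a * k (a + q))"
    unfolding cyl_def by (rule integral_restrict_space[symmetric]) simp
  also have "\<dots> = (LINT a|cyl. ?f (a + q))" by simp
  also have "\<dots> = (LINT z|cyl. ?f z)"
    by (rule integral_cyl_shift[OF _ perf]) simp
  finally show ?thesis by (simp add: q_def)
qed

lemma corner_kernel_continuous_at:
  assumes "fst u \<notin> \<int>" "snd u \<noteq> 0" "snd u \<noteq> 1"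
  shows "isCont (corner_kernel r s) u"
proof -
  have "isCont (\<lambda>u. frac (fst u)) u"
    by (rule isCont_o2[where g = frac and f = fst, OF _ continuous_frac[OF assms(1)]]) (intro continuous_intros)
  moreover have "isCont (\<lambda>u :: real \<times> real. indicator {0..1} (snd u) :: real) u"
  proof (rule isCont_o2[where f = snd])
    have "snd u \<notin> frontier {0..1}"
      using assms by (auto simp: frontier_def interior_atLeastAtMost_real)
    then show "isCont (indicator {0..1} :: real \<Rightarrow> real) (snd u)"
      by (subst isCont_indicator) auto
  qed (intro continuous_intros)
  ultimately show ?thesis unfolding corner_kernel_def by (intro continuous_intros)
qed

text \<open>Dominated convergence: for a convergent sequence of points the kernels converge except on three
  lines, and their supports stay in one strip.\<close>

lemma continuous_corner_avg:
  assumes k: "loc_integrable k" shows "continuous_on UNIV (corner_avg r s k)"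
proof (rule continuous_on_sequentiallyI)
  fix u :: "nat \<Rightarrow> real \<times> real" and p assume u: "u \<longlonglongrightarrow> p"
  have kb [measurable]: "k \<in> borel_measurable borel" and kper: "theta_periodic k"
    using k by (auto simp: loc_integrable_def)
  note [measurable] = borel_corner_kernel
  from convergentI[OF u] have "Bseq u" by (rule convergent_imp_Bseq)
  then obtain B where B: "\<And>n. norm (u n) \<le> B" by (auto simp: Bseq_def)
  have snd_le: "\<bar>snd (u n)\<bar> \<le> B" for n using B[of n] norm_snd_le[of "snd (u n)" "fst (u n)"] by simp
  have "(\<lambda>n. LINT z|cyl. corner_kernel r s (z - (u n - (1, 1))) * k z)
      \<longlonglongrightarrow> (LINT z|cyl. corner_kernel r s (z - (p - (1, 1))) * k z)"
  proof (rule integral_dominated_convergence)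
    have "integrable cyl (\<lambda>z. indicator {-(B+1)..B+1} (snd z) * k z)"
      using k unfolding loc_integrable_iff by blast
    then show "integrable cyl (\<lambda>z. norm (indicator {-(B+1)..B+1} (snd z) * k z))" by (rule integrable_norm)
    show "AE z in cyl. norm (corner_kernel r s (z - (u n - (1, 1))) * k z) \<le> norm (indicator {-(B+1)..B+1} (snd z) * k z)" for n
    proof (rule AE_I2)
      fix z
      let ?v = "z - (u n - (1, 1))"
      have "indicator {0..1} (snd ?v) \<le> (indicator {-(B+1)..B+1} (snd z) :: real)"
        using snd_le[of n] by (auto simp: indicator_def)
      then have "\<bar>corner_kernel r s ?v\<bar> \<le> \<bar>indicator {-(B+1)..B+1} (snd z)\<bar>"
        using corner_kernel_bounds[of r s ?v] by linarith
      then show "norm (corner_kernel r s ?v * k z) \<le> norm (indicator {-(B+1)..B+1} (snd z) * k z)"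
        unfolding norm_mult by (intro mult_right_mono) auto
    qed
    show "AE z in cyl. (\<lambda>n. corner_kernel r s (z - (u n - (1, 1))) * k z) \<longlonglongrightarrow> corner_kernel r s (z - (p - (1, 1))) * k z"
      unfolding AE_cyl_iff
      \<comment> \<open>the preimages of the discontinuities of the kernel for the limit point\<close>
      using AE_vertical_line[of "frac (fst p)"] AE_horizontal_line[of "snd p"] AE_horizontal_line[of "snd p - 1"]
    proof eventually_elim
      case (elim z)
      show ?case
      proof
        assume z: "z \<in> {0..<1} \<times> UNIV"
        have "isCont (corner_kernel r s) (z - (p - (1, 1)))"
        proof (rule corner_kernel_continuous_at)
          show "fst (z - (p - (1, 1))) \<notin> \<int>"
          proof
            assume "fst (z - (p - (1, 1))) \<in> \<int>"
            then obtain m where "fst (z - (p - (1, 1))) = of_int m" by (rule Ints_cases)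
            then have "fst z = fst p + of_int (m - 1)" by simp
            then have "frac (fst z) = frac (fst p)" by (simp only: frac_add_of_int_right)
            moreover have "frac (fst z) = fst z" using z by (auto simp: frac_eq_id)
            ultimately show False using elim(1) by simp
          qed
        qed (use elim in auto)
        moreover have "(\<lambda>n. z - (u n - (1, 1))) \<longlonglongrightarrow> z - (p - (1, 1))"
          by (intro tendsto_intros u)
        ultimately have "(\<lambda>n. corner_kernel r s (z - (u n - (1, 1)))) \<longlonglongrightarrow> corner_kernel r s (z - (p - (1, 1)))"
          by (rule isCont_tendsto_compose)
        then show "(\<lambda>n. corner_kernel r s (z - (u n - (1, 1))) * k z) \<longlonglongrightarrow> corner_kernel r s (z - (p - (1, 1))) * k z"
          by (intro tendsto_intros)
      qed
    qed
  qed (rule measurable_cyl, measurable)+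
  then show "(\<lambda>n. corner_avg r s k (u n)) \<longlonglongrightarrow> corner_avg r s k p"
    by (simp add: corner_avg_eq_kernel[OF kb kper])
qed

lemma integral_strip:
  assumes "c \<le> d"
  shows "integrable cyl (\<lambda>z. indicator {c..d} (snd z) :: real)"
    "(LINT z|cyl. indicator {c..d} (snd z) :: real) = d - c"
proof -
  have eq: "(\<lambda>z :: real \<times> real. indicator ({0..<1} \<times> UNIV) z * (indicator {c..d} (snd z) :: real))
     = indicator ({0..<1} \<times> {c..d})"
    by (auto simp: indicator_def fun_eq_iff)
  have s: "{0..<1} \<times> {c..d} \<in> sets (lborel \<Otimes>\<^sub>M lborel :: (real \<times> real) measure)"
    by (rule pair_measureI) auto
  have e: "emeasure (lborel \<Otimes>\<^sub>M lborel) ({0..<1::real} \<times> {c..d}) = ennreal (d - c)"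
    using assms by (subst lborel.emeasure_pair_measure_Times) auto
  note s' = s[unfolded lborel_prod] and e' = e[unfolded lborel_prod]
  show "integrable cyl (\<lambda>z. indicator {c..d} (snd z) :: real)"
    unfolding cyl_def using s' e'
    by (subst integrable_restrict_space) (auto simp: eq intro!: integrable_real_indicator)
  show "(LINT z|cyl. indicator {c..d} (snd z) :: real) = d - c"
    unfolding cyl_def using s' e' assms
    by (subst integral_restrict_space) (auto simp: eq measure_def)
qed

text \<open>The real value of \<^const>\<open>L2_norm\<close>, only meaningful on \<^const>\<open>L2_cyl\<close>.\<close>

definition l2 :: "field \<Rightarrow> real" where
  "l2 f = sqrt (LINT p|cyl. (f p)\<^sup>2)"

lemma l2_nonneg: "0 \<le> l2 f"
  by (simp add: l2_def)

lemma l2_square: "(l2 f)\<^sup>2 = (LINT p|cyl. (f p)\<^sup>2)"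
  by (simp add: l2_def)

lemma L2_cyl_loc_integrable:
  assumes f: "f \<in> L2_cyl" shows "loc_integrable f"
  unfolding loc_integrable_iff
proof (intro conjI allI)
  show "f \<in> borel_measurable borel" "theta_periodic f"
    using f by (auto simp: L2_cyl_def)
  then have [measurable]: "f \<in> borel_measurable borel" by simp
  fix R :: real
  show "integrable cyl (\<lambda>p. indicator {-R..R} (snd p) * f p)"
  proof (cases "R \<ge> 0")
    case True
    have "integrable cyl (\<lambda>p. (f p)\<^sup>2 + indicator {-R..R} (snd p))"
      using f True by (intro Bochner_Integration.integrable_add integral_strip) (auto simp: L2_cyl_def)
    then show ?thesis
    proof (rule Bochner_Integration.integrable_bound)
      show "(\<lambda>p. indicator {-R..R} (snd p) * f p) \<in> borel_measurable cyl"
        by (rule measurable_cyl) measurable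
      have "\<bar>indicator {-R..R} (snd p) * f p\<bar> \<le> (f p)\<^sup>2 + indicator {-R..R} (snd p)" for p
        using zero_le_power2[of "\<bar>f p\<bar> - 1"] by (auto simp: power2_diff indicator_def)
      then show "AE p in cyl. norm (indicator {-R..R} (snd p) * f p) \<le> norm ((f p)\<^sup>2 + indicator {-R..R} (snd p))"
        by (intro AE_I2) (simp add: order.trans[OF _ abs_ge_self])
    qed
  qed simp
qed

text \<open>The Cauchy-Schwarz inequality on a strip of area 1, in the form \<open>\<bar>k\<bar> \<le> A/2 + k\<^sup>2/(2A)\<close> with A slightly above
  the norm, so that the norm may be zero.\<close>

lemma corner_avg_bound:
  assumes k: "k \<in> L2_cyl" shows "\<bar>corner_avg r s k p\<bar> \<le> l2 k"
proof (rule field_le_epsilon)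
  fix e :: real assume "e > 0"
  define A where "A = l2 k + e"
  have A: "A > 0" "l2 k \<le> A" using \<open>e > 0\<close> l2_nonneg[of k] by (auto simp: A_def)
  have kb [measurable]: "k \<in> borel_measurable borel" and kper: "theta_periodic k"
    and int: "integrable cyl (\<lambda>p. (k p)\<^sup>2)"
    using k by (auto simp: L2_cyl_def)
  note [measurable] = borel_corner_kernel
  let ?K = "\<lambda>z. corner_kernel r s (z - (p - (1, 1)))"
  let ?I = "\<lambda>z. indicator {snd p - 1..snd p} (snd z) :: real"
  have ptw: "\<bar>?K z * k z\<bar> \<le> (A / 2) * ?I z + (1 / (2 * A)) * (k z)\<^sup>2" for z
  proof -
    have "?K z \<le> ?I z" using corner_kernel_bounds(2)[of r s "z - (p - (1, 1))"]
      by (rule order.trans) (auto simp: indicator_def)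
    then have "\<bar>?K z * k z\<bar> \<le> ?I z * \<bar>k z\<bar>"
      unfolding abs_mult using corner_kernel_bounds(1) by (intro mult_right_mono) auto
    moreover have "\<bar>k z\<bar> \<le> A / 2 + (1 / (2 * A)) * (k z)\<^sup>2"
      using zero_le_power2[of "\<bar>k z\<bar> - A"] A(1)
      by (simp add: power2_diff field_simps power2_eq_square)
    moreover have "0 \<le> (1 / (2 * A)) * (k z)\<^sup>2" using A by simp
    ultimately show ?thesis by (auto simp: indicator_def split: if_splits)
  qed
  have int': "integrable cyl (\<lambda>z. (A / 2) * ?I z + (1 / (2 * A)) * (k z)\<^sup>2)"
    using int by (intro Bochner_Integration.integrable_add integrable_mult_right integral_strip) auto
  have "\<bar>corner_avg r s k p\<bar> \<le> (LINT z|cyl. \<bar>?K z * k z\<bar>)"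
    unfolding corner_avg_eq_kernel[OF kb kper] by (rule integral_abs_bound)
  also have "\<dots> \<le> (LINT z|cyl. (A / 2) * ?I z + (1 / (2 * A)) * (k z)\<^sup>2)"
  proof (rule integral_mono[OF _ int' ptw])
    show "integrable cyl (\<lambda>z. \<bar>?K z * k z\<bar>)"
      by (rule Bochner_Integration.integrable_bound[OF int'])
        (rule measurable_cyl, measurable, use ptw order.trans[OF ptw abs_ge_self] in auto)
  qed
  also have "\<dots> = A / 2 + (1 / (2 * A)) * (l2 k)\<^sup>2"
    using int integral_strip[of "snd p - 1" "snd p"] by (simp add: l2_square)
  also have "\<dots> \<le> A / 2 + (1 / (2 * A)) * A\<^sup>2"
    using A l2_nonneg by (intro add_left_mono mult_left_mono power_mono) auto
  also have "\<dots> = A" using A(1) by (simp add: power2_eq_square)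
  finally show "\<bar>corner_avg r s k p\<bar> \<le> l2 k + e" by (simp add: A_def)
qed

text \<open>Each weak derivative is replaced by its representation by averages, which is continuous. Between
  continuous functions weak derivatives are classical ones.\<close>

lemma smooth_representative:
  assumes G: "\<And>i j. weak_deriv i j f (G i j)" and L2: "\<And>i j. G i j \<in> L2_cyl"
  obtains F where "jet F" "\<And>i j. AE p in cyl. G i j p = F i j p"
    "\<And>i j p. \<bar>F i j p\<bar> \<le> (\<Sum>r\<le>1. \<Sum>s\<le>1. l2 (G (i + r) (j + s)))"
proof -
  define F where "F = (\<lambda>i j. corner_rep (\<lambda>r s. G (i + r) (j + s)))"
  have loc: "loc_integrable (G i j)" for i j using weak_derivD(2)[OF G] .
  have GG: "weak_deriv k l (G i j) (G (i + k) (j + l))" for i j k l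
    by (rule weak_deriv_cancel[OF G G])
  have AE: "AE p in cyl. G i j p = F i j p" for i j
    unfolding F_def by (rule corner_rep_AE_eq) (rule GG)
  have locF: "loc_integrable (F i j)" for i j
    unfolding F_def corner_rep_def by (intro loc_integrable_sum loc_integrable_corner_avg loc) auto
  have cont: "continuous_on UNIV (F i j)" for i j
    unfolding F_def corner_rep_def by (intro continuous_intros continuous_corner_avg loc)
  have FF: "weak_deriv k l (F i j) (F (i + k) (j + l))" for i j k l
    by (rule weak_deriv_cong_AE[OF GG locF locF AE AE])
  have "jet F"
  proof (rule jetI)
    show "theta_periodic (F i j)" for i j using locF[of i j] by (simp add: loc_integrable_def)
    show "continuous_on UNIV (F i j)" for i j by (rule cont)
    show "((\<lambda>s. F i j (s, y)) has_real_derivative F (Suc i) j (x, y)) (at x)" for i j x y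
      using weak_deriv_imp_classical[OF cont cont FF[of 1 0 i j], of "(x, y)"] DERIV_shift[of "\<lambda>s. F i j (s, y)" _ 0 x]
      by (simp add: unit_dir_def dir_def add.commute)
    show "((\<lambda>s. F i j (x, s)) has_real_derivative F i (Suc j) (x, y)) (at y)" for i j x y
      using weak_deriv_imp_classical[OF cont cont FF[of 0 1 i j], of "(x, y)"] DERIV_shift[of "\<lambda>s. F i j (x, s)" _ 0 y]
      by (simp add: unit_dir_def dir_def add.commute)
  qed
  moreover have "\<bar>F i j p\<bar> \<le> (\<Sum>r\<le>1. \<Sum>s\<le>1. l2 (G (i + r) (j + s)))" for i j p
    unfolding F_def corner_rep_def
    by (intro order.trans[OF sum_abs] sum_mono corner_avg_bound L2)
  ultimately show thesis using that AE by blast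
qed

section \<open>Calculus of the Sobolev norms\<close>

lemma L2_cylD:
  assumes "f \<in> L2_cyl"
  shows "f \<in> borel_measurable borel" "theta_periodic f" "integrable cyl (\<lambda>p. (f p)\<^sup>2)"
  using assms by (auto simp: L2_cyl_def)

lemma L2_norm_eq: "f \<in> L2_cyl \<Longrightarrow> L2_norm f = ennreal (l2 f)"
  by (simp add: L2_norm_def l2_def)

lemma L2_cyl_bound:
  assumes f: "f \<in> borel_measurable borel" "theta_periodic f"
    and g: "integrable cyl g" and le: "\<And>p. (f p)\<^sup>2 \<le> g p"
  shows "f \<in> L2_cyl" "(l2 f)\<^sup>2 \<le> (LINT p|cyl. g p)"
proof -
  note [measurable] = f(1)
  have int: "integrable cyl (\<lambda>p. (f p)\<^sup>2)"
    by (rule Bochner_Integration.integrable_bound[OF g])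
      (rule measurable_cyl, measurable, use le order.trans[OF le abs_ge_self] in auto)
  then show "f \<in> L2_cyl" using f by (simp add: L2_cyl_def)
  show "(l2 f)\<^sup>2 \<le> (LINT p|cyl. g p)"
    unfolding l2_square by (rule integral_mono[OF int g le])
qed

lemma l2_cmult:
  assumes "f \<in> L2_cyl"
  shows "(\<lambda>p. c * f p) \<in> L2_cyl" "l2 (\<lambda>p. c * f p) = \<bar>c\<bar> * l2 f"
  using assms by (auto simp: L2_cyl_def theta_periodic_def l2_def power_mult_distrib real_sqrt_mult)

text \<open>Minkowski's inequality: the pointwise bound \<open>(a + b)\<^sup>2 \<le> (A + B) (a\<^sup>2/A + b\<^sup>2/B)\<close> is integrated with A and B
  slightly above the two norms.\<close>

lemma l2_add:
  assumes f: "f \<in> L2_cyl" and g: "g \<in> L2_cyl"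
  shows "(\<lambda>p. f p + g p) \<in> L2_cyl" "l2 (\<lambda>p. f p + g p) \<le> l2 f + l2 g"
proof -
  note fD = L2_cylD[OF f] and gD = L2_cylD[OF g]
  note [measurable] = fD(1) gD(1)
  have sq: "(a + b)\<^sup>2 \<le> (A + B) * (a\<^sup>2 / A + b\<^sup>2 / B)" if "A > 0" "B > 0" for a b A B :: real
  proof -
    have "(A + B) * (a\<^sup>2 / A + b\<^sup>2 / B) - (a + b)\<^sup>2 = (B * a - A * b)\<^sup>2 / (A * B)"
      using that by (simp add: field_simps power2_eq_square)
    moreover have "0 \<le> (B * a - A * b)\<^sup>2 / (A * B)" using that by simp
    ultimately show ?thesis by linarith
  qed
  have bound: "(\<lambda>p. f p + g p) \<in> L2_cyl \<and> l2 (\<lambda>p. f p + g p) \<le> A + B"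
    if A: "A > 0" "l2 f \<le> A" and B: "B > 0" "l2 g \<le> B" for A B
  proof -
    let ?g = "\<lambda>p. (A + B) * ((f p)\<^sup>2 / A + (g p)\<^sup>2 / B)"
    have int: "integrable cyl ?g" using fD(3) gD(3) by auto
    have b: "(\<lambda>p. f p + g p) \<in> borel_measurable borel" by measurable
    have p: "theta_periodic (\<lambda>p. f p + g p)" using fD gD by (simp add: theta_periodic_def)
    note * = L2_cyl_bound[OF b p int sq[OF A(1) B(1)]]
    have "(l2 (\<lambda>p. f p + g p))\<^sup>2 \<le> (A + B) * ((l2 f)\<^sup>2 / A + (l2 g)\<^sup>2 / B)"
      using *(2) fD(3) gD(3) by (simp add: l2_square)
    also have "\<dots> \<le> (A + B) * (A\<^sup>2 / A + B\<^sup>2 / B)"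
      using A B l2_nonneg by (intro mult_left_mono add_mono divide_right_mono power_mono) auto
    also have "\<dots> = (A + B)\<^sup>2" using A B by (simp add: power2_eq_square)
    finally have "l2 (\<lambda>p. f p + g p) \<le> A + B" by (rule power2_le_imp_le) (use A B in auto)
    with *(1) show ?thesis by simp
  qed
  show "(\<lambda>p. f p + g p) \<in> L2_cyl"
    using bound[of "l2 f + 1" "l2 g + 1"] l2_nonneg[of f] l2_nonneg[of g] by simp
  show "l2 (\<lambda>p. f p + g p) \<le> l2 f + l2 g"
  proof (rule field_le_epsilon)
    fix e :: real assume "e > 0"
    then show "l2 (\<lambda>p. f p + g p) \<le> l2 f + l2 g + e"
      using bound[of "l2 f + e / 2" "l2 g + e / 2"] l2_nonneg[of f] l2_nonneg[of g] by simp
  qed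
qed

lemma l2_zero: "(\<lambda>p. 0) \<in> L2_cyl" "l2 (\<lambda>p. 0) = 0"
  by (simp_all add: L2_cyl_def theta_periodic_def l2_def)

lemma l2_sum:
  assumes "finite I" "\<And>i. i \<in> I \<Longrightarrow> f i \<in> L2_cyl"
  shows "(\<lambda>p. \<Sum>i\<in>I. f i p) \<in> L2_cyl \<and> l2 (\<lambda>p. \<Sum>i\<in>I. f i p) \<le> (\<Sum>i\<in>I. l2 (f i))"
  using assms
proof (induction I rule: finite_induct)
  case empty
  then show ?case by (simp add: l2_zero)
next
  case (insert i I)
  then have IH: "(\<lambda>p. \<Sum>i\<in>I. f i p) \<in> L2_cyl" "l2 (\<lambda>p. \<Sum>i\<in>I. f i p) \<le> (\<Sum>i\<in>I. l2 (f i))"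
    and fi: "f i \<in> L2_cyl" by auto
  from l2_add[OF fi IH(1)] IH(2) show ?case using insert.hyps by simp
qed

lemma l2_mult_bounded:
  assumes u: "u \<in> borel_measurable borel" "theta_periodic u" and S: "\<And>p. \<bar>u p\<bar> \<le> S" and v: "v \<in> L2_cyl"
  shows "(\<lambda>p. u p * v p) \<in> L2_cyl" "l2 (\<lambda>p. u p * v p) \<le> S * l2 v"
proof -
  note vD = L2_cylD[OF v]
  note [measurable] = u(1) vD(1)
  have S0: "0 \<le> S" using S[of 0] by linarith
  have b: "(\<lambda>p. u p * v p) \<in> borel_measurable borel" by measurable
  have p: "theta_periodic (\<lambda>p. u p * v p)" using u vD by (simp add: theta_periodic_def)
  have int: "integrable cyl (\<lambda>p. S\<^sup>2 * (v p)\<^sup>2)" using vD(3) by simp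
  have le: "(u p * v p)\<^sup>2 \<le> S\<^sup>2 * (v p)\<^sup>2" for p
    unfolding power_mult_distrib using S[of p] by (intro mult_right_mono abs_le_square_iff[THEN iffD1]) auto
  note * = L2_cyl_bound[OF b p int le]
  show "(\<lambda>p. u p * v p) \<in> L2_cyl" by (rule *)
  have "(l2 (\<lambda>p. u p * v p))\<^sup>2 \<le> (S * l2 v)\<^sup>2"
    using *(2) by (simp add: l2_square power_mult_distrib)
  then show "l2 (\<lambda>p. u p * v p) \<le> S * l2 v"
    by (rule power2_le_imp_le) (simp add: S0 l2_nonneg)
qed

lemma l2_cong_AE:
  assumes f: "f \<in> L2_cyl" and g: "g \<in> borel_measurable borel" "theta_periodic g"
    and eq: "AE p in cyl. f p = g p"
  shows "g \<in> L2_cyl" "l2 g = l2 f"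
proof -
  note [measurable] = L2_cylD(1)[OF f] g(1)
  have meas: "(\<lambda>p. (f p)\<^sup>2) \<in> borel_measurable cyl" "(\<lambda>p. (g p)\<^sup>2) \<in> borel_measurable cyl"
    by (rule measurable_cyl, measurable)+
  have eq2: "AE p in cyl. (f p)\<^sup>2 = (g p)\<^sup>2" using eq by eventually_elim simp
  have "integrable cyl (\<lambda>p. (g p)\<^sup>2)"
    using integrable_cong_AE[OF meas eq2] L2_cylD(3)[OF f] by simp
  then show "g \<in> L2_cyl" using g by (simp add: L2_cyl_def)
  show "l2 g = l2 f" unfolding l2_def using integral_cong_AE[OF meas eq2] by simp
qed

lemma weak_deriv_L2_AE:
  assumes "weak_deriv i j f g" "g \<in> L2_cyl" "weak_deriv i j f g'"
  shows "g' \<in> L2_cyl" "l2 g' = l2 g"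
  using l2_cong_AE[OF assms(2) _ _ weak_deriv_unique[OF assms(1,3)]] weak_derivD(2)[OF assms(3)]
  by (auto simp: loc_integrable_def)

lemma Sob_pd:
  assumes "f \<in> Sob m" "i + j \<le> m"
  shows "weak_deriv i j f (pd i j f)" "pd i j f \<in> L2_cyl"
proof -
  obtain g where g: "g \<in> L2_cyl" "weak_deriv i j f g" using assms by (auto simp: Sob_def)
  show w: "weak_deriv i j f (pd i j f)" by (rule weak_deriv_pd[OF g(2)])
  show "pd i j f \<in> L2_cyl" by (rule weak_deriv_L2_AE[OF g(2,1) w])
qed

lemma finite_order_le: "finite {(i, j). i + j \<le> (m::nat)}"
  by (rule finite_subset[of _ "{..m} \<times> {..m}"]) auto

lemma Hnorm_w_eq:
  assumes "f \<in> Sob m"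
  shows "Hnorm_w \<epsilon> m f = ennreal (\<Sum>(i, j) \<in> {(i, j). i + j \<le> m}. \<bar>\<epsilon> ^ i\<bar> * l2 (pd i j f))"
proof -
  have "Hnorm_w \<epsilon> m f = (\<Sum>(i, j) \<in> {(i, j). i + j \<le> m}. L2_norm (\<lambda>p. \<epsilon> ^ i * pd i j f p))"
    using assms by (simp add: Hnorm_w_def)
  also have "\<dots> = (\<Sum>(i, j) \<in> {(i, j). i + j \<le> m}. ennreal (\<bar>\<epsilon> ^ i\<bar> * l2 (pd i j f)))"
    by (intro sum.cong refl) (auto simp: L2_norm_eq l2_cmult Sob_pd[OF assms])
  also have "\<dots> = ennreal (\<Sum>(i, j) \<in> {(i, j). i + j \<le> m}. \<bar>\<epsilon> ^ i\<bar> * l2 (pd i j f))"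
    by (subst sum_ennreal[symmetric]) (auto simp: l2_nonneg case_prod_beta)
  finally show ?thesis .
qed

lemma Hnorm_w_finite_iff: "Hnorm_w \<epsilon> m f < \<infinity> \<longleftrightarrow> f \<in> Sob m"
  by (cases "f \<in> Sob m") (simp add: Hnorm_w_eq, simp add: Hnorm_w_def)

text \<open>The norm is defined with the derivatives chosen by \<^const>\<open>pd\<close>. Uniqueness of weak derivatives allows
  any other choice.\<close>

lemma Hnorm_w_le:
  assumes f: "f \<in> borel_measurable borel" "theta_periodic f"
    and g: "\<And>i j. i + j \<le> m \<Longrightarrow> weak_deriv i j f (g i j)" "\<And>i j. i + j \<le> m \<Longrightarrow> g i j \<in> L2_cyl"
    and K: "\<And>i j. i + j \<le> m \<Longrightarrow> \<bar>\<epsilon> ^ i\<bar> * l2 (g i j) \<le> K i j"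
  shows "f \<in> Sob m" "Hnorm_w \<epsilon> m f \<le> ennreal (\<Sum>(i, j) \<in> {(i, j). i + j \<le> m}. K i j)"
proof -
  have "weak_deriv 0 0 f f" using weak_derivD(1)[OF g(1)[of 0 0]] by (simp add: weak_deriv_0)
  then have "f \<in> L2_cyl" using weak_deriv_L2_AE(1)[OF g(1,2)[of 0 0]] by simp
  then show S: "f \<in> Sob m" unfolding Sob_def using g by blast
  have "l2 (pd i j f) = l2 (g i j)" if "i + j \<le> m" for i j
    by (rule weak_deriv_L2_AE(2)[OF g(1)[OF that] g(2)[OF that] Sob_pd(1)[OF S that]])
  then show "Hnorm_w \<epsilon> m f \<le> ennreal (\<Sum>(i, j) \<in> {(i, j). i + j \<le> m}. K i j)"
    unfolding Hnorm_w_eq[OF S] using K by (intro ennreal_leI sum_mono) auto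
qed

lemma Sob_borel: "f \<in> Sob m \<Longrightarrow> f \<in> borel_measurable borel" "f \<in> Sob m \<Longrightarrow> theta_periodic f"
  by (auto simp: Sob_def L2_cyl_def)

lemma Hnorm_w_add: "Hnorm_w \<epsilon> m (\<lambda>p. f p + g p) \<le> Hnorm_w \<epsilon> m f + Hnorm_w \<epsilon> m g"
proof (cases "f \<in> Sob m \<and> g \<in> Sob m")
  case True
  then have f: "f \<in> Sob m" and g: "g \<in> Sob m" by auto
  note [measurable] = Sob_borel(1)[OF f] Sob_borel(1)[OF g]
  have "Hnorm_w \<epsilon> m (\<lambda>p. f p + g p)
      \<le> ennreal (\<Sum>(i, j) \<in> {(i, j). i + j \<le> m}. \<bar>\<epsilon> ^ i\<bar> * l2 (pd i j f) + \<bar>\<epsilon> ^ i\<bar> * l2 (pd i j g))"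
  proof (rule Hnorm_w_le(2)[where g = "\<lambda>i j p. pd i j f p + pd i j g p"])
    show "(\<lambda>p. f p + g p) \<in> borel_measurable borel" by measurable
    show "theta_periodic (\<lambda>p. f p + g p)"
      using Sob_borel(2)[OF f] Sob_borel(2)[OF g] by (simp add: theta_periodic_def)
    fix i j assume ij: "i + j \<le> m"
    show "weak_deriv i j (\<lambda>p. f p + g p) (\<lambda>p. pd i j f p + pd i j g p)"
      by (intro weak_deriv_add Sob_pd(1)[OF _ ij] f g)
    note * = l2_add[OF Sob_pd(2)[OF f ij] Sob_pd(2)[OF g ij]]
    show "(\<lambda>p. pd i j f p + pd i j g p) \<in> L2_cyl" by (rule *)
    show "\<bar>\<epsilon> ^ i\<bar> * l2 (\<lambda>p. pd i j f p + pd i j g p) \<le> \<bar>\<epsilon> ^ i\<bar> * l2 (pd i j f) + \<bar>\<epsilon> ^ i\<bar> * l2 (pd i j g)"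
      unfolding distrib_left[symmetric] by (intro mult_left_mono *) auto
  qed
  also have "\<dots> = Hnorm_w \<epsilon> m f + Hnorm_w \<epsilon> m g"
    unfolding Hnorm_w_eq[OF f] Hnorm_w_eq[OF g]
    by (subst ennreal_plus[symmetric]) (auto simp: sum.distrib case_prod_beta l2_nonneg intro!: sum_nonneg)
  finally show ?thesis .
next
  case False
  then show ?thesis by (auto simp: Hnorm_w_def)
qed

lemma Hnorm_w_cmult:
  assumes f: "f \<in> Sob m"
  shows "Hnorm_w \<epsilon> m (\<lambda>p. c * f p) \<le> ennreal \<bar>c\<bar> * Hnorm_w \<epsilon> m f"
proof -
  note [measurable] = Sob_borel(1)[OF f]
  have "Hnorm_w \<epsilon> m (\<lambda>p. c * f p)
      \<le> ennreal (\<Sum>(i, j) \<in> {(i, j). i + j \<le> m}. \<bar>c\<bar> * (\<bar>\<epsilon> ^ i\<bar> * l2 (pd i j f)))"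
  proof (rule Hnorm_w_le(2)[where g = "\<lambda>i j p. c * pd i j f p"])
    show "(\<lambda>p. c * f p) \<in> borel_measurable borel" by measurable
    show "theta_periodic (\<lambda>p. c * f p)"
      using Sob_borel(2)[OF f] by (simp add: theta_periodic_def)
    fix i j assume ij: "i + j \<le> m"
    show "weak_deriv i j (\<lambda>p. c * f p) (\<lambda>p. c * pd i j f p)"
      by (intro weak_deriv_cmult Sob_pd(1)[OF _ ij] f)
    note * = l2_cmult[OF Sob_pd(2)[OF f ij], of c]
    show "(\<lambda>p. c * pd i j f p) \<in> L2_cyl" by (rule *)
    show "\<bar>\<epsilon> ^ i\<bar> * l2 (\<lambda>p. c * pd i j f p) \<le> \<bar>c\<bar> * (\<bar>\<epsilon> ^ i\<bar> * l2 (pd i j f))"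
      by (simp add: *(2))
  qed
  also have "\<dots> = ennreal \<bar>c\<bar> * Hnorm_w \<epsilon> m f"
    unfolding Hnorm_w_eq[OF f]
    by (subst ennreal_mult[symmetric]) (auto simp: sum_distrib_left case_prod_beta l2_nonneg intro!: sum_nonneg)
  finally show ?thesis .
qed

lemma Hnorm_w_sum:
  assumes "finite I" "\<And>k. k \<in> I \<Longrightarrow> f k \<in> Sob m"
  shows "Hnorm_w \<epsilon> m (\<lambda>p. \<Sum>k\<in>I. c k * f k p) \<le> (\<Sum>k\<in>I. ennreal \<bar>c k\<bar> * Hnorm_w \<epsilon> m (f k))"
  using assms
proof (induction I rule: finite_induct)
  case empty
  have "weak_deriv i j (\<lambda>p. 0) (\<lambda>p. 0)" for i j
    using L2_cyl_loc_integrable[OF l2_zero(1)] by (simp add: weak_deriv_def)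
  then have "Hnorm_w \<epsilon> m (\<lambda>p. 0) \<le> ennreal (\<Sum>(i, j) \<in> {(i, j). i + j \<le> m}. 0)"
    by (intro Hnorm_w_le(2)[where g = "\<lambda>i j p. 0"]) (auto simp: l2_zero theta_periodic_def)
  then show ?case by simp
next
  case (insert k I)
  have "Hnorm_w \<epsilon> m (\<lambda>p. \<Sum>k\<in>insert k I. c k * f k p)
      \<le> Hnorm_w \<epsilon> m (\<lambda>p. c k * f k p) + Hnorm_w \<epsilon> m (\<lambda>p. \<Sum>k\<in>I. c k * f k p)"
    using insert.hyps Hnorm_w_add[of \<epsilon> m "\<lambda>p. c k * f k p"] by simp
  also have "\<dots> \<le> ennreal \<bar>c k\<bar> * Hnorm_w \<epsilon> m (f k) + (\<Sum>k\<in>I. ennreal \<bar>c k\<bar> * Hnorm_w \<epsilon> m (f k))"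
    using insert by (intro add_mono Hnorm_w_cmult) auto
  finally show ?case using insert.hyps by simp
qed

section \<open>The quadratic pressure terms\<close>

text \<open>The supremum of a derivative of order i in the angle is controlled by derivatives of order i and
  \<open>i + 1\<close> in the angle, which accounts for the one additional factor \<open>\<epsilon>\<close>. The constant 4 counts the
  terms of the representation formula.\<close>

lemma anisotropic_sobolev:
  assumes \<epsilon>: "0 < \<epsilon>" "\<epsilon> \<le> 1" and f: "f \<in> Sob_inf" and B: "Hnorm_w \<epsilon> (m + 2) f \<le> ennreal B" "0 \<le> B"
  obtains F where "jet F" "\<And>i j. AE p in cyl. pd i j f p = F i j p" "AE p in cyl. f p = F 0 0 p"
    "\<And>i j. F i j \<in> L2_cyl"
    "\<And>i j. i + j \<le> m + 2 \<Longrightarrow> \<epsilon> ^ i * l2 (F i j) \<le> B"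
    "\<And>i j p. i + j \<le> m \<Longrightarrow> \<epsilon> ^ (i + 1) * \<bar>F i j p\<bar> \<le> 4 * B"
proof -
  have S: "f \<in> Sob k" for k using f by (simp add: Sob_inf_def)
  have G: "weak_deriv i j f (pd i j f)" "pd i j f \<in> L2_cyl" for i j
    using Sob_pd[OF S, of i j "i + j"] by simp_all
  obtain F where F: "jet F" "\<And>i j. AE p in cyl. pd i j f p = F i j p"
    "\<And>i j p. \<bar>F i j p\<bar> \<le> (\<Sum>r\<le>1. \<Sum>s\<le>1. l2 (pd (i + r) (j + s) f))"
    by (rule smooth_representative[OF G]) (rule that; assumption)
  have FL2: "F i j \<in> L2_cyl" "l2 (F i j) = l2 (pd i j f)" for i j
    using l2_cong_AE[OF G(2) _ _ F(2)] jet_borel[OF F(1)] jetD(1)[OF F(1)] by auto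
  have bound: "\<epsilon> ^ i * l2 (pd i j f) \<le> B" if ij: "i + j \<le> m + 2" for i j
  proof -
    have "(\<Sum>(i, j) \<in> {(i, j). i + j \<le> m + 2}. \<bar>\<epsilon> ^ i\<bar> * l2 (pd i j f)) \<le> B"
      using B Hnorm_w_eq[OF S[of "m + 2"], of \<epsilon>] by (simp only: ennreal_le_iff)
    moreover have "\<bar>\<epsilon> ^ i\<bar> * l2 (pd i j f) \<le> (\<Sum>(i, j) \<in> {(i, j). i + j \<le> m + 2}. \<bar>\<epsilon> ^ i\<bar> * l2 (pd i j f))"
      using member_le_sum[of "(i, j)" "{(i, j). i + j \<le> m + 2}" "\<lambda>(i, j). \<bar>\<epsilon> ^ i\<bar> * l2 (pd i j f)"]
        ij finite_order_le by (auto simp: l2_nonneg)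
    ultimately show ?thesis using \<epsilon> by simp
  qed
  have sup: "\<epsilon> ^ (i + 1) * \<bar>F i j p\<bar> \<le> 4 * B" if ij: "i + j \<le> m" for i j p
  proof -
    have "\<epsilon> ^ (i + 1) * \<bar>F i j p\<bar> \<le> \<epsilon> ^ (i + 1) * (\<Sum>r\<le>1. \<Sum>s\<le>1. l2 (pd (i + r) (j + s) f))"
      using \<epsilon> by (intro mult_left_mono F) auto
    also have "\<dots> = (\<Sum>r\<le>1. \<Sum>s\<le>1. \<epsilon> ^ (i + 1) * l2 (pd (i + r) (j + s) f))"
      by (simp only: sum_distrib_left)
    also have "\<dots> \<le> (\<Sum>r\<le>1::nat. \<Sum>s\<le>1::nat. B)"
    proof (intro sum_mono)
      fix r s :: nat assume rs: "r \<in> {..1}" "s \<in> {..1}"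
      have "\<epsilon> ^ (i + 1) * l2 (pd (i + r) (j + s) f) \<le> \<epsilon> ^ (i + r) * l2 (pd (i + r) (j + s) f)"
        using \<epsilon> rs by (intro mult_right_mono power_decreasing l2_nonneg) auto
      also have "\<dots> \<le> B" using ij rs by (intro bound) auto
      finally show "\<epsilon> ^ (i + 1) * l2 (pd (i + r) (j + s) f) \<le> B" .
    qed
    also have "\<dots> = 4 * B" by simp
    finally show ?thesis .
  qed
  have "AE p in cyl. f p = pd 0 0 f p"
    by (rule weak_deriv_unique[OF weak_deriv_0[OF weak_derivD(1)[OF G(1)]] G(1)])
  then have "AE p in cyl. f p = F 0 0 p"
    using F(2)[of 0 0] by eventually_elim simp
  from that[OF F(1,2) this FL2(1) _ sup] bound show thesis by (simp only: FL2(2))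
qed

lemma binomial_double_sum: "(\<Sum>a\<le>i. \<Sum>b\<le>j. real (i choose a) * real (j choose b)) = 2 ^ (i + j)"
proof -
  have row: "(\<Sum>a\<le>n. real (n choose a)) = 2 ^ n" for n
    using choose_row_sum[of n] by (metis of_nat_numeral of_nat_power of_nat_sum)
  show ?thesis by (simp add: sum_product[symmetric] row power_add)
qed

text \<open>In each term of the Leibniz formula of order \<open>(i, j)\<close> the supremum of the first factor, of order a
  in the angle, costs \<open>\<epsilon>\<^bsup>-(a+1)\<^esup>\<close> and the square norm of the second one, of order \<open>i - a + i0\<close>, costs
  \<open>\<epsilon>\<^bsup>-(i-a+i0)\<^esup>\<close>. The total \<open>\<epsilon>\<^bsup>-(i+1+i0)\<^esup>\<close> does not depend on a. The binomial coefficients sum up to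
  \<open>2\<^bsup>i+j\<^esup>\<close>.\<close>

lemma Hnorm_quadratic_bound:
  assumes \<epsilon>: "0 < \<epsilon>" "\<epsilon> \<le> 1" and f: "f \<in> Sob_inf" and B: "Hnorm_w \<epsilon> (m + 2) f \<le> ennreal B" "0 \<le> B"
    and e: "unit_dir i0 j0" and c: "\<bar>c\<bar> \<le> K * \<epsilon> ^ (m + 1 + i0)" and K: "0 \<le> K"
  shows "Hnorm m (\<lambda>p. c * (f p * pd i0 j0 f p))
    \<le> ennreal (\<Sum>(i, j) \<in> {(i, j). i + j \<le> m}. K * (2 ^ (i + j) * (4 * B\<^sup>2)))"
proof -
  obtain F where F: "jet F" "\<And>i j. AE p in cyl. pd i j f p = F i j p" "AE p in cyl. f p = F 0 0 p"
    and L2: "\<And>i j. F i j \<in> L2_cyl" and l2: "\<And>i j. i + j \<le> m + 2 \<Longrightarrow> \<epsilon> ^ i * l2 (F i j) \<le> B"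
    and sup: "\<And>i j p. i + j \<le> m \<Longrightarrow> \<epsilon> ^ (i + 1) * \<bar>F i j p\<bar> \<le> 4 * B"
    by (rule anisotropic_sobolev[OF \<epsilon> f B]) (rule that; assumption)
  define P where "P = jet_mult F (\<lambda>i j. F (i + i0) (j + j0))"
  have P: "jet P" unfolding P_def by (intro jet_jet_mult jet_shift_index F)
  have PL2: "P i j \<in> L2_cyl \<and> \<epsilon> ^ (i + 1 + i0) * l2 (P i j) \<le> 2 ^ (i + j) * (4 * B\<^sup>2)" if ij: "i + j \<le> m" for i j
  proof -
    have entry: "(\<lambda>p. F a b p * F (i - a + i0) (j - b + j0) p) \<in> L2_cyl \<and>
        \<epsilon> ^ (i + 1 + i0) * l2 (\<lambda>p. F a b p * F (i - a + i0) (j - b + j0) p) \<le> 4 * B\<^sup>2"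
      if ab: "a \<le> i" "b \<le> j" for a b
    proof -
      have abs: "\<bar>F a b p\<bar> \<le> 4 * B / \<epsilon> ^ (a + 1)" for p
        using sup[of a b p] ab ij \<epsilon> by (simp add: field_simps)
      have split: "\<epsilon> ^ (i + 1 + i0) = \<epsilon> ^ (a + 1) * \<epsilon> ^ (i - a + i0)"
        using ab by (simp flip: power_add)
      have ord: "i - a + i0 + (j - b + j0) \<le> m + 2" using ab ij e by (auto simp: unit_dir_def)
      note * = l2_mult_bounded[OF jet_borel[OF F(1)] jetD(1)[OF F(1)] abs L2[of "i - a + i0" "j - b + j0"]]
      have "\<epsilon> ^ (i + 1 + i0) * l2 (\<lambda>p. F a b p * F (i - a + i0) (j - b + j0) p)
          \<le> \<epsilon> ^ (i + 1 + i0) * (4 * B / \<epsilon> ^ (a + 1) * l2 (F (i - a + i0) (j - b + j0)))"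
        using \<epsilon> by (intro mult_left_mono *) auto
      also have "\<dots> = 4 * B * (\<epsilon> ^ (i - a + i0) * l2 (F (i - a + i0) (j - b + j0)))"
        using \<epsilon> unfolding split by simp
      also have "\<dots> \<le> 4 * B * B" using B ord by (intro mult_left_mono l2) auto
      finally show ?thesis using *(1) by (simp add: power2_eq_square)
    qed
    have rows: "(\<lambda>p. \<Sum>b\<le>j. real (i choose a) * real (j choose b) * (F a b p * F (i - a + i0) (j - b + j0) p)) \<in> L2_cyl \<and>
        l2 (\<lambda>p. \<Sum>b\<le>j. real (i choose a) * real (j choose b) * (F a b p * F (i - a + i0) (j - b + j0) p))
        \<le> (\<Sum>b\<le>j. real (i choose a) * real (j choose b) * l2 (\<lambda>p. F a b p * F (i - a + i0) (j - b + j0) p))"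
      if a: "a \<le> i" for a
      using l2_sum[of "{..j}" "\<lambda>b p. real (i choose a) * real (j choose b) * (F a b p * F (i - a + i0) (j - b + j0) p)"]
        l2_cmult[OF conjunct1[OF entry[OF a]]] by auto
    have PL: "P i j = (\<lambda>p. \<Sum>a\<le>i. \<Sum>b\<le>j. real (i choose a) * real (j choose b) * (F a b p * F (i - a + i0) (j - b + j0) p))"
      by (simp add: P_def jet_mult_def fun_eq_iff)
    have mem: "P i j \<in> L2_cyl" and "l2 (P i j) \<le> (\<Sum>a\<le>i. l2 (\<lambda>p. \<Sum>b\<le>j. real (i choose a) * real (j choose b) * (F a b p * F (i - a + i0) (j - b + j0) p)))"
      unfolding PL using l2_sum[of "{..i}" "\<lambda>a p. \<Sum>b\<le>j. real (i choose a) * real (j choose b) * (F a b p * F (i - a + i0) (j - b + j0) p)"] rows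
      by auto
    note this(2)
    also have "\<dots> \<le> (\<Sum>a\<le>i. \<Sum>b\<le>j. real (i choose a) * real (j choose b) * l2 (\<lambda>p. F a b p * F (i - a + i0) (j - b + j0) p))"
      using rows by (intro sum_mono) auto
    finally have "\<epsilon> ^ (i + 1 + i0) * l2 (P i j) \<le> \<epsilon> ^ (i + 1 + i0) * \<dots>"
      using \<epsilon> by (intro mult_left_mono) auto
    also have "\<dots> = (\<Sum>a\<le>i. \<Sum>b\<le>j. real (i choose a) * real (j choose b) *
        (\<epsilon> ^ (i + 1 + i0) * l2 (\<lambda>p. F a b p * F (i - a + i0) (j - b + j0) p)))"
      by (simp only: sum_distrib_left mult.left_commute)
    also have "\<dots> \<le> (\<Sum>a\<le>i. \<Sum>b\<le>j. real (i choose a) * real (j choose b) * (4 * B\<^sup>2))"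
      using entry by (intro sum_mono mult_left_mono) auto
    also have "\<dots> = 2 ^ (i + j) * (4 * B\<^sup>2)"
      by (simp only: sum_distrib_right[symmetric] binomial_double_sum)
    finally show ?thesis using mem by simp
  qed
  have S: "f \<in> Sob k" for k using f by (simp add: Sob_inf_def)
  have pdL: "loc_integrable (pd i0 j0 f)"
    using weak_derivD(2)[OF Sob_pd(1)[OF S, of i0 j0 "i0 + j0"]] by simp
  have meas: "(\<lambda>p. f p * pd i0 j0 f p) \<in> borel_measurable borel" "theta_periodic (\<lambda>p. f p * pd i0 j0 f p)"
    using Sob_borel[OF S] pdL by (auto simp: loc_integrable_def theta_periodic_def)
  have eq: "AE p in cyl. P 0 0 p = f p * pd i0 j0 f p"
    using F(3) F(2)[of i0 j0] by eventually_elim (simp add: P_def)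
  have loc: "loc_integrable (\<lambda>p. f p * pd i0 j0 f p)"
    by (rule loc_integrable_cong_AE[OF loc_integrable_jet[OF P] meas eq])
  have weak: "weak_deriv i j (\<lambda>p. f p * pd i0 j0 f p) (P i j)" for i j
    using weak_deriv_cong_AE[OF jet_weak_deriv[OF P, of i j 0 0] loc _ eq] loc_integrable_jet[OF P] by simp
  show ?thesis
  proof (rule Hnorm_w_le(2)[where g = "\<lambda>i j p. c * P i j p"])
    show "(\<lambda>p. c * (f p * pd i0 j0 f p)) \<in> borel_measurable borel"
      "theta_periodic (\<lambda>p. c * (f p * pd i0 j0 f p))"
      using loc_integrable_cmult[OF loc, of c] by (auto simp: loc_integrable_def)
    fix i j assume ij: "i + j \<le> m"
    show "weak_deriv i j (\<lambda>p. c * (f p * pd i0 j0 f p)) (\<lambda>p. c * P i j p)"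
      by (rule weak_deriv_cmult[OF weak])
    note * = l2_cmult[OF conjunct1[OF PL2[OF ij]], of c]
    show "(\<lambda>p. c * P i j p) \<in> L2_cyl" by (rule *)
    have "\<bar>c\<bar> * l2 (P i j) \<le> K * \<epsilon> ^ (m + 1 + i0) * l2 (P i j)"
      by (intro mult_right_mono c l2_nonneg)
    also have "\<dots> \<le> K * \<epsilon> ^ (i + 1 + i0) * l2 (P i j)"
      using \<epsilon> ij K by (intro mult_right_mono mult_left_mono power_decreasing l2_nonneg) auto
    also have "\<dots> \<le> K * (2 ^ (i + j) * (4 * B\<^sup>2))"
      unfolding mult.assoc using PL2[OF ij] K by (intro mult_left_mono) (auto simp: mult.assoc)
    finally show "\<bar>1 ^ i\<bar> * l2 (\<lambda>p. c * P i j p) \<le> K * (2 ^ (i + j) * (4 * B\<^sup>2))"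
      by (simp add: *(2))
  qed
qed

lemma HT_inf0_Sob_inf:
  assumes "f \<in> HT_inf0 T" "0 \<le> t" "t \<le> T" shows "f t \<in> Sob_inf"
  using assms by (force simp: HT_inf0_def HT_def C_Sob_def Sob_inf_def)

lemma powi_le_power:
  assumes "0 < \<epsilon>" "\<epsilon> \<le> (1::real)" "int k \<le> n"
  shows "\<epsilon> powi n \<le> \<epsilon> ^ k"
proof -
  obtain l where "n = int (k + l)"
    using assms(3) zle_iff_zadd by (metis of_nat_add)
  then show ?thesis using assms by (simp add: power_int_of_nat power_decreasing del: of_nat_add)
qed

theorem proposition1p3:
  fixes \<mu> lam \<gamma> C \<delta> :: real
    and h :: "real \<Rightarrow> real"
    and m M N \<nu> :: nat
    and v0 :: "nat \<Rightarrow> vfield"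
    and S :: "nat \<Rightarrow> (nat \<Rightarrow> real \<Rightarrow> vfield) \<Rightarrow> real \<Rightarrow> real \<Rightarrow> real ^ 2"
    and vs vf :: "nat \<Rightarrow> real \<Rightarrow> vfield"
    and q0 :: "nat \<Rightarrow> field"
    and q :: "nat \<Rightarrow> real \<Rightarrow> real \<Rightarrow> field"
  assumes "\<mu> > 0" and "lam > 0" and "\<gamma> > 1" and "C = (\<gamma> - 1) / 2"
    and "circle_smooth h" and "mean_zero h"
    and "0 < \<delta>" and "\<delta> < \<mu>"
    and "M \<ge> 2" and "m \<ge> 2"
    and "2 * real \<nu> - real M - 5 / 2 - (real m + 1) - real N \<ge> 0"
    and "approx_velocities \<mu> lam h M N \<delta> v0 S vs vf"
    and "approx_pressures C h M N (v_app N vs vf) q0 q"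
  shows "\<forall>T>0. \<forall>j::2.
    (SUP \<epsilon>\<in>{0<..1}. SUP t\<in>{0..T}.
       Hnorm m (\<lambda>p. \<epsilon> powi (- int N) *
                   L_op \<mu> lam C h M \<nu> j \<epsilon> (q_app N q \<epsilon>) (v_app N vs vf \<epsilon>) t p)) < \<infinity>"
proof (intro allI impI)
  fix T :: real and j :: 2 assume T: "T > 0"
  define i0 j0 :: nat where "i0 = (if j = 1 then 1 else 0)" and "j0 = (if j = 1 then 0 else 1)"
  have e: "unit_dir i0 j0" by (simp add: unit_dir_def i0_def j0_def)
  have C: "0 \<le> C" using assms(3,4) by simp
  define V where "V = (SUP \<epsilon>\<in>{0<..1}. SUP t\<in>{0..T}.
      Hnorm m (\<lambda>p. \<epsilon> powi (- int N) * La \<mu> lam h M j \<epsilon> (v_app N vs vf \<epsilon>) t p))"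
  have V: "V < \<infinity>" using assms(12) T unfolding approx_velocities_def V_def by blast
  define Q where "Q k = (SUP \<epsilon>\<in>{0<..1}. SUP t\<in>{0..T}. Hnorm_w \<epsilon> (m + 2) (q k \<epsilon> t))" for k
  have Q: "Q k < \<infinity>" if "k \<le> N + 1" for k
    using assms(13) T that unfolding approx_pressures_def Q_def by blast
  define B where "B = enn2real (\<Sum>k\<le>N + 1. Q k)"
  have "(\<Sum>k\<le>N + 1. Q k) < \<infinity>" using Q by (simp add: less_top[symmetric])
  then have B: "ennreal B = (\<Sum>k\<le>N + 1. Q k)" "0 \<le> B"
    by (simp_all add: B_def less_top)
  define A where "A = (\<Sum>(i, j) \<in> {(i, j). i + j \<le> m}. C * (2 ^ (i + j) * (4 * B\<^sup>2)))"
  have "Hnorm m (\<lambda>p. \<epsilon> powi (- int N) * L_op \<mu> lam C h M \<nu> j \<epsilon> (q_app N q \<epsilon>) (v_app N vs vf \<epsilon>) t p) \<le> V + ennreal A"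
    if \<epsilon>: "\<epsilon> \<in> {0<..1}" and t: "t \<in> {0..T}" for \<epsilon> t
  proof -
    have \<epsilon>': "0 < \<epsilon>" "\<epsilon> \<le> 1" using \<epsilon> by auto
    let ?f = "q_app N q \<epsilon> t"
    let ?n = "2 * int \<nu> - int M - 1 - int i0"
    have qk: "q k \<epsilon> t \<in> Sob_inf" if "k \<le> N + 1" for k
      by (rule HT_inf0_Sob_inf[of _ T]) (use assms(13) that \<epsilon> t T in \<open>auto simp: approx_pressures_def\<close>)
    have sum: "Hnorm_w \<epsilon> k ?f \<le> (\<Sum>l\<le>N + 1. ennreal \<bar>\<epsilon> ^ l\<bar> * Hnorm_w \<epsilon> k (q l \<epsilon> t))" for k
      unfolding q_app_def by (rule Hnorm_w_sum) (use qk in \<open>auto simp: Sob_inf_def\<close>)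
    have f: "?f \<in> Sob_inf"
      unfolding Sob_inf_def
    proof
      fix k
      have "(\<Sum>l\<le>N + 1. ennreal \<bar>\<epsilon> ^ l\<bar> * Hnorm_w \<epsilon> k (q l \<epsilon> t)) < \<infinity>"
        using qk by (auto simp: ennreal_mult_less_top Sob_inf_def Hnorm_w_finite_iff[unfolded infinity_ennreal_def])
      with sum[of k] show "?f \<in> Sob k" unfolding Hnorm_w_finite_iff[of \<epsilon>, symmetric] by (rule order.strict_trans1)
    qed
    have "Hnorm_w \<epsilon> (m + 2) ?f \<le> (\<Sum>l\<le>N + 1. 1 * Q l)"
    proof (rule order.trans[OF sum], intro sum_mono mult_mono)
      fix l assume "l \<in> {..N + 1}"
      show "ennreal \<bar>\<epsilon> ^ l\<bar> \<le> 1" using \<epsilon>' by (simp add: power_le_one)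
      show "Hnorm_w \<epsilon> (m + 2) (q l \<epsilon> t) \<le> Q l"
        unfolding Q_def using \<epsilon> t by (intro SUP_upper2[OF \<epsilon>] SUP_upper2[OF t]) auto
    qed auto
    then have fB: "Hnorm_w \<epsilon> (m + 2) ?f \<le> ennreal B" by (simp add: B)
    let ?c = "\<epsilon> powi (- int N) * (C * \<epsilon> powi ?n)"
    have "\<bar>?c\<bar> = C * \<epsilon> powi (?n - int N)"
      using \<epsilon>' C by (simp add: abs_mult power_int_add[symmetric])
    also have "\<dots> \<le> C * \<epsilon> ^ (m + 1 + i0)"
      \<comment> \<open>The assumption contains a half-integer, so the inequality between the integer exponents gains
        1/2; this is needed for the derivative in the angle.\<close>
      using assms(11) by (intro mult_left_mono powi_le_power \<epsilon>' C) (auto simp: i0_def)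
    finally have c: "\<bar>?c\<bar> \<le> C * \<epsilon> ^ (m + 1 + i0)" .
    have quad: "Hnorm m (\<lambda>p. ?c * (?f p * pd i0 j0 ?f p)) \<le> ennreal A"
      unfolding A_def by (rule Hnorm_quadratic_bound[OF \<epsilon>' f fB B(2) e c C])
    have lin: "Hnorm m (\<lambda>p. \<epsilon> powi (- int N) * La \<mu> lam h M j \<epsilon> (v_app N vs vf \<epsilon>) t p) \<le> V"
      unfolding V_def using \<epsilon> t by (intro SUP_upper2[OF \<epsilon>] SUP_upper2[OF t]) auto
    have "(\<lambda>p. \<epsilon> powi (- int N) * L_op \<mu> lam C h M \<nu> j \<epsilon> (q_app N q \<epsilon>) (v_app N vs vf \<epsilon>) t p)
        = (\<lambda>p. \<epsilon> powi (- int N) * La \<mu> lam h M j \<epsilon> (v_app N vs vf \<epsilon>) t p + ?c * (?f p * pd i0 j0 ?f p))"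
      by (cases "j = 1") (auto simp: L_op_def i0_def j0_def algebra_simps fun_eq_iff)
    then show ?thesis
      using order.trans[OF Hnorm_w_add add_mono[OF lin quad]] by simp
  qed
  then have "(SUP \<epsilon>\<in>{0<..1}. SUP t\<in>{0..T}. Hnorm m (\<lambda>p. \<epsilon> powi (- int N) *
      L_op \<mu> lam C h M \<nu> j \<epsilon> (q_app N q \<epsilon>) (v_app N vs vf \<epsilon>) t p)) \<le> V + ennreal A"
    by (intro SUP_least)
  also have "\<dots> < \<infinity>" using V by simp
  finally show "(SUP \<epsilon>\<in>{0<..1}. SUP t\<in>{0..T}. Hnorm m (\<lambda>p. \<epsilon> powi (- int N) *
      L_op \<mu> lam C h M \<nu> j \<epsilon> (q_app N q \<epsilon>) (v_app N vs vf \<epsilon>) t p)) < \<infinity>" .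
qed

end
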